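(* Let $M$ be a connected orientable smooth manifold of dimension $4$, let $g$ be a continuous pseudo-Riemannian metric on $M$ with index $(-+++)$, let $\iota(g)\in\hat{\mathcal G}(M)^0_2$ be its embedding into the Colombeau algebra, and let $T\in\hat{\mathcal G}(M)^0_2$ (the stress-energy tensor). Let $(U,\psi)$ be a chart of $M$, with coordinates indexed by $0,1,2,3$, in which both $T$ and $\iota(g)$ are diagonal. Then, in this coordinate system, $$\forall X\in\hat{\mathcal L}^1_0(U):\ T(X,X)\ge 0 \quad\Longleftrightarrow\quad \forall \nu\in\{1,2,3\}:\ T_{00}\,\iota(g_{\nu\nu})-T_{\nu\nu}\,\iota(g_{00})\ \ge\ 0 \ \text{ on } U,$$ where $\hat{\mathcal L}^1_0(U)$ is the set of generalized lightlike vector fields on $U$ and $\ge 0$ denotes non-negativity in the Colombeau algebra $\hat{\mathcal G}(U)$.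
   Context: Colombeau algebra. Let $N$ be a smooth oriented $n$-manifold (here $N=M$ or an open subset of $M$), $\Omega^n_c(N)$ the smooth compactly supported $n$-forms, $\mathcal T^r_s(N)$ the smooth tensor fields of rank $(r,s)$, $\mathfrak X(N)$ the smooth vector fields, and $\|\cdot\|$ a norm on tensors induced by any Riemannian metric. For nets $(u_\varepsilon)_{\varepsilon\in(0,1]}\subset\mathcal T^r_s(N)$: - $(u_\varepsilon)_\varepsilon$ is moderate, $(u_\varepsilon)_\varepsilon\in\hat{\mathcal E}_m(N)^r_s$, if for all compact $K\subset N$ and $k\in\mathbb N_0$ there is $m\in\mathbb N$ such that for all $X_1,\dots,X_k\in\mathfrak X(N)$, $\sup_{x\in K}\|\mathcal L_{X_1}\cdots\mathcal L_{X_k}u_\varepsilon(x)\|=O(\varepsilon^{-m})$ as $\varepsilon\to0$ ($\mathcal L$ = Lie derivative); - $(u_\varepsilon)_\varepsilon$ is negligible, $(u_\varepsilon)_\varepsilon\in\hat{\mathcal N}(N)^r_s$, if for all compact $K$, all $k,m\in\mathbb N_0$ and all $X_1,\dots,X_k\in\mathfrak X(N)$ this supremum is $O(\varepsilon^m)$. $\hat{\mathcal G}(N)^r_s:=\hat{\mathcal E}_m(N)^r_s/\hat{\mathcal N}(N)^r_s$ (also written $\hat{\mathcal G}^r_s(N)$), $\hat{\mathcal G}(N):=\hat{\mathcal G}(N)^0_0$. Sums, tensor products, contractions and Lie derivatives are defined $\varepsilon$-wise on representatives. All equalities of generalized objects are equalities in these quotients; "diagonal in $(U,\psi)$" means the off-diagonal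 components vanish. For $X=X^i\partial_i$, $T(X,X)=T_{ij}X^iX^j$. Admissible mollifier. A fixed net $\rho_\varepsilon=\varepsilon^{-n}\psi_\varepsilon(\cdot/\varepsilon)$, where $\psi_\varepsilon\in C_c^\infty(\mathbb R^n)$, $\varepsilon\in(0,1]$, satisfies: $\operatorname{supp}\psi_\varepsilon\subset B_1(0)$; $\int\psi_\varepsilon=1$; for every multi-index $\alpha$ there is $p\in\mathbb R$ with $\sup|\partial^\alpha\psi_\varepsilon|=O(\varepsilon^{-p})$ as $\varepsilon\to0$; for every $j\in\mathbb N$ there is $\varepsilon_0$ such that $\int x^\alpha\psi_\varepsilon\,dx=0$ for all $1\le|\alpha|\le j$, $\varepsilon\le\varepsilon_0$; for every $\nu>0$ there is $\varepsilon_0$ with $\int|\psi_\varepsilon|\,dx\le1+\nu$ for $\varepsilon\le\varepsilon_0$. Embedding. $M$ is assumed to have global coordinates, identifying it with an open subset of $\mathbb R^n$ ($n=4$). The embedding $\iota$ mollifies components with respect to these coordinates: each component $L$ is replaced by $L*\rho_\varepsilon$ (on a relatively compact open $V$, by $(\chi L)*\rho_\varepsilon$ with $\chi\in C^\infty_c(M)$, $\chi=1$ near $\overline V$; for small $\varepsilon$ this does not depend on $\chi$). $\iota(g)$ is a generalized pseudo-Riemannian metric with inverse $\iota(g)^{-1}$. The notation $\iota(g_{ij})$ stands for the components $\iota(g)_{ij}$ of $\iota(g)$ in the coordinates used. The coordinate with index $0$ is the time coordinate and those with indices $1,2,3$ are spatial. Non-negativity. For $u=[(u_\varepsilon)_\varepsilon]\in\hat{\mathcal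 G}(N)$, $u\ge0$ means $\lim_{\varepsilon\to0^+}\int_N(u_\varepsilon)_-\,w=0$ for all $w\in\Omega^n_c(N)$, where $(f)_-:=\min(f,0)$ (negative part, with negative values). This does not depend on the representative. Generalized lightlike vector fields. $\hat{\mathcal L}^1_0(U)$ is the set of $X\in\hat{\mathcal G}(U)^1_0$ such that (1) $\iota(g)(X,X)=\iota(g)_{ij}X^iX^j=0$ in $\hat{\mathcal G}(U)$; and (2) for every chart $(W,\phi)$ of $U$ with coordinate fields $\partial_i$, writing $X=\sum_iX^i\partial_i$ on $W$, one has: for all $L\in\hat{\mathcal G}(W)$ with $L\ge0$ and every index $i$, $(X^i)^2L\ge0$ in $\hat{\mathcal G}(W)$. *)

theory Defs
  imports "HOL-Analysis.Analysis"
begin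

text \<open>
  The manifold \<open>M\<close> is an open connected subset of \<open>\<real>\<^sup>4\<close> (global coordinates); the index type \<open>4\<close>
  has the elements \<open>0, 1, 2, 3\<close>. Tensor fields on open subsets of \<open>\<real>\<^sup>4\<close> are given by
  their components in the global coordinates: scalars are real functions, vector fields are
  functions into \<open>real ^ 4\<close>, and tensor fields of rank \<open>(0,2)\<close> are functions into
  \<open>real ^ 4 ^ 4\<close>, with \<open>A $ i $ j\<close> the component \<open>A\<^sub>i\<^sub>j\<close>.
  Functions are total; only their values on the open set in question matter.
\<close>

type_synonym pt = "real ^ 4"
type_synonym tensor02 = "real ^ 4 ^ 4"
type_synonym 'b net = "real \<Rightarrow> pt \<Rightarrow> 'b"

section \<open>Smooth functions and charts\<close>

primrec times_differentiable_on ::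
    "nat \<Rightarrow> 'a::real_normed_vector set \<Rightarrow> ('a \<Rightarrow> 'b::real_normed_vector) \<Rightarrow> bool" where
  "times_differentiable_on 0 N f \<longleftrightarrow> continuous_on N f"
| "times_differentiable_on (Suc k) N f \<longleftrightarrow>
     (\<forall>x\<in>N. f differentiable (at x)) \<and>
     (\<forall>v. times_differentiable_on k N (\<lambda>x. frechet_derivative f (at x) v))"

text \<open>Used for open sets \<open>N\<close> only.\<close>

definition smooth_on ::
    "'a::real_normed_vector set \<Rightarrow> ('a \<Rightarrow> 'b::real_normed_vector) \<Rightarrow> bool" where
  "smooth_on N f \<longleftrightarrow> (\<forall>k. times_differentiable_on k N f)"

definition supp :: "('a::topological_space \<Rightarrow> real) \<Rightarrow> 'a set" where
  "supp f = closure {x. f x \<noteq> 0}"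

text \<open>\<open>C\<^sub>c\<^sup>\<infinity>(N)\<close>, its elements being extended by \<open>0\<close> outside \<open>N\<close>.\<close>

definition test_function :: "pt set \<Rightarrow> (pt \<Rightarrow> real) \<Rightarrow> bool" where
  "test_function N f \<longleftrightarrow> smooth_on UNIV f \<and> compact (supp f) \<and> supp f \<subseteq> N"

definition chart :: "pt set \<Rightarrow> pt set \<Rightarrow> (pt \<Rightarrow> pt) \<Rightarrow> bool" where
  "chart N W \<phi> \<longleftrightarrow> open W \<and> W \<subseteq> N \<and> inj_on \<phi> W \<and> open (\<phi> ` W) \<and>
     smooth_on W \<phi> \<and> smooth_on (\<phi> ` W) (inv_into W \<phi>)"

text \<open>The coordinate field \<open>\<partial>\<^sub>i\<close> of the chart \<open>(W, \<phi>)\<close>, expressed in the global coordinates.\<close>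

definition coord_field :: "pt set \<Rightarrow> (pt \<Rightarrow> pt) \<Rightarrow> 4 \<Rightarrow> pt \<Rightarrow> pt" where
  "coord_field W \<phi> i x = frechet_derivative (inv_into W \<phi>) (at (\<phi> x)) (axis i 1)"

definition bilin :: "tensor02 \<Rightarrow> pt \<Rightarrow> pt \<Rightarrow> real" where
  "bilin A v w = (\<Sum>i\<in>UNIV. \<Sum>j\<in>UNIV. A $ i $ j * v $ i * w $ j)"

section \<open>Lie derivatives of scalars, vector fields and \<open>(0,2)\<close>-tensor fields\<close>

definition lie0 :: "(pt \<Rightarrow> pt) \<Rightarrow> (pt \<Rightarrow> real) \<Rightarrow> pt \<Rightarrow> real" where
  "lie0 X f x = frechet_derivative f (at x) (X x)"

definition lie1 :: "(pt \<Rightarrow> pt) \<Rightarrow> (pt \<Rightarrow> pt) \<Rightarrow> pt \<Rightarrow> pt" where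
  "lie1 X Y x = frechet_derivative Y (at x) (X x) - frechet_derivative X (at x) (Y x)"

text \<open>In components,
  \<open>(L\<^sub>X S)\<^sub>i\<^sub>j = X\<^sup>k \<partial>\<^sub>k S\<^sub>i\<^sub>j + (\<partial>\<^sub>i X\<^sup>k) S\<^sub>k\<^sub>j + (\<partial>\<^sub>j X\<^sup>k) S\<^sub>i\<^sub>k\<close>.\<close>

definition lie2 :: "(pt \<Rightarrow> pt) \<Rightarrow> (pt \<Rightarrow> tensor02) \<Rightarrow> pt \<Rightarrow> tensor02" where
  "lie2 X S x = (let J = matrix (frechet_derivative X (at x)) in
     frechet_derivative S (at x) (X x) + transpose J ** S x + S x ** J)"

section \<open>The Colombeau algebra\<close>

text \<open>\<open>sup\<^sub>x\<^sub>\<in>\<^sub>K \<parallel>f\<^sub>\<epsilon>(x)\<parallel> = O(\<epsilon>\<^sup>r)\<close> as \<open>\<epsilon> \<rightarrow> 0\<close>, spelled out so that it also makes sense for \<open>K = {}\<close>,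
  where the real supremum is unspecified.\<close>

definition sup_bigo :: "'a set \<Rightarrow> (real \<Rightarrow> 'a \<Rightarrow> 'b::real_normed_vector) \<Rightarrow> real \<Rightarrow> bool" where
  "sup_bigo K f r \<longleftrightarrow>
     (\<exists>C. \<forall>\<^sub>F \<epsilon> in at_right 0. \<forall>x\<in>K. norm (f \<epsilon> x) \<le> C * \<epsilon> powr r)"

definition smooth_net :: "pt set \<Rightarrow> 'b::real_normed_vector net \<Rightarrow> bool" where
  "smooth_net N u \<longleftrightarrow> (\<forall>\<epsilon>\<in>{0<..1}. smooth_on N (u \<epsilon>))"

text \<open>The parameter \<open>D\<close> is the Lie derivative for the rank in question: \<open>lie0\<close>, \<open>lie1\<close> or \<open>lie2\<close>.
  The norm is the one induced by the Euclidean metric, i.e. the Euclidean norm of the components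
  in the global coordinates. A list \<open>Xs = [X\<^sub>1, \<dots>, X\<^sub>k]\<close> stands for \<open>L\<^sub>X\<^sub>1 \<dots> L\<^sub>X\<^sub>k\<close>.\<close>

definition moderate ::
    "((pt \<Rightarrow> pt) \<Rightarrow> (pt \<Rightarrow> 'b) \<Rightarrow> (pt \<Rightarrow> 'b)) \<Rightarrow> pt set \<Rightarrow> 'b::real_normed_vector net set" where
  "moderate D N = {u. smooth_net N u \<and>
     (\<forall>K k. compact K \<and> K \<subseteq> N \<longrightarrow>
       (\<exists>m::nat. \<forall>Xs. length Xs = k \<and> (\<forall>X\<in>set Xs. smooth_on N X) \<longrightarrow>
         sup_bigo K (\<lambda>\<epsilon>. foldr D Xs (u \<epsilon>)) (- real m)))}"

definition negligible_nets ::
    "((pt \<Rightarrow> pt) \<Rightarrow> (pt \<Rightarrow> 'b) \<Rightarrow> (pt \<Rightarrow> 'b)) \<Rightarrow> pt set \<Rightarrow> 'b::real_normed_vector net set" where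
  "negligible_nets D N = {u. smooth_net N u \<and>
     (\<forall>K k m::nat. compact K \<and> K \<subseteq> N \<longrightarrow>
       (\<forall>Xs. length Xs = k \<and> (\<forall>X\<in>set Xs. smooth_on N X) \<longrightarrow>
         sup_bigo K (\<lambda>\<epsilon>. foldr D Xs (u \<epsilon>)) (real m)))}"

definition colombeau_rel ::
    "((pt \<Rightarrow> pt) \<Rightarrow> (pt \<Rightarrow> 'b) \<Rightarrow> (pt \<Rightarrow> 'b)) \<Rightarrow> pt set \<Rightarrow> 'b::real_normed_vector net rel" where
  "colombeau_rel D N = {(u, v). u \<in> moderate D N \<and> v \<in> moderate D N \<and>
     (\<lambda>\<epsilon> x. u \<epsilon> x - v \<epsilon> x) \<in> negligible_nets D N}"

definition colombeau ::
    "((pt \<Rightarrow> pt) \<Rightarrow> (pt \<Rightarrow> 'b) \<Rightarrow> (pt \<Rightarrow> 'b)) \<Rightarrow> pt set \<Rightarrow> 'b::real_normed_vector net set set" where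
  "colombeau D N = moderate D N // colombeau_rel D N"

abbreviation "G00 \<equiv> colombeau lie0"
abbreviation "G10 \<equiv> colombeau lie1"
abbreviation "G02 \<equiv> colombeau lie2"

subsection \<open>Operations, defined \<open>\<epsilon>\<close>-wise on representatives\<close>

text \<open>All results are scalars, i.e. elements of \<open>G00 N\<close>. The arguments may be generalized objects
  on any open set containing \<open>N\<close>; they are then implicitly restricted to \<open>N\<close>.\<close>

definition gzero :: "pt set \<Rightarrow> real net set" where
  "gzero N = colombeau_rel lie0 N `` {\<lambda>\<epsilon> x. 0}"

definition gmult :: "pt set \<Rightarrow> real net set \<Rightarrow> real net set \<Rightarrow> real net set" where
  "gmult N A B = (\<Union>a\<in>A. \<Union>b\<in>B. colombeau_rel lie0 N `` {\<lambda>\<epsilon> x. a \<epsilon> x * b \<epsilon> x})"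

definition gdiff :: "pt set \<Rightarrow> real net set \<Rightarrow> real net set \<Rightarrow> real net set" where
  "gdiff N A B = (\<Union>a\<in>A. \<Union>b\<in>B. colombeau_rel lie0 N `` {\<lambda>\<epsilon> x. a \<epsilon> x - b \<epsilon> x})"

text \<open>\<open>S(X, Y) = S\<^sub>i\<^sub>j X\<^sup>i Y\<^sup>j\<close>.\<close>

definition geval2 :: "pt set \<Rightarrow> tensor02 net set \<Rightarrow> pt net set \<Rightarrow> pt net set \<Rightarrow> real net set" where
  "geval2 N S X Y = (\<Union>s\<in>S. \<Union>v\<in>X. \<Union>w\<in>Y.
     colombeau_rel lie0 N `` {\<lambda>\<epsilon> x. bilin (s \<epsilon> x) (v \<epsilon> x) (w \<epsilon> x)})"

text \<open>Components \<open>S\<^sub>i\<^sub>j = S(\<partial>\<^sub>i, \<partial>\<^sub>j)\<close> and \<open>X\<^sup>i = d\<phi>\<^sup>i(X)\<close> in the chart \<open>(W, \<phi>)\<close>, as elements of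
  \<open>G00 W\<close>.\<close>

definition gcomp2 :: "pt set \<Rightarrow> (pt \<Rightarrow> pt) \<Rightarrow> tensor02 net set \<Rightarrow> 4 \<Rightarrow> 4 \<Rightarrow> real net set" where
  "gcomp2 W \<phi> S i j = (\<Union>s\<in>S. colombeau_rel lie0 W ``
     {\<lambda>\<epsilon> x. bilin (s \<epsilon> x) (coord_field W \<phi> i x) (coord_field W \<phi> j x)})"

definition gcomp1 :: "pt set \<Rightarrow> (pt \<Rightarrow> pt) \<Rightarrow> pt net set \<Rightarrow> 4 \<Rightarrow> real net set" where
  "gcomp1 W \<phi> X i = (\<Union>v\<in>X. colombeau_rel lie0 W ``
     {\<lambda>\<epsilon> x. frechet_derivative \<phi> (at x) (v \<epsilon> x) $ i})"

definition gdiagonal :: "pt set \<Rightarrow> (pt \<Rightarrow> pt) \<Rightarrow> tensor02 net set \<Rightarrow> bool" where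
  "gdiagonal W \<phi> S \<longleftrightarrow> (\<forall>i j. i \<noteq> j \<longrightarrow> gcomp2 W \<phi> S i j = gzero W)"

subsection \<open>Non-negativity\<close>

text \<open>A compactly supported \<open>4\<close>-form \<open>w dx\<^sup>0 \<and> dx\<^sup>1 \<and> dx\<^sup>2 \<and> dx\<^sup>3\<close> on \<open>N\<close> is given by its
  coefficient \<open>w\<close> in the global coordinates. The condition does not depend on the representative
  or on the orientation.\<close>

definition gnonneg :: "pt set \<Rightarrow> real net set \<Rightarrow> bool" where
  "gnonneg N A \<longleftrightarrow> (\<exists>u\<in>A. \<forall>w. test_function N w \<longrightarrow>
     ((\<lambda>\<epsilon>. LINT x:N|lborel. min (u \<epsilon> x) 0 * w x) \<longlongrightarrow> 0) (at_right 0))"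

section \<open>Mollifiers and the embedding of continuous metrics\<close>

definition partial :: "4 \<Rightarrow> (pt \<Rightarrow> real) \<Rightarrow> pt \<Rightarrow> real" where
  "partial i f x = frechet_derivative f (at x) (axis i 1)"

definition multi_partial :: "(4 \<Rightarrow> nat) \<Rightarrow> (pt \<Rightarrow> real) \<Rightarrow> pt \<Rightarrow> real" where
  "multi_partial \<alpha> f =
     (partial 0 ^^ \<alpha> 0) ((partial 1 ^^ \<alpha> 1) ((partial 2 ^^ \<alpha> 2) ((partial 3 ^^ \<alpha> 3) f)))"

definition admissible_mollifier :: "real net \<Rightarrow> bool" where
  "admissible_mollifier \<psi> \<longleftrightarrow>
     (\<forall>\<epsilon>\<in>{0<..1}. smooth_on UNIV (\<psi> \<epsilon>) \<and> supp (\<psi> \<epsilon>) \<subseteq> ball 0 1 \<and>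
        (LINT x|lborel. \<psi> \<epsilon> x) = 1) \<and>
     (\<forall>\<alpha>. \<exists>p::real. sup_bigo UNIV (\<lambda>\<epsilon>. multi_partial \<alpha> (\<psi> \<epsilon>)) (- p)) \<and>
     (\<forall>j::nat. \<exists>\<epsilon>\<^sub>0>0. \<forall>\<alpha> \<epsilon>. 1 \<le> sum \<alpha> UNIV \<and> sum \<alpha> UNIV \<le> j \<and> \<epsilon> \<in> {0<..1} \<and> \<epsilon> \<le> \<epsilon>\<^sub>0 \<longrightarrow>
        (LINT x|lborel. (\<Prod>i\<in>UNIV. (x $ i) ^ \<alpha> i) * \<psi> \<epsilon> x) = 0) \<and>
     (\<forall>\<nu>>0. \<exists>\<epsilon>\<^sub>0>0. \<forall>\<epsilon>\<in>{0<..1}. \<epsilon> \<le> \<epsilon>\<^sub>0 \<longrightarrow> (LINT x|lborel. \<bar>\<psi> \<epsilon> x\<bar>) \<le> 1 + \<nu>)"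

definition rho :: "real net \<Rightarrow> real net" where
  "rho \<psi> \<epsilon> x = \<psi> \<epsilon> (x /\<^sub>R \<epsilon>) / \<epsilon> ^ 4"

definition convolve :: "(pt \<Rightarrow> real) \<Rightarrow> (pt \<Rightarrow> real) \<Rightarrow> pt \<Rightarrow> real" where
  "convolve f r x = (LINT y|lborel. f y * r (x - y))"

text \<open>\<open>\<iota>(g)\<close> is the class of nets on \<open>M\<close> whose restriction to each relatively compact open \<open>V\<close>
  represents \<open>((c g\<^sub>i\<^sub>j) * \<rho>\<^sub>\<epsilon>)\<^sub>\<epsilon>\<close> for the cut-off functions \<open>c \<in> C\<^sub>c\<^sup>\<infinity>(M)\<close> with \<open>c = 1\<close> near the
  closure of \<open>V\<close>. By the sheaf property this determines a unique element of \<open>G02 M\<close>. (The plain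
  convolution \<open>g\<^sub>i\<^sub>j * \<rho>\<^sub>\<epsilon>\<close> need not be defined on all of \<open>M\<close>.)\<close>

definition iota :: "real net \<Rightarrow> pt set \<Rightarrow> (pt \<Rightarrow> tensor02) \<Rightarrow> tensor02 net set" where
  "iota \<psi> M g = {u \<in> moderate lie2 M. \<forall>V c.
     open V \<and> compact (closure V) \<and> closure V \<subseteq> M \<and> test_function M c \<and>
     (\<exists>Q. open Q \<and> closure V \<subseteq> Q \<and> (\<forall>x\<in>Q. c x = 1)) \<longrightarrow>
     (\<lambda>\<epsilon> x. u \<epsilon> x - (\<chi> i j. convolve (\<lambda>y. c y * g y $ i $ j) (rho \<psi> \<epsilon>) x))
       \<in> negligible_nets lie2 V}"

text \<open>\<open>A\<close> is symmetric with normal form \<open>diag(-1, 1, 1, 1)\<close>.\<close>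

definition lorentzian :: "tensor02 \<Rightarrow> bool" where
  "lorentzian A \<longleftrightarrow> transpose A = A \<and> (\<exists>B :: real ^ 4 ^ 4. invertible B \<and>
     transpose B ** A ** B = (\<chi> i j. if i \<noteq> j then 0 else if i = 0 then - 1 else 1))"

definition continuous_lorentz_metric :: "pt set \<Rightarrow> (pt \<Rightarrow> tensor02) \<Rightarrow> bool" where
  "continuous_lorentz_metric M g \<longleftrightarrow> continuous_on M g \<and> (\<forall>x\<in>M. lorentzian (g x))"

text \<open>The coordinate \<open>0\<close> of the chart is the time coordinate, the others are spatial.\<close>

definition time_space_coordinates :: "pt set \<Rightarrow> (pt \<Rightarrow> pt) \<Rightarrow> (pt \<Rightarrow> tensor02) \<Rightarrow> bool" where
  "time_space_coordinates W \<phi> g \<longleftrightarrow> (\<forall>x\<in>W.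
     bilin (g x) (coord_field W \<phi> 0 x) (coord_field W \<phi> 0 x) < 0 \<and>
     (\<forall>\<nu>\<in>{1, 2, 3}. bilin (g x) (coord_field W \<phi> \<nu> x) (coord_field W \<phi> \<nu> x) > 0))"

section \<open>Generalized lightlike vector fields\<close>

definition lightlike_fields :: "tensor02 net set \<Rightarrow> pt set \<Rightarrow> pt net set set" where
  "lightlike_fields h U = {X \<in> G10 U.
     geval2 U h X X = gzero U \<and>
     (\<forall>W \<phi>. chart U W \<phi> \<longrightarrow>
       (\<forall>L\<in>G00 W. gnonneg W L \<longrightarrow>
         (\<forall>i. gnonneg W (gmult W (gmult W (gcomp1 W \<phi> X i) (gcomp1 W \<phi> X i)) L))))}"

end

theory Submission
  imports Defs
begin

text \<open>
  Write \<open>g\<^sub>i\<^sub>j\<close> and \<open>T\<^sub>i\<^sub>j\<close> for the components of the embedded metric and of \<open>T\<close> in the given chart. Both are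
  diagonal, so for \<open>X = X\<^sup>i \<partial>\<^sub>i\<close> one has \<open>T(X,X) = \<Sum>\<^sub>i T\<^sub>i\<^sub>i (X\<^sup>i)\<^sup>2\<close> and \<open>g(X,X) = \<Sum>\<^sub>i g\<^sub>i\<^sub>i (X\<^sup>i)\<^sup>2\<close>. Put
  \<open>L\<^sub>\<nu> = T\<^sub>0\<^sub>0 g\<^sub>\<nu>\<^sub>\<nu> - T\<^sub>\<nu>\<^sub>\<nu> g\<^sub>0\<^sub>0\<close> for a spatial index \<open>\<nu>\<close>.

  If \<open>T(X,X) \<ge> 0\<close> for all lightlike \<open>X\<close>, take \<open>X = g\<^sub>\<nu>\<^sub>\<nu>\<^sup>1\<^sup>/\<^sup>2 \<partial>\<^sub>0 + (- g\<^sub>0\<^sub>0)\<^sup>1\<^sup>/\<^sup>2 \<partial>\<^sub>\<nu>\<close>: then \<open>g(X,X) = 0\<close> and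
  \<open>T(X,X) = L\<^sub>\<nu>\<close>. The field is bounded on compact sets, which gives the second requirement on lightlike fields
  (\<open>locally_bounded_field_preserves_nonneg\<close>). Conversely, if \<open>X\<close> is lightlike, eliminating \<open>(X\<^sup>0)\<^sup>2\<close> with
  \<open>g(X,X) = 0\<close> yields \<open>- g\<^sub>0\<^sub>0 T(X,X) = \<Sum>\<^sub>\<nu> (X\<^sup>\<nu>)\<^sup>2 L\<^sub>\<nu>\<close>. The terms on the right are non-negative by the second
  requirement, applied to \<open>L\<^sub>\<nu>\<close>, and one may divide by \<open>- g\<^sub>0\<^sub>0\<close>.

  Three analytic facts make these computations legitimate. The metric is continuous, so its mollifications converge
  uniformly on compact sets (\<open>iota_tendsto_uniformly\<close>); therefore \<open>g\<^sub>\<nu>\<^sub>\<nu>\<close> and \<open>- g\<^sub>0\<^sub>0\<close> lie between positive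
  constants there once \<open>\<epsilon>\<close> is small. Such a generalized function has a square root
  (\<open>square_root_net\<close>), although no member of the net has to be positive on the whole chart domain.
  Non-negativity means \<open>L\<^sup>1\<close> convergence of the negative parts to zero on compact sets
  (\<open>gnonneg_net_class\<close>) and is thus stable under negligible changes, sums, and multiplication or division by
  locally bounded factors (\<open>nonneg_net_lower_bound\<close>).

  The algebra rests on a description of moderate and negligible nets by derivatives along constant
  directions, which is the same for every rank (\<open>moderate_lie\<close>, \<open>negligible_lie\<close>).
\<close>

section \<open>Calculus of smooth functions\<close>

text \<open>The derivative of \<open>f\<close> in the fixed direction \<open>v\<close>, as a function of the point: the operator that
  \<open>times_differentiable_on\<close> iterates.\<close>

definition dirderiv :: "'a \<Rightarrow> ('a::real_normed_vector \<Rightarrow> 'b::real_normed_vector) \<Rightarrow> 'a \<Rightarrow> 'b" where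
  "dirderiv v f x = frechet_derivative f (at x) v"

lemma times_differentiable_on_Suc:
  "times_differentiable_on (Suc k) N f \<longleftrightarrow>
     (\<forall>x\<in>N. f differentiable (at x)) \<and> (\<forall>v. times_differentiable_on k N (dirderiv v f))"
  by (simp add: dirderiv_def[abs_def])

declare times_differentiable_on.simps(2) [simp del]

lemma dirderiv_eq: "(f has_derivative f') (at x) \<Longrightarrow> dirderiv v f x = f' v"
  unfolding dirderiv_def by (metis frechet_derivative_at)

lemma has_derivative_dirderiv:
  "f differentiable (at x) \<Longrightarrow> (f has_derivative (\<lambda>v. dirderiv v f x)) (at x)"
  unfolding dirderiv_def by (simp add: frechet_derivative_works[symmetric])

lemma differentiable_cong_open:
  assumes "open N" "x \<in> N" "\<And>y. y \<in> N \<Longrightarrow> f y = g y"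
  shows "f differentiable (at x) \<longleftrightarrow> g differentiable (at x)"
  using assms unfolding differentiable_def
  by (metis (no_types, lifting) has_derivative_transform_within_open)

lemma dirderiv_cong_open:
  assumes "open N" "x \<in> N" "\<And>y. y \<in> N \<Longrightarrow> f y = g y"
  shows "dirderiv v f x = dirderiv v g x"
proof -
  have "(f has_derivative f') (at x) \<longleftrightarrow> (g has_derivative f') (at x)" for f'
    using assms by (metis (no_types, lifting) has_derivative_transform_within_open)
  then show ?thesis by (simp add: dirderiv_def frechet_derivative_def)
qed

lemma times_differentiable_on_cong:
  assumes "open N" "\<And>y. y \<in> N \<Longrightarrow> f y = g y"
  shows "times_differentiable_on k N f \<longleftrightarrow> times_differentiable_on k N g"
  using assms(2)
proof (induction k arbitrary: f g)
  case 0
  then show ?case by (simp cong: continuous_on_cong)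
next
  case (Suc k)
  have "times_differentiable_on k N (dirderiv v f) \<longleftrightarrow> times_differentiable_on k N (dirderiv v g)" for v
    by (rule Suc.IH) (use assms(1) Suc.prems in \<open>auto intro: dirderiv_cong_open\<close>)
  moreover have "f differentiable (at x) \<longleftrightarrow> g differentiable (at x)" if "x \<in> N" for x
    using differentiable_cong_open[OF assms(1) that] Suc.prems by blast
  ultimately show ?case by (simp add: times_differentiable_on_Suc)
qed

lemma times_differentiable_on_SucD:
  "times_differentiable_on (Suc k) N f \<Longrightarrow> times_differentiable_on k N f"
proof (induction k arbitrary: f)
  case 0
  then show ?case
    by (auto simp: times_differentiable_on_Suc differentiable_imp_continuous_within
        intro!: continuous_at_imp_continuous_on)
next
  case (Suc k)
  then show ?case by (metis times_differentiable_on_Suc)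
qed

lemma times_differentiable_on_const: "times_differentiable_on k N (\<lambda>x. c)"
proof (induction k arbitrary: c)
  case (Suc k)
  have "dirderiv v (\<lambda>x. c) = (\<lambda>x. 0)" for v :: 'a
    by (rule ext, rule dirderiv_eq[OF has_derivative_const])
  then show ?case by (simp add: times_differentiable_on_Suc Suc)
qed simp

lemma times_differentiable_on_linear:
  assumes "open N" "bounded_linear h" "times_differentiable_on k N f"
  shows "times_differentiable_on k N (\<lambda>x. h (f x))"
  using assms(3)
proof (induction k arbitrary: f)
  case 0
  then show ?case
    using bounded_linear.continuous_on[OF assms(2)] by auto
next
  case (Suc k)
  have hd: "((\<lambda>x. h (f x)) has_derivative (\<lambda>v. h (dirderiv v f x))) (at x)" if "x \<in> N" for x
    using that Suc.prems
    by (intro bounded_linear.has_derivative[OF assms(2)] has_derivative_dirderiv)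
       (auto simp: times_differentiable_on_Suc)
  have "times_differentiable_on k N (dirderiv v (\<lambda>x. h (f x)))" for v
  proof (subst times_differentiable_on_cong[OF assms(1)])
    show "dirderiv v (\<lambda>x. h (f x)) y = h (dirderiv v f y)" if "y \<in> N" for y
      using dirderiv_eq[OF hd[OF that]] .
    show "times_differentiable_on k N (\<lambda>y. h (dirderiv v f y))"
      using Suc by (auto simp: times_differentiable_on_Suc)
  qed
  with hd show ?case by (auto simp: times_differentiable_on_Suc differentiable_def)
qed

lemma times_differentiable_on_add:
  assumes "open N" "times_differentiable_on k N f" "times_differentiable_on k N g"
  shows "times_differentiable_on k N (\<lambda>x. f x + g x)"
  using assms(2,3)
proof (induction k arbitrary: f g)
  case 0
  then show ?case by (auto intro: continuous_on_add)
next
  case (Suc k)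
  have hd: "((\<lambda>x. f x + g x) has_derivative (\<lambda>v. dirderiv v f x + dirderiv v g x)) (at x)" if "x \<in> N" for x
    using that Suc.prems
    by (intro has_derivative_add has_derivative_dirderiv) (auto simp: times_differentiable_on_Suc)
  have "times_differentiable_on k N (dirderiv v (\<lambda>x. f x + g x))" for v
  proof (subst times_differentiable_on_cong[OF assms(1)])
    show "dirderiv v (\<lambda>x. f x + g x) y = dirderiv v f y + dirderiv v g y" if "y \<in> N" for y
      using dirderiv_eq[OF hd[OF that]] .
    show "times_differentiable_on k N (\<lambda>y. dirderiv v f y + dirderiv v g y)"
      using Suc by (auto simp: times_differentiable_on_Suc)
  qed
  with hd show ?case by (auto simp: times_differentiable_on_Suc differentiable_def)
qed

lemma has_derivative_bilinear_dirderiv: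
  assumes "bounded_bilinear p" "f differentiable (at x)" "g differentiable (at x)"
  shows "((\<lambda>x. p (f x) (g x)) has_derivative (\<lambda>v. p (f x) (dirderiv v g x) + p (dirderiv v f x) (g x))) (at x)"
  using bounded_bilinear.FDERIV[OF assms(1) has_derivative_dirderiv[OF assms(2)] has_derivative_dirderiv[OF assms(3)]] .

text \<open>All products in question (of numbers, with vectors, of matrices, inner products) are bounded and
  bilinear, so one Leibniz rule covers them.\<close>

lemma times_differentiable_on_bilinear:
  assumes "open N" "bounded_bilinear p" "times_differentiable_on k N f" "times_differentiable_on k N g"
  shows "times_differentiable_on k N (\<lambda>x. p (f x) (g x))"
  using assms(3,4)
proof (induction k arbitrary: f g)
  case 0
  then show ?case by (auto intro: bounded_bilinear.continuous_on[OF assms(2)])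
next
  case (Suc k)
  note hd = has_derivative_bilinear_dirderiv[OF assms(2), of f _ g]
  have df: "f differentiable (at x)" "g differentiable (at x)" if "x \<in> N" for x
    using that Suc.prems by (auto simp: times_differentiable_on_Suc)
  have "times_differentiable_on k N (dirderiv v (\<lambda>x. p (f x) (g x)))" for v
  proof (subst times_differentiable_on_cong[OF assms(1)])
    show "dirderiv v (\<lambda>x. p (f x) (g x)) y = p (f y) (dirderiv v g y) + p (dirderiv v f y) (g y)" if "y \<in> N" for y
      using dirderiv_eq[OF hd[OF df[OF that]]] .
    show "times_differentiable_on k N (\<lambda>y. p (f y) (dirderiv v g y) + p (dirderiv v f y) (g y))"
      using Suc times_differentiable_on_SucD[OF Suc.prems(1)] times_differentiable_on_SucD[OF Suc.prems(2)]
      by (intro times_differentiable_on_add assms(1) Suc.IH) (auto simp: times_differentiable_on_Suc)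
  qed
  moreover have "(\<lambda>x. p (f x) (g x)) differentiable (at x)" if "x \<in> N" for x
    using hd[OF df[OF that]] by (auto simp: differentiable_def)
  ultimately show ?case by (auto simp: times_differentiable_on_Suc)
qed

lemma times_differentiable_on_sum:
  assumes "open N" "finite I" "\<And>i. i \<in> I \<Longrightarrow> times_differentiable_on k N (f i)"
  shows "times_differentiable_on k N (\<lambda>x. \<Sum>i\<in>I. f i x)"
  using assms(2,3)
  by (induction I rule: finite_induct)
     (auto simp: times_differentiable_on_const intro: times_differentiable_on_add assms(1))

text \<open>In the chain rule the outer derivative is taken in a direction that varies with the point. Expanding
  that direction in a basis leaves constant directions only, which is what an induction over the
  order of differentiability can use.\<close>

lemma dirderiv_compose:
  fixes f :: "'a::real_normed_vector \<Rightarrow> 'b::euclidean_space"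
  assumes "f differentiable (at x)" "g differentiable (at (f x))"
  shows "((\<lambda>x. g (f x)) has_derivative (\<lambda>v. dirderiv (dirderiv v f x) g (f x))) (at x)"
    and "dirderiv (dirderiv v f x) g (f x) = (\<Sum>b\<in>Basis. (dirderiv v f x \<bullet> b) *\<^sub>R dirderiv b g (f x))"
proof -
  show "((\<lambda>x. g (f x)) has_derivative (\<lambda>v. dirderiv (dirderiv v f x) g (f x))) (at x)"
    using diff_chain_at[OF has_derivative_dirderiv[OF assms(1)] has_derivative_dirderiv[OF assms(2)]]
    by (simp add: o_def)
  have lin: "linear (\<lambda>w. dirderiv w g (f x))"
    using has_derivative_linear[OF has_derivative_dirderiv[OF assms(2)]] .
  let ?w = "dirderiv v f x"
  have "dirderiv ?w g (f x) = dirderiv (\<Sum>b\<in>Basis. (?w \<bullet> b) *\<^sub>R b) g (f x)"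
    by (simp add: euclidean_representation)
  also have "\<dots> = (\<Sum>b\<in>Basis. (?w \<bullet> b) *\<^sub>R dirderiv b g (f x))"
    using linear_sum[OF lin, of "\<lambda>b. (?w \<bullet> b) *\<^sub>R b" Basis] linear_cmul[OF lin] by simp
  finally show "dirderiv ?w g (f x) = (\<Sum>b\<in>Basis. (?w \<bullet> b) *\<^sub>R dirderiv b g (f x))" .
qed

lemma times_differentiable_on_compose:
  fixes f :: "'a::real_normed_vector \<Rightarrow> 'b::euclidean_space" and g :: "'b \<Rightarrow> 'c::real_normed_vector"
  assumes "open N" "open S" "f ` N \<subseteq> S"
    and "times_differentiable_on k S g" "times_differentiable_on k N f"
  shows "times_differentiable_on k N (\<lambda>x. g (f x))"
  using assms(4,5)
proof (induction k arbitrary: g)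
  case 0
  then show ?case
    using assms(3) by (auto intro: continuous_on_compose2)
next
  case (Suc k)
  have df: "f differentiable (at x)" "g differentiable (at (f x))" if "x \<in> N" for x
    using that Suc.prems assms(3) by (auto simp: times_differentiable_on_Suc)
  have "times_differentiable_on k N (dirderiv v (\<lambda>x. g (f x)))" for v
  proof (subst times_differentiable_on_cong[OF assms(1)])
    show "dirderiv v (\<lambda>x. g (f x)) y = (\<Sum>b\<in>Basis. (dirderiv v f y \<bullet> b) *\<^sub>R dirderiv b g (f y))"
      if "y \<in> N" for y
      using dirderiv_eq[OF dirderiv_compose(1)[OF df[OF that]]] dirderiv_compose(2)[OF df[OF that]] by simp
    show "times_differentiable_on k N (\<lambda>y. \<Sum>b\<in>Basis. (dirderiv v f y \<bullet> b) *\<^sub>R dirderiv b g (f y))"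
    proof (intro times_differentiable_on_sum assms(1) finite_Basis
          times_differentiable_on_bilinear[OF assms(1) bounded_bilinear_scaleR])
      fix b :: 'b
      show "times_differentiable_on k N (\<lambda>x. dirderiv v f x \<bullet> b)"
        using Suc.prems(2)
        by (intro times_differentiable_on_linear[OF assms(1) bounded_linear_inner_left])
           (auto simp: times_differentiable_on_Suc)
      show "times_differentiable_on k N (\<lambda>x. dirderiv b g (f x))"
        using Suc.prems times_differentiable_on_SucD[OF Suc.prems(2)]
        by (intro Suc.IH) (auto simp: times_differentiable_on_Suc)
    qed
  qed
  moreover have "(\<lambda>x. g (f x)) differentiable (at x)" if "x \<in> N" for x
    using dirderiv_compose(1)[OF df[OF that]] by (auto simp: differentiable_def)
  ultimately show ?case by (auto simp: times_differentiable_on_Suc)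
qed

lemma smooth_on_iff_dirderiv:
  "smooth_on N f \<longleftrightarrow> (\<forall>x\<in>N. f differentiable (at x)) \<and> (\<forall>v. smooth_on N (dirderiv v f))"
proof
  assume "smooth_on N f"
  then show "(\<forall>x\<in>N. f differentiable (at x)) \<and> (\<forall>v. smooth_on N (dirderiv v f))"
    unfolding smooth_on_def using times_differentiable_on_Suc by blast
next
  assume "(\<forall>x\<in>N. f differentiable (at x)) \<and> (\<forall>v. smooth_on N (dirderiv v f))"
  then have "times_differentiable_on (Suc k) N f" for k
    by (simp add: times_differentiable_on_Suc smooth_on_def)
  then show "smooth_on N f"
    unfolding smooth_on_def using times_differentiable_on_SucD by blast
qed

lemma smooth_on_differentiable: "smooth_on N f \<Longrightarrow> x \<in> N \<Longrightarrow> f differentiable (at x)"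
  using smooth_on_iff_dirderiv by blast

lemma smooth_on_dirderiv: "smooth_on N f \<Longrightarrow> smooth_on N (dirderiv v f)"
  using smooth_on_iff_dirderiv by blast

lemma smooth_on_continuous: "smooth_on N f \<Longrightarrow> continuous_on N f"
  unfolding smooth_on_def by (auto dest: spec[of _ 0])

lemma smooth_on_subset: "smooth_on N f \<Longrightarrow> N' \<subseteq> N \<Longrightarrow> smooth_on N' f"
proof -
  assume "smooth_on N f" "N' \<subseteq> N"
  have "times_differentiable_on k N f \<Longrightarrow> times_differentiable_on k N' f" for k
    using \<open>N' \<subseteq> N\<close>
    by (induction k arbitrary: f)
       (auto simp: times_differentiable_on_Suc intro: continuous_on_subset)
  with \<open>smooth_on N f\<close> show ?thesis by (simp add: smooth_on_def)
qed

lemma smooth_on_cong: "open N \<Longrightarrow> (\<And>y. y \<in> N \<Longrightarrow> f y = g y) \<Longrightarrow> smooth_on N f \<longleftrightarrow> smooth_on N g"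
  by (simp add: smooth_on_def times_differentiable_on_cong[of N f g])

lemma smooth_on_const: "smooth_on N (\<lambda>x. c)"
  by (simp add: smooth_on_def times_differentiable_on_const)

lemma smooth_on_linear:
  "open N \<Longrightarrow> bounded_linear h \<Longrightarrow> smooth_on N f \<Longrightarrow> smooth_on N (\<lambda>x. h (f x))"
  by (simp add: smooth_on_def times_differentiable_on_linear)

lemma smooth_on_add:
  "open N \<Longrightarrow> smooth_on N f \<Longrightarrow> smooth_on N g \<Longrightarrow> smooth_on N (\<lambda>x. f x + g x)"
  by (simp add: smooth_on_def times_differentiable_on_add)

lemma smooth_on_bilinear:
  "open N \<Longrightarrow> bounded_bilinear p \<Longrightarrow> smooth_on N f \<Longrightarrow> smooth_on N g \<Longrightarrow> smooth_on N (\<lambda>x. p (f x) (g x))"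
  by (simp add: smooth_on_def times_differentiable_on_bilinear)

lemmas smooth_on_mult = smooth_on_bilinear[OF _ bounded_bilinear_mult]

lemma smooth_on_sum:
  "open N \<Longrightarrow> finite I \<Longrightarrow> (\<And>i. i \<in> I \<Longrightarrow> smooth_on N (f i)) \<Longrightarrow> smooth_on N (\<lambda>x. \<Sum>i\<in>I. f i x)"
  by (simp add: smooth_on_def times_differentiable_on_sum)

lemma smooth_on_diff:
  assumes "open N" "smooth_on N f" "smooth_on N g"
  shows "smooth_on N (\<lambda>x. f x - g x)"
  using smooth_on_add[OF assms(1,2) smooth_on_linear[OF assms(1) _ assms(3), of uminus]]
  by (simp add: bounded_linear_minus[OF bounded_linear_ident])

lemma smooth_on_compose:
  fixes f :: "'a::real_normed_vector \<Rightarrow> 'b::euclidean_space" and g :: "'b \<Rightarrow> 'c::real_normed_vector"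
  shows "open N \<Longrightarrow> open S \<Longrightarrow> f ` N \<subseteq> S \<Longrightarrow> smooth_on S g \<Longrightarrow> smooth_on N f \<Longrightarrow> smooth_on N (\<lambda>x. g (f x))"
  unfolding smooth_on_def by (blast intro: times_differentiable_on_compose)

lemma smooth_on_ident: "smooth_on N (\<lambda>x. x)"
proof -
  have "dirderiv v (\<lambda>x. x) = (\<lambda>x. v)" for v :: 'a
    by (rule ext, rule dirderiv_eq[OF has_derivative_ident])
  then show ?thesis
    by (subst smooth_on_iff_dirderiv) (simp add: smooth_on_const)
qed

text \<open>Differentiating a power lowers its exponent by one and produces the smooth factor \<open>a\<close>, so
  smoothness of all real powers follows by one induction over the order, for all exponents at once.\<close>

lemma smooth_on_powr: "smooth_on {0<..} (\<lambda>t::real. t powr a)"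
proof -
  have "times_differentiable_on k {0<..} (\<lambda>t::real. t powr a)" for k
  proof (induction k arbitrary: a)
    case 0
    then show ?case by (auto intro!: continuous_intros)
  next
    case (Suc k)
    have hd: "((\<lambda>t. t powr a) has_derivative (\<lambda>v. (v * a) * t powr (a - 1))) (at t)" if "t > 0" for t
      using has_real_derivative_powr[OF that, of a] unfolding has_field_derivative_def
      by (rule has_derivative_eq_rhs) (auto simp: fun_eq_iff)
    have "times_differentiable_on k {0<..} (dirderiv v (\<lambda>t. t powr a))" for v
    proof (subst times_differentiable_on_cong)
      show "dirderiv v (\<lambda>t. t powr a) t = (v * a) * t powr (a - 1)" if "t \<in> {0<..}" for t
        using that by (auto intro: dirderiv_eq[OF hd])
      show "times_differentiable_on k {0<..} (\<lambda>t. (v * a) * t powr (a - 1))"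
        by (intro times_differentiable_on_bilinear[OF _ bounded_bilinear_mult]
            times_differentiable_on_const Suc open_greaterThan)
    qed simp
    with hd show ?case by (auto simp: times_differentiable_on_Suc differentiable_def)
  qed
  then show ?thesis by (simp add: smooth_on_def)
qed

section \<open>Cut-off functions\<close>

text \<open>For \<open>m = 0\<close> the standard smooth function that vanishes exactly on the negative half-line. The division by
  \<open>t\<^sup>m\<close> provides for its derivatives.\<close>

definition flat_exp :: "nat \<Rightarrow> real \<Rightarrow> real" where
  "flat_exp m t = (if t \<le> 0 then 0 else exp (- (1 / t)) / t ^ m)"

lemma flat_exp_tendsto_0: "(flat_exp m \<longlongrightarrow> 0) (at 0)"
proof -
  have "((\<lambda>t::real. t ^ m / exp t) \<longlongrightarrow> 0) at_top"
    by (rule tendsto_power_div_exp_0)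
  then have "((\<lambda>t::real. (inverse t) ^ m / exp (inverse t)) \<longlongrightarrow> 0) (at_right 0)"
    by (rule filterlim_compose[OF _ filterlim_inverse_at_top_right])
  moreover have "\<forall>\<^sub>F t in at_right 0. (inverse t) ^ m / exp (inverse t) = flat_exp m t"
    by (auto simp: eventually_at_filter flat_exp_def field_simps exp_minus)
  ultimately have 1: "(flat_exp m \<longlongrightarrow> 0) (at_right 0)"
    by (rule Lim_transform_eventually)
  have "\<forall>\<^sub>F t in at_left 0. 0 = flat_exp m t"
    by (auto simp: eventually_at_filter flat_exp_def)
  then have "(flat_exp m \<longlongrightarrow> 0) (at_left 0)"
    by (rule Lim_transform_eventually[OF tendsto_const])
  with 1 show ?thesis by (simp add: filterlim_at_split)
qed

lemma flat_exp_has_derivative: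
  "(flat_exp m has_real_derivative (flat_exp (m + 2) t - real m * flat_exp (m + 1) t)) (at t)"
proof -
  consider "t < 0" | "t = 0" | "t > 0" by linarith
  then show ?thesis
  proof cases
    case 1
    have "((\<lambda>t. 0) has_real_derivative 0) (at t)" by simp
    then have "(flat_exp m has_real_derivative 0) (at t)"
      by (rule has_field_derivative_transform_within_open[where S = "{..<0}"])
         (use 1 in \<open>auto simp: flat_exp_def\<close>)
    with 1 show ?thesis by (simp add: flat_exp_def)
  next
    case 2
    have "(flat_exp m y - flat_exp m 0) / (y - 0) = flat_exp (m + 1) y" for y
      by (simp add: flat_exp_def)
    then have "(flat_exp m has_real_derivative 0) (at 0)"
      using flat_exp_tendsto_0[of "m + 1"] by (simp add: has_field_derivative_iff)
    with 2 show ?thesis by (simp add: flat_exp_def)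
  next
    case 3
    have "((\<lambda>t. exp (- (1 / t)) / t ^ m) has_real_derivative
        (exp (- (1 / t)) * (1 / (t * t)) * t ^ m - exp (- (1 / t)) * (real m * t ^ (m - 1))) / (t ^ m * t ^ m)) (at t)"
      using 3 by (auto intro!: derivative_eq_intros)
    also have "(exp (- (1 / t)) * (1 / (t * t)) * t ^ m - exp (- (1 / t)) * (real m * t ^ (m - 1))) / (t ^ m * t ^ m)
        = flat_exp (m + 2) t - real m * flat_exp (m + 1) t"
      using 3 by (cases m) (auto simp: flat_exp_def field_simps power2_eq_square)
    finally show ?thesis
      by (rule has_field_derivative_transform_within_open[where S = "{0<..}"])
         (use 3 in \<open>auto simp: flat_exp_def\<close>)
  qed
qed

text \<open>The family \<open>flat_exp m\<close> is closed under differentiation up to linear combinations.\<close>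

lemma smooth_on_flat_exp: "smooth_on UNIV (flat_exp m)"
proof -
  have "times_differentiable_on k UNIV (flat_exp m)" for k
  proof (induction k arbitrary: m)
    case 0
    then show ?case
      using DERIV_isCont[OF flat_exp_has_derivative] by (auto intro: continuous_at_imp_continuous_on)
  next
    case (Suc k)
    let ?g = "\<lambda>v t. v * flat_exp (m + 2) t + (- v * real m) * flat_exp (m + 1) t"
    have hd: "(flat_exp m has_derivative (\<lambda>v. ?g v t)) (at t)" for t
      using flat_exp_has_derivative[of m t] unfolding has_field_derivative_def
      by (rule has_derivative_eq_rhs) (auto simp: fun_eq_iff algebra_simps)
    have "dirderiv v (flat_exp m) = ?g v" for v
      using dirderiv_eq[OF hd] by auto
    moreover have "times_differentiable_on k UNIV (?g v)" for v
      by (intro times_differentiable_on_add times_differentiable_on_bilinear[OF _ bounded_bilinear_mult]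
          times_differentiable_on_const Suc open_UNIV)
    ultimately show ?case
      using hd by (auto simp: times_differentiable_on_Suc differentiable_def)
  qed
  then show ?thesis by (simp add: smooth_on_def)
qed

text \<open>The exponent \<open>-1\<close> stands for the reciprocal and makes smoothness an instance of that of real powers.\<close>

definition smooth_step :: "real \<Rightarrow> real" where
  "smooth_step t = flat_exp 0 t * (flat_exp 0 t + flat_exp 0 (1 - t)) powr (- 1)"

lemma flat_exp_pos: "t > 0 \<Longrightarrow> flat_exp 0 t > 0" and flat_exp_nonneg: "flat_exp 0 t \<ge> 0"
  by (auto simp: flat_exp_def)

lemma smooth_step_denominator_pos: "flat_exp 0 t + flat_exp 0 (1 - t) > 0"
proof (cases "t > 0")
  case True
  then show ?thesis using flat_exp_pos[of t] flat_exp_nonneg[of "1 - t"] by linarith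
next
  case False
  then show ?thesis using flat_exp_pos[of "1 - t"] flat_exp_nonneg[of t] by linarith
qed

lemma smooth_step_values:
  "0 \<le> smooth_step t" "smooth_step t \<le> 1"
  "t \<ge> 1 \<Longrightarrow> smooth_step t = 1" "t \<le> 0 \<Longrightarrow> smooth_step t = 0"
proof -
  have eq: "smooth_step t = flat_exp 0 t / (flat_exp 0 t + flat_exp 0 (1 - t))" for t
    using smooth_step_denominator_pos[of t] by (simp add: smooth_step_def powr_minus divide_inverse)
  show "0 \<le> smooth_step t" "smooth_step t \<le> 1"
    using smooth_step_denominator_pos[of t] flat_exp_nonneg[of t] flat_exp_nonneg[of "1 - t"]
    by (auto simp: eq field_simps)
  show "smooth_step t = 1" if "t \<ge> 1"
  proof -
    have "flat_exp 0 (1 - t) = 0" using that by (simp add: flat_exp_def)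
    then show ?thesis using smooth_step_denominator_pos[of t] by (simp add: eq)
  qed
  show "t \<le> 0 \<Longrightarrow> smooth_step t = 0" by (simp add: eq flat_exp_def)
qed

lemma smooth_on_smooth_step: "smooth_on UNIV smooth_step"
proof -
  have 1: "smooth_on UNIV (\<lambda>t. flat_exp 0 (1 - t))"
    by (rule smooth_on_compose[where S = UNIV])
       (auto intro!: smooth_on_flat_exp smooth_on_diff smooth_on_const smooth_on_ident)
  have 2: "smooth_on UNIV (\<lambda>t. (flat_exp 0 t + flat_exp 0 (1 - t)) powr (- 1))"
    by (rule smooth_on_compose[OF open_UNIV open_greaterThan _ smooth_on_powr])
       (auto intro!: smooth_on_add smooth_on_flat_exp 1 smooth_step_denominator_pos)
  show ?thesis
    unfolding smooth_step_def[abs_def] by (intro smooth_on_mult smooth_on_flat_exp 2 open_UNIV)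
qed

text \<open>Near each point there is a plateau function; finitely many of them cover \<open>K\<close>, and
  \<open>1 - \<Prod>(1 - b)\<close> equals \<open>1\<close> wherever one of them does.\<close>

lemma cutoff_exists:
  fixes K M :: "pt set"
  assumes "compact K" "open M" "K \<subseteq> M"
  obtains c Q where "test_function M c" "open Q" "K \<subseteq> Q" "\<And>x. x \<in> Q \<Longrightarrow> c x = 1"
    "\<And>x. 0 \<le> c x" "\<And>x. c x \<le> 1"
proof -
  have "\<forall>x\<in>K. \<exists>r>0. cball x (2 * r) \<subseteq> M"
  proof
    fix x assume "x \<in> K"
    then obtain e where "e > 0" "cball x e \<subseteq> M"
      using assms open_contains_cball by (metis subsetD)
    then show "\<exists>r>0. cball x (2 * r) \<subseteq> M" by (intro exI[of _ "e / 2"]) auto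
  qed
  then obtain r where r: "\<And>x. x \<in> K \<Longrightarrow> r x > 0 \<and> cball x (2 * r x) \<subseteq> M" by metis
  have "K \<subseteq> (\<Union>x\<in>K. ball x (r x))" using r by force
  then obtain I where I: "I \<subseteq> K" "finite I" "K \<subseteq> (\<Union>x\<in>I. ball x (r x))"
    using compactE_image[OF assms(1), of K "\<lambda>x. ball x (r x)"] by (metis open_ball)
  define b where "b a x = smooth_step (2 - (1 / (r a)\<^sup>2) * ((x - a) \<bullet> (x - a)))" for a x
  have b_smooth: "smooth_on UNIV (b a)" for a
    unfolding b_def[abs_def]
    by (rule smooth_on_compose[OF open_UNIV open_UNIV subset_UNIV smooth_on_smooth_step])
       (intro smooth_on_diff smooth_on_const smooth_on_ident smooth_on_mult open_UNIV
        smooth_on_bilinear[OF _ bounded_bilinear_inner])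
  have b01: "0 \<le> b a x" "b a x \<le> 1" for a x
    by (auto simp: b_def smooth_step_values)
  have b1: "b a x = 1" if "a \<in> K" "x \<in> ball a (r a)" for a x
  proof -
    have "norm (x - a) \<le> r a" using that by (simp add: dist_norm norm_minus_commute)
    then have "(norm (x - a))\<^sup>2 \<le> (r a)\<^sup>2" by (simp add: power_mono)
    then show ?thesis using r[OF that(1)]
      unfolding b_def by (intro smooth_step_values) (simp add: dot_square_norm field_simps)
  qed
  have b0: "b a x = 0" if "a \<in> K" "x \<notin> cball a (2 * r a)" for a x
  proof -
    have "norm (x - a) \<ge> 2 * r a" using that by (simp add: dist_norm norm_minus_commute)
    then have "(norm (x - a))\<^sup>2 \<ge> (2 * r a)\<^sup>2" using r[OF that(1)] by (intro power_mono) auto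
    moreover have "2 * (r a)\<^sup>2 \<le> (2 * r a)\<^sup>2" by (simp add: power_mult_distrib)
    ultimately have "(norm (x - a))\<^sup>2 \<ge> 2 * (r a)\<^sup>2" by linarith
    then show ?thesis using r[OF that(1)]
      unfolding b_def by (intro smooth_step_values) (simp add: dot_square_norm field_simps)
  qed
  define c where "c x = 1 - (\<Prod>a\<in>I. 1 - b a x)" for x
  have "smooth_on UNIV (\<lambda>x. \<Prod>a\<in>I. 1 - b a x)"
    using I(2) by (induction I rule: finite_induct)
      (auto intro!: smooth_on_const smooth_on_mult smooth_on_diff b_smooth)
  then have c_smooth: "smooth_on UNIV c"
    unfolding c_def[abs_def] by (intro smooth_on_diff smooth_on_const open_UNIV)
  have supp: "supp c \<subseteq> (\<Union>a\<in>I. cball a (2 * r a))"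
    unfolding supp_def
  proof (rule closure_minimal)
    show "{x. c x \<noteq> 0} \<subseteq> (\<Union>a\<in>I. cball a (2 * r a))"
    proof (rule subsetI, rule ccontr)
      fix x assume "x \<in> {x. c x \<noteq> 0}" "x \<notin> (\<Union>a\<in>I. cball a (2 * r a))"
      moreover from this have "b a x = 0" if "a \<in> I" for a using that I(1) b0[of a x] by blast
      ultimately show False by (simp add: c_def)
    qed
    show "closed (\<Union>a\<in>I. cball a (2 * r a))" using I(2) by auto
  qed
  have "compact (\<Union>a\<in>I. cball a (2 * r a))" using I(2) by auto
  then have "compact (supp c)"
    using supp compact_Int_closed[of _ "supp c"] by (metis Int_absorb1 supp_def closed_closure)
  moreover have "supp c \<subseteq> M" using supp r I(1) by blast
  ultimately have "test_function M c" using c_smooth by (simp add: test_function_def)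
  moreover have "c x = 1" if x: "x \<in> (\<Union>a\<in>I. ball a (r a))" for x
  proof -
    obtain a where "a \<in> I" "x \<in> ball a (r a)" using x by blast
    then have "1 - b a x = 0" using b1 I(1) by auto
    then show ?thesis using I(2) \<open>a \<in> I\<close> by (force simp: c_def prod_zero_iff)
  qed
  moreover have "(\<Prod>a\<in>I. 1 - b a x) \<ge> 0" "(\<Prod>a\<in>I. 1 - b a x) \<le> 1" for x
    using b01 by (auto intro: prod_nonneg prod_le_1)
  then have "0 \<le> c x" "c x \<le> 1" for x
    by (simp_all add: c_def)
  ultimately show thesis
    by (intro that[where c = c, OF _ _ I(3)]) (simp_all add: open_UN)
qed

section \<open>Order bounds of nets\<close>

lemma eventually_unit_interval: "\<forall>\<^sub>F \<epsilon> in at_right (0::real). \<epsilon> \<in> {0<..1}"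
  using eventually_at_right_real[of 0 1] by (rule eventually_mono[OF _]) auto

lemma eventually_at_right_mono:
  "(\<And>\<epsilon>. \<epsilon> \<in> {0<..1::real} \<Longrightarrow> P \<epsilon> \<Longrightarrow> Q \<epsilon>) \<Longrightarrow> \<forall>\<^sub>F \<epsilon> in at_right 0. P \<epsilon> \<Longrightarrow> \<forall>\<^sub>F \<epsilon> in at_right 0. Q \<epsilon>"
  by (rule eventually_mp[OF _ eventually_conj[OF eventually_unit_interval]])
     (auto intro: always_eventually)

lemma sup_bigo_cong:
  assumes "\<And>\<epsilon> x. \<epsilon> \<in> {0<..1} \<Longrightarrow> x \<in> K \<Longrightarrow> u \<epsilon> x = v \<epsilon> x"
  shows "sup_bigo K u r \<longleftrightarrow> sup_bigo K v r"
proof -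
  have "(\<forall>\<^sub>F \<epsilon> in at_right 0. \<forall>x\<in>K. norm (u \<epsilon> x) \<le> C * \<epsilon> powr r) \<longleftrightarrow>
        (\<forall>\<^sub>F \<epsilon> in at_right 0. \<forall>x\<in>K. norm (v \<epsilon> x) \<le> C * \<epsilon> powr r)" for C
    by (rule eventually_cong[OF eventually_unit_interval]) (use assms in auto)
  then show ?thesis by (simp add: sup_bigo_def)
qed

lemma sup_bigoE:
  assumes "sup_bigo K u r"
  obtains C where "C \<ge> 0" "\<forall>\<^sub>F \<epsilon> in at_right 0. \<forall>x\<in>K. norm (u \<epsilon> x) \<le> C * \<epsilon> powr r"
proof -
  obtain C where C: "\<forall>\<^sub>F \<epsilon> in at_right 0. \<forall>x\<in>K. norm (u \<epsilon> x) \<le> C * \<epsilon> powr r"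
    using assms by (auto simp: sup_bigo_def)
  have "C * \<epsilon> powr r \<le> \<bar>C\<bar> * \<epsilon> powr r" for \<epsilon> by (intro mult_right_mono) auto
  then have "\<forall>\<^sub>F \<epsilon> in at_right 0. \<forall>x\<in>K. norm (u \<epsilon> x) \<le> \<bar>C\<bar> * \<epsilon> powr r"
    using C by (intro eventually_mono[OF C] ballI) (blast intro: order_trans)
  then show thesis using that[of "\<bar>C\<bar>"] by simp
qed

lemma sup_bigo_exponent_mono: "sup_bigo K u r \<Longrightarrow> s \<le> r \<Longrightarrow> sup_bigo K u s"
proof -
  assume "sup_bigo K u r" "s \<le> r"
  then obtain C where C: "C \<ge> 0" "\<forall>\<^sub>F \<epsilon> in at_right 0. \<forall>x\<in>K. norm (u \<epsilon> x) \<le> C * \<epsilon> powr r"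
    by (auto elim: sup_bigoE)
  have "\<forall>\<^sub>F \<epsilon> in at_right 0. \<forall>x\<in>K. norm (u \<epsilon> x) \<le> C * \<epsilon> powr s"
  proof (rule eventually_at_right_mono[OF _ C(2)])
    fix \<epsilon> :: real assume e: "\<epsilon> \<in> {0<..1}" and b: "\<forall>x\<in>K. norm (u \<epsilon> x) \<le> C * \<epsilon> powr r"
    have "\<epsilon> powr r \<le> \<epsilon> powr s" using e \<open>s \<le> r\<close> by (intro powr_mono') auto
    then have "C * \<epsilon> powr r \<le> C * \<epsilon> powr s" using C(1) by (intro mult_left_mono)
    with b show "\<forall>x\<in>K. norm (u \<epsilon> x) \<le> C * \<epsilon> powr s" by (blast intro: order_trans)
  qed
  then show ?thesis by (auto simp: sup_bigo_def)
qed

lemma sup_bigo_linear: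
  assumes "bounded_linear h" "sup_bigo K u r"
  shows "sup_bigo K (\<lambda>\<epsilon> x. h (u \<epsilon> x)) r"
proof -
  obtain B where B: "B \<ge> 0" "\<And>x. norm (h x) \<le> norm x * B"
    using bounded_linear.nonneg_bounded[OF assms(1)] by blast
  obtain C where C: "\<forall>\<^sub>F \<epsilon> in at_right 0. \<forall>x\<in>K. norm (u \<epsilon> x) \<le> C * \<epsilon> powr r"
    using assms(2) by (auto simp: sup_bigo_def)
  have "\<forall>\<^sub>F \<epsilon> in at_right 0. \<forall>x\<in>K. norm (h (u \<epsilon> x)) \<le> (C * B) * \<epsilon> powr r"
  proof (rule eventually_mono[OF C], rule ballI)
    fix \<epsilon> x assume "\<forall>x\<in>K. norm (u \<epsilon> x) \<le> C * \<epsilon> powr r" "x \<in> K"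
    then have "norm (u \<epsilon> x) * B \<le> (C * \<epsilon> powr r) * B" using B(1) by (intro mult_right_mono) auto
    with B(2)[of "u \<epsilon> x"] show "norm (h (u \<epsilon> x)) \<le> (C * B) * \<epsilon> powr r" by (simp add: mult_ac)
  qed
  then show ?thesis by (auto simp: sup_bigo_def)
qed

lemma sup_bigo_add:
  assumes "sup_bigo K u r" "sup_bigo K v r"
  shows "sup_bigo K (\<lambda>\<epsilon> x. u \<epsilon> x + v \<epsilon> x) r"
proof -
  obtain C where C: "\<forall>\<^sub>F \<epsilon> in at_right 0. \<forall>x\<in>K. norm (u \<epsilon> x) \<le> C * \<epsilon> powr r"
    using assms by (auto simp: sup_bigo_def)
  obtain D where D: "\<forall>\<^sub>F \<epsilon> in at_right 0. \<forall>x\<in>K. norm (v \<epsilon> x) \<le> D * \<epsilon> powr r"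
    using assms by (auto simp: sup_bigo_def)
  have "\<forall>\<^sub>F \<epsilon> in at_right 0. \<forall>x\<in>K. norm (u \<epsilon> x + v \<epsilon> x) \<le> (C + D) * \<epsilon> powr r"
    using C D
  proof (eventually_elim, intro ballI)
    fix \<epsilon> x assume "\<forall>x\<in>K. norm (u \<epsilon> x) \<le> C * \<epsilon> powr r" "\<forall>x\<in>K. norm (v \<epsilon> x) \<le> D * \<epsilon> powr r" "x \<in> K"
    then show "norm (u \<epsilon> x + v \<epsilon> x) \<le> (C + D) * \<epsilon> powr r"
      by (metis add_mono distrib_right norm_triangle_le)
  qed
  then show ?thesis by (auto simp: sup_bigo_def)
qed

lemma sup_bigo_bilinear:
  assumes "bounded_bilinear p" "sup_bigo K u r" "sup_bigo K v s"
  shows "sup_bigo K (\<lambda>\<epsilon> x. p (u \<epsilon> x) (v \<epsilon> x)) (r + s)"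
proof -
  obtain B where B: "B \<ge> 0" "\<And>x y. norm (p x y) \<le> norm x * norm y * B"
    using bounded_bilinear.nonneg_bounded[OF assms(1)] by blast
  obtain C where C: "C \<ge> 0" "\<forall>\<^sub>F \<epsilon> in at_right 0. \<forall>x\<in>K. norm (u \<epsilon> x) \<le> C * \<epsilon> powr r"
    using assms(2) by (auto elim: sup_bigoE)
  obtain D where D: "D \<ge> 0" "\<forall>\<^sub>F \<epsilon> in at_right 0. \<forall>x\<in>K. norm (v \<epsilon> x) \<le> D * \<epsilon> powr s"
    using assms(3) by (auto elim: sup_bigoE)
  have "\<forall>\<^sub>F \<epsilon> in at_right 0. \<forall>x\<in>K. norm (p (u \<epsilon> x) (v \<epsilon> x)) \<le> (C * D * B) * \<epsilon> powr (r + s)"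
    using C(2) D(2)
  proof (eventually_elim, intro ballI)
    fix \<epsilon> x assume "\<forall>x\<in>K. norm (u \<epsilon> x) \<le> C * \<epsilon> powr r" "\<forall>x\<in>K. norm (v \<epsilon> x) \<le> D * \<epsilon> powr s" "x \<in> K"
    then have "norm (u \<epsilon> x) * norm (v \<epsilon> x) \<le> (C * \<epsilon> powr r) * (D * \<epsilon> powr s)"
      using C(1) by (intro mult_mono) auto
    then have "norm (u \<epsilon> x) * norm (v \<epsilon> x) * B \<le> (C * \<epsilon> powr r) * (D * \<epsilon> powr s) * B"
      using B(1) by (rule mult_right_mono)
    with B(2)[of "u \<epsilon> x" "v \<epsilon> x"] show "norm (p (u \<epsilon> x) (v \<epsilon> x)) \<le> (C * D * B) * \<epsilon> powr (r + s)"
      by (simp add: mult_ac powr_add)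
  qed
  then show ?thesis by (auto simp: sup_bigo_def)
qed

lemma sup_bigo_bounded:
  assumes "\<forall>\<^sub>F \<epsilon> in at_right 0. \<forall>x\<in>K. norm (u \<epsilon> x) \<le> C"
  shows "sup_bigo K u 0"
  unfolding sup_bigo_def
  by (rule exI[of _ C], rule eventually_at_right_mono[OF _ assms]) simp

text \<open>Constant directions keep the notion independent of the tensorial rank and of the domain of vector
  fields.\<close>

primrec order_bound ::
    "'a set \<Rightarrow> real \<Rightarrow> nat \<Rightarrow> (real \<Rightarrow> 'a::real_normed_vector \<Rightarrow> 'b::real_normed_vector) \<Rightarrow> bool" where
  "order_bound K r 0 u \<longleftrightarrow> sup_bigo K u r"
| "order_bound K r (Suc k) u \<longleftrightarrow> sup_bigo K u r \<and> (\<forall>v. order_bound K r k (\<lambda>\<epsilon>. dirderiv v (u \<epsilon>)))"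

lemma order_bound_sup_bigo: "order_bound K r k u \<Longrightarrow> sup_bigo K u r"
  by (cases k) auto

lemma order_bound_exponent_mono: "order_bound K r k u \<Longrightarrow> s \<le> r \<Longrightarrow> order_bound K s k u"
  by (induction k arbitrary: u) (auto intro: sup_bigo_exponent_mono)

lemma order_bound_SucD: "order_bound K r (Suc k) u \<Longrightarrow> order_bound K r k u"
  by (induction k arbitrary: u) auto

lemma order_bound_foldr:
  "order_bound K r k u \<longleftrightarrow>
     (\<forall>vs. length vs \<le> k \<longrightarrow> sup_bigo K (\<lambda>\<epsilon>. foldr dirderiv vs (u \<epsilon>)) r)"
proof (induction k arbitrary: u)
  case (Suc k)
  have "order_bound K r (Suc k) u \<longleftrightarrow> sup_bigo K u r \<and>
      (\<forall>v vs. length vs \<le> k \<longrightarrow> sup_bigo K (\<lambda>\<epsilon>. foldr dirderiv (vs @ [v]) (u \<epsilon>)) r)"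
    by (simp add: Suc)
  also have "\<dots> \<longleftrightarrow> (\<forall>vs. length vs \<le> Suc k \<longrightarrow> sup_bigo K (\<lambda>\<epsilon>. foldr dirderiv vs (u \<epsilon>)) r)"
    (is "?L \<longleftrightarrow> ?R")
  proof
    assume L: ?L
    show ?R
    proof (intro allI impI)
      fix vs :: "'a list" assume "length vs \<le> Suc k"
      then show "sup_bigo K (\<lambda>\<epsilon>. foldr dirderiv vs (u \<epsilon>)) r"
        using L by (cases vs rule: rev_cases) auto
    qed
  next
    assume R: ?R
    have "length (vs @ [v]) \<le> Suc k \<Longrightarrow> sup_bigo K (\<lambda>\<epsilon>. foldr dirderiv (vs @ [v]) (u \<epsilon>)) r" for v vs
      using R by blast
    moreover have "sup_bigo K u r" using R[rule_format, of "[]"] by simp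
    ultimately show ?L by simp
  qed
  finally show ?case .
qed simp

text \<open>The bound together with smoothness on an open set \<open>N\<close> around \<open>K\<close>: differentiation rules hold for
  smooth nets only, so an induction over the order has to carry both.\<close>

definition net_bound ::
    "pt set \<Rightarrow> pt set \<Rightarrow> real \<Rightarrow> nat \<Rightarrow> 'b::real_normed_vector net \<Rightarrow> bool" where
  "net_bound N K r k u \<longleftrightarrow> smooth_net N u \<and> order_bound K r k u"

lemma smooth_net_dirderiv: "smooth_net N u \<Longrightarrow> smooth_net N (\<lambda>\<epsilon>. dirderiv v (u \<epsilon>))"
  by (auto simp: smooth_net_def intro: smooth_on_dirderiv)

lemma net_bound_0: "net_bound N K r 0 u \<longleftrightarrow> smooth_net N u \<and> sup_bigo K u r"
  by (simp add: net_bound_def)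

lemma net_bound_Suc:
  "net_bound N K r (Suc k) u \<longleftrightarrow>
     smooth_net N u \<and> sup_bigo K u r \<and> (\<forall>v. net_bound N K r k (\<lambda>\<epsilon>. dirderiv v (u \<epsilon>)))"
  by (auto simp: net_bound_def intro: smooth_net_dirderiv)

lemma net_bound_exponent_mono: "net_bound N K r k u \<Longrightarrow> s \<le> r \<Longrightarrow> net_bound N K s k u"
  by (auto simp: net_bound_def intro: order_bound_exponent_mono)

lemma net_bound_SucD: "net_bound N K r (Suc k) u \<Longrightarrow> net_bound N K r k u"
  unfolding net_bound_def using order_bound_SucD by blast

lemma net_bound_smooth: "net_bound N K r k u \<Longrightarrow> smooth_net N u"
  and net_bound_sup_bigo: "net_bound N K r k u \<Longrightarrow> sup_bigo K u r"
  by (auto simp: net_bound_def intro: order_bound_sup_bigo)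

lemma smooth_net_differentiable:
  "smooth_net N u \<Longrightarrow> \<epsilon> \<in> {0<..1} \<Longrightarrow> x \<in> N \<Longrightarrow> u \<epsilon> differentiable (at x)"
  by (auto simp: smooth_net_def intro: smooth_on_differentiable)

lemma smooth_net_cong:
  assumes "open N" "\<And>\<epsilon> x. \<epsilon> \<in> {0<..1} \<Longrightarrow> x \<in> N \<Longrightarrow> u \<epsilon> x = v \<epsilon> x"
  shows "smooth_net N u \<longleftrightarrow> smooth_net N v"
  unfolding smooth_net_def using assms smooth_on_cong[of N "u _" "v _"] by (intro ball_cong) auto

lemma smooth_net_subset: "smooth_net N u \<Longrightarrow> N' \<subseteq> N \<Longrightarrow> smooth_net N' u"
  by (auto simp: smooth_net_def intro: smooth_on_subset)

lemma smooth_net_add: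
  "open N \<Longrightarrow> smooth_net N u \<Longrightarrow> smooth_net N v \<Longrightarrow> smooth_net N (\<lambda>\<epsilon> x. u \<epsilon> x + v \<epsilon> x)"
  by (simp add: smooth_net_def smooth_on_add)

lemma smooth_net_linear:
  "open N \<Longrightarrow> bounded_linear h \<Longrightarrow> smooth_net N u \<Longrightarrow> smooth_net N (\<lambda>\<epsilon> x. h (u \<epsilon> x))"
  by (simp add: smooth_net_def smooth_on_linear)

lemma smooth_net_bilinear:
  "open N \<Longrightarrow> bounded_bilinear p \<Longrightarrow> smooth_net N u \<Longrightarrow> smooth_net N v \<Longrightarrow>
     smooth_net N (\<lambda>\<epsilon> x. p (u \<epsilon> x) (v \<epsilon> x))"
  by (simp add: smooth_net_def smooth_on_bilinear)

lemma order_bound_cong: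
  assumes "open N" "K \<subseteq> N" "\<And>\<epsilon> x. \<epsilon> \<in> {0<..1} \<Longrightarrow> x \<in> N \<Longrightarrow> u \<epsilon> x = v \<epsilon> x"
  shows "order_bound K r k u \<longleftrightarrow> order_bound K r k v"
  using assms(3)
proof (induction k arbitrary: u v)
  case 0
  have "sup_bigo K u r \<longleftrightarrow> sup_bigo K v r"
    using assms(2) 0 by (intro sup_bigo_cong) auto
  then show ?case by simp
next
  case (Suc k)
  have "sup_bigo K u r \<longleftrightarrow> sup_bigo K v r"
    using assms(2) Suc.prems by (intro sup_bigo_cong) auto
  moreover have "order_bound K r k (\<lambda>\<epsilon>. dirderiv w (u \<epsilon>)) \<longleftrightarrow> order_bound K r k (\<lambda>\<epsilon>. dirderiv w (v \<epsilon>))" for w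
    using Suc by (intro Suc.IH dirderiv_cong_open[OF assms(1)]) auto
  ultimately show ?case by simp
qed

lemma net_bound_cong:
  assumes "open N" "K \<subseteq> N" "\<And>\<epsilon> x. \<epsilon> \<in> {0<..1} \<Longrightarrow> x \<in> N \<Longrightarrow> u \<epsilon> x = v \<epsilon> x"
  shows "net_bound N K r k u \<longleftrightarrow> net_bound N K r k v"
  unfolding net_bound_def
  using order_bound_cong[of N K u v] smooth_net_cong[of N u v] assms by blast

context
  fixes N K :: "pt set"
  assumes N: "open N" and K: "compact K" "K \<subseteq> N"
begin

lemma net_bound_linear:
  assumes h: "bounded_linear h" and "net_bound N K r k u"
  shows "net_bound N K r k (\<lambda>\<epsilon> x. h (u \<epsilon> x))"
  using assms(2)
proof (induction k arbitrary: u)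
  case 0
  then show ?case
    using smooth_net_linear[OF N h] sup_bigo_linear[OF h] by (auto simp: net_bound_0)
next
  case (Suc k)
  have sm: "smooth_net N u" and b: "sup_bigo K u r" using Suc.prems by (auto simp: net_bound_Suc)
  have "net_bound N K r k (\<lambda>\<epsilon>. dirderiv v (\<lambda>x. h (u \<epsilon> x)))" for v
  proof (subst net_bound_cong[OF N K(2)])
    fix \<epsilon> :: real and x assume "\<epsilon> \<in> {0<..1}" "x \<in> N"
    then have "u \<epsilon> differentiable (at x)" using smooth_net_differentiable[OF sm] by blast
    then show "dirderiv v (\<lambda>x. h (u \<epsilon> x)) x = h (dirderiv v (u \<epsilon>) x)"
      using dirderiv_eq[OF bounded_linear.has_derivative[OF h has_derivative_dirderiv]] by blast
  next
    show "net_bound N K r k (\<lambda>\<epsilon> x. h (dirderiv v (u \<epsilon>) x))"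
      using Suc by (auto simp: net_bound_Suc)
  qed
  then show ?case
    using smooth_net_linear[OF N h sm] sup_bigo_linear[OF h b] by (auto simp: net_bound_Suc)
qed

lemma net_bound_add:
  assumes "net_bound N K r k u" "net_bound N K r k v"
  shows "net_bound N K r k (\<lambda>\<epsilon> x. u \<epsilon> x + v \<epsilon> x)"
  using assms
proof (induction k arbitrary: u v)
  case 0
  then show ?case
    using smooth_net_add[OF N] sup_bigo_add unfolding net_bound_0 by blast
next
  case (Suc k)
  have sm: "smooth_net N u" "smooth_net N v" and b: "sup_bigo K u r" "sup_bigo K v r"
    using Suc.prems by (auto simp: net_bound_Suc)
  have "net_bound N K r k (\<lambda>\<epsilon>. dirderiv w (\<lambda>x. u \<epsilon> x + v \<epsilon> x))" for w
  proof (subst net_bound_cong[OF N K(2)])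
    fix \<epsilon> :: real and x assume "\<epsilon> \<in> {0<..1}" "x \<in> N"
    then have "u \<epsilon> differentiable (at x)" "v \<epsilon> differentiable (at x)"
      using smooth_net_differentiable sm by blast+
    then show "dirderiv w (\<lambda>x. u \<epsilon> x + v \<epsilon> x) x = dirderiv w (u \<epsilon>) x + dirderiv w (v \<epsilon>) x"
      using dirderiv_eq[OF has_derivative_add[OF has_derivative_dirderiv has_derivative_dirderiv]] by blast
  next
    show "net_bound N K r k (\<lambda>\<epsilon> x. dirderiv w (u \<epsilon>) x + dirderiv w (v \<epsilon>) x)"
      using Suc by (auto simp: net_bound_Suc)
  qed
  then show ?case
    using smooth_net_add[OF N sm] sup_bigo_add[OF b] by (simp add: net_bound_Suc)
qed

lemma net_bound_bilinear:
  assumes p: "bounded_bilinear p" and "net_bound N K r k u" "net_bound N K s k v"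
  shows "net_bound N K (r + s) k (\<lambda>\<epsilon> x. p (u \<epsilon> x) (v \<epsilon> x))"
  using assms(2,3)
proof (induction k arbitrary: u v)
  case 0
  then show ?case
    using smooth_net_bilinear[OF N p] sup_bigo_bilinear[OF p] unfolding net_bound_0 by blast
next
  case (Suc k)
  have sm: "smooth_net N u" "smooth_net N v" and b: "sup_bigo K u r" "sup_bigo K v s"
    using Suc.prems by (auto simp: net_bound_Suc)
  have "net_bound N K (r + s) k (\<lambda>\<epsilon>. dirderiv w (\<lambda>x. p (u \<epsilon> x) (v \<epsilon> x)))" for w
  proof (subst net_bound_cong[OF N K(2)])
    fix \<epsilon> :: real and x assume "\<epsilon> \<in> {0<..1}" "x \<in> N"
    then have "u \<epsilon> differentiable (at x)" "v \<epsilon> differentiable (at x)"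
      using smooth_net_differentiable sm by blast+
    then show "dirderiv w (\<lambda>x. p (u \<epsilon> x) (v \<epsilon> x)) x = p (u \<epsilon> x) (dirderiv w (v \<epsilon>) x) + p (dirderiv w (u \<epsilon>) x) (v \<epsilon> x)"
      using dirderiv_eq[OF has_derivative_bilinear_dirderiv[OF p]] by blast
  next
    show "net_bound N K (r + s) k (\<lambda>\<epsilon> x. p (u \<epsilon> x) (dirderiv w (v \<epsilon>) x) + p (dirderiv w (u \<epsilon>) x) (v \<epsilon> x))"
      using Suc.prems net_bound_SucD[OF Suc.prems(1)] net_bound_SucD[OF Suc.prems(2)]
      by (intro net_bound_add Suc.IH) (auto simp: net_bound_Suc)
  qed
  then show ?case
    using smooth_net_bilinear[OF N p sm] sup_bigo_bilinear[OF p b] by (simp add: net_bound_Suc)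
qed

lemma net_bound_fixed:
  fixes f :: "pt \<Rightarrow> 'b::real_normed_vector"
  assumes "smooth_on N f"
  shows "net_bound N K 0 k (\<lambda>\<epsilon>. f)"
proof -
  have b: "sup_bigo K (\<lambda>\<epsilon>. f) 0" if f: "smooth_on N f" for f :: "pt \<Rightarrow> 'b"
  proof -
    have "compact (f ` K)"
      using compact_continuous_image[OF continuous_on_subset[OF smooth_on_continuous[OF f] K(2)] K(1)] .
    then obtain C where "\<forall>x\<in>K. norm (f x) \<le> C"
      by (auto dest!: compact_imp_bounded simp: bounded_iff)
    then show ?thesis by (intro sup_bigo_bounded[where C = C] always_eventually) simp
  qed
  show ?thesis
    using assms
  proof (induction k arbitrary: f)
    case (Suc k)
    then show ?case
      using b[OF Suc.prems] smooth_on_dirderiv[OF Suc.prems] by (auto simp: net_bound_Suc smooth_net_def)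
  qed (auto simp: net_bound_0 smooth_net_def b)
qed

lemma net_bound_zero: "net_bound N K r k (\<lambda>\<epsilon> x. 0 :: 'b::real_normed_vector)"
proof -
  have "dirderiv v (\<lambda>x. 0 :: 'b) = (\<lambda>x. 0)" for v :: pt
    by (rule ext, rule dirderiv_eq[OF has_derivative_const])
  then show ?thesis
    by (induction k)
       (simp_all add: net_bound_0 net_bound_Suc smooth_net_def smooth_on_const sup_bigo_def exI[of _ 0])
qed

lemma net_bound_sum:
  "finite I \<Longrightarrow> (\<And>i. i \<in> I \<Longrightarrow> net_bound N K r k (u i)) \<Longrightarrow> net_bound N K r k (\<lambda>\<epsilon> x. \<Sum>i\<in>I. u i \<epsilon> x)"
  by (induction I rule: finite_induct) (auto simp: net_bound_zero intro: net_bound_add)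

lemma net_bound_fixed_left:
  assumes "bounded_bilinear p" "smooth_on N f" "net_bound N K r k u"
  shows "net_bound N K r k (\<lambda>\<epsilon> x. p (f x) (u \<epsilon> x))"
  using net_bound_bilinear[OF assms(1) net_bound_fixed[OF assms(2)] assms(3)] by simp

lemma net_bound_fixed_right:
  assumes "bounded_bilinear p" "smooth_on N f" "net_bound N K r k u"
  shows "net_bound N K r k (\<lambda>\<epsilon> x. p (u \<epsilon> x) (f x))"
  using net_bound_bilinear[OF assms(1,3) net_bound_fixed[OF assms(2)]] by simp

end

lemma dirderiv_in_basis:
  fixes f :: "'a::euclidean_space \<Rightarrow> 'b::real_normed_vector"
  assumes "f differentiable (at x)"
  shows "dirderiv w f x = (\<Sum>b\<in>Basis. (w \<bullet> b) *\<^sub>R dirderiv b f x)"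
proof -
  have lin: "linear (\<lambda>w. dirderiv w f x)"
    using has_derivative_linear[OF has_derivative_dirderiv[OF assms]] .
  have "dirderiv w f x = dirderiv (\<Sum>b\<in>Basis. (w \<bullet> b) *\<^sub>R b) f x"
    by (simp add: euclidean_representation)
  also have "\<dots> = (\<Sum>b\<in>Basis. (w \<bullet> b) *\<^sub>R dirderiv b f x)"
    using linear_sum[OF lin, of "\<lambda>b. (w \<bullet> b) *\<^sub>R b" Basis] linear_cmul[OF lin] by simp
  finally show ?thesis .
qed

section \<open>Moderate and negligible nets through constant directions\<close>

text \<open>A Lie derivative along a smooth field combines derivatives along constant directions with
  smooth coefficients, which are bounded on compact sets; conversely, the Lie derivative along a constant
  field is a directional derivative, in every rank. So moderateness and negligibility can be tested with
  constant directions, and all ranks are treated at once. This also makes restriction to smaller open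
  sets trivial, although a field on the smaller set need not extend.\<close>

definition moderate_nets :: "pt set \<Rightarrow> 'b::real_normed_vector net set" where
  "moderate_nets N = {u. smooth_net N u \<and>
     (\<forall>K k. compact K \<longrightarrow> K \<subseteq> N \<longrightarrow> (\<exists>m::nat. order_bound K (- real m) k u))}"

definition null_nets :: "pt set \<Rightarrow> 'b::real_normed_vector net set" where
  "null_nets N = {u. smooth_net N u \<and>
     (\<forall>K k. compact K \<longrightarrow> K \<subseteq> N \<longrightarrow> (\<forall>m::nat. order_bound K (real m) k u))}"

text \<open>Lists of constant fields recover the iterated directional derivatives. Conversely, every operator in a list
  uses up one order of the bound, so a bound of order \<open>k\<close> suffices for lists of length \<open>k\<close>.\<close>

lemma
  fixes D :: "(pt \<Rightarrow> pt) \<Rightarrow> (pt \<Rightarrow> 'b::real_normed_vector) \<Rightarrow> pt \<Rightarrow> 'b"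
  assumes N: "open N"
    and const: "\<And>v f. D (\<lambda>x. v) f = dirderiv v f"
    and step: "\<And>K r k X u. compact K \<Longrightarrow> K \<subseteq> N \<Longrightarrow> smooth_on N X \<Longrightarrow>
      net_bound N K r (Suc k) u \<Longrightarrow> net_bound N K r k (\<lambda>\<epsilon>. D X (u \<epsilon>))"
  shows moderate_eq_moderate_nets: "moderate D N = moderate_nets N"
    and negligible_eq_null_nets: "negligible_nets D N = null_nets N"
proof -
  have foldr_const: "foldr D (map (\<lambda>v x. v) vs) f = foldr dirderiv vs f" for vs f
    by (induction vs) (simp_all add: const)
  \<comment> \<open>\<open>foldr\<close> applies the last field of the list first, hence the induction from the right.\<close>
  have to_lie: "sup_bigo K (\<lambda>\<epsilon>. foldr D Xs (u \<epsilon>)) r"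
    if "compact K" "K \<subseteq> N" "\<forall>X\<in>set Xs. smooth_on N X" "net_bound N K r (length Xs) u" for K Xs u r
    using that(3,4)
  proof (induction Xs arbitrary: u rule: rev_induct)
    case Nil
    then show ?case by (simp add: net_bound_0)
  next
    case (snoc X Xs)
    then have "net_bound N K r (length Xs) (\<lambda>\<epsilon>. D X (u \<epsilon>))"
      using step[OF that(1,2)] by simp
    then show ?case using snoc.IH snoc.prems by simp
  qed
  have from_lie: "order_bound K r k u"
    if "\<And>Xs. length Xs \<le> k \<Longrightarrow> \<forall>X\<in>set Xs. smooth_on N X \<Longrightarrow> sup_bigo K (\<lambda>\<epsilon>. foldr D Xs (u \<epsilon>)) r" for K r k u
    unfolding order_bound_foldr
  proof (intro allI impI)
    fix vs :: "pt list" assume "length vs \<le> k"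
    then show "sup_bigo K (\<lambda>\<epsilon>. foldr dirderiv vs (u \<epsilon>)) r"
      using that[of "map (\<lambda>v x. v) vs"] by (simp add: foldr_const smooth_on_const)
  qed
  show "moderate D N = moderate_nets N"
  proof (intro equalityI subsetI)
    fix u assume u: "u \<in> moderate D N"
    have "\<exists>m::nat. order_bound K (- real m) k u" if "compact K" "K \<subseteq> N" for K k
    proof -
      have "\<forall>j. \<exists>m::nat. \<forall>Xs. length Xs = j \<and> (\<forall>X\<in>set Xs. smooth_on N X) \<longrightarrow>
         sup_bigo K (\<lambda>\<epsilon>. foldr D Xs (u \<epsilon>)) (- real m)"
        using u that by (auto simp: moderate_def)
      then obtain m :: "nat \<Rightarrow> nat" where m: "\<And>Xs. \<forall>X\<in>set Xs. smooth_on N X \<Longrightarrow>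
         sup_bigo K (\<lambda>\<epsilon>. foldr D Xs (u \<epsilon>)) (- real (m (length Xs)))" by metis
      have "order_bound K (- real (Max (m ` {..k}))) k u"
        by (rule from_lie, rule sup_bigo_exponent_mono[OF m]) auto
      then show ?thesis by blast
    qed
    then show "u \<in> moderate_nets N" using u by (auto simp: moderate_nets_def moderate_def)
  next
    fix u :: "'b net" assume u: "u \<in> moderate_nets N"
    have "\<exists>m::nat. \<forall>Xs. length Xs = k \<and> (\<forall>X\<in>set Xs. smooth_on N X) \<longrightarrow>
         sup_bigo K (\<lambda>\<epsilon>. foldr D Xs (u \<epsilon>)) (- real m)" if K: "compact K" "K \<subseteq> N" for K k
    proof -
      obtain m :: nat where "order_bound K (- real m) k u" using u K unfolding moderate_nets_def by blast
      then have "net_bound N K (- real m) k u" using u by (simp add: moderate_nets_def net_bound_def)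
      then show ?thesis using to_lie[OF K] by (intro exI[of _ m]) auto
    qed
    then show "u \<in> moderate D N" using u by (auto simp: moderate_nets_def moderate_def)
  qed
  show "negligible_nets D N = null_nets N"
  proof (intro equalityI subsetI)
    fix u assume u: "u \<in> negligible_nets D N"
    then have "order_bound K (real m) k u" if "compact K" "K \<subseteq> N" for K k m
      using that by (intro from_lie) (auto simp: negligible_nets_def)
    then show "u \<in> null_nets N" using u by (auto simp: null_nets_def negligible_nets_def)
  next
    fix u :: "'b net" assume u: "u \<in> null_nets N"
    have "sup_bigo K (\<lambda>\<epsilon>. foldr D Xs (u \<epsilon>)) (real m)"
      if K: "compact K" "K \<subseteq> N" and Xs: "\<forall>X\<in>set Xs. smooth_on N X" for K Xs m
      using to_lie[OF K Xs] u K by (auto simp: null_nets_def net_bound_def)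
    then show "u \<in> negligible_nets D N" using u by (auto simp: null_nets_def negligible_nets_def)
  qed
qed

text \<open>The two kinds of terms in a Lie derivative: differentiating a net along a smooth field costs one order, and using the net itself as the
  direction costs none.\<close>

lemma net_bound_along_field:
  assumes N: "open N" and K: "compact K" "K \<subseteq> N" and X: "smooth_on N X"
    and u: "net_bound N K r (Suc k) u"
  shows "net_bound N K r k (\<lambda>\<epsilon> x. dirderiv (X x) (u \<epsilon>) x)"
proof (subst net_bound_cong[OF N K(2)])
  fix \<epsilon> :: real and x assume "\<epsilon> \<in> {0<..1}" "x \<in> N"
  then have "u \<epsilon> differentiable (at x)"
    using smooth_net_differentiable[OF net_bound_smooth[OF u]] by blast
  then show "dirderiv (X x) (u \<epsilon>) x = (\<Sum>b\<in>Basis. (X x \<bullet> b) *\<^sub>R dirderiv b (u \<epsilon>) x)"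
    by (rule dirderiv_in_basis)
next
  show "net_bound N K r k (\<lambda>\<epsilon> x. \<Sum>b\<in>Basis. (X x \<bullet> b) *\<^sub>R dirderiv b (u \<epsilon>) x)"
    using u
    by (intro net_bound_sum[OF N K] finite_Basis net_bound_fixed_left[OF N K bounded_bilinear_scaleR]
        smooth_on_linear[OF N bounded_linear_inner_left X]) (simp add: net_bound_Suc)
qed

lemma net_bound_net_direction:
  assumes N: "open N" and K: "compact K" "K \<subseteq> N" and X: "smooth_on N X"
    and u: "net_bound N K r k u"
  shows "net_bound N K r k (\<lambda>\<epsilon> x. dirderiv (u \<epsilon> x) X x)"
proof (subst net_bound_cong[OF N K(2)])
  fix \<epsilon> :: real and x assume "\<epsilon> \<in> {0<..1}" "x \<in> N"
  then show "dirderiv (u \<epsilon> x) X x = (\<Sum>b\<in>Basis. (u \<epsilon> x \<bullet> b) *\<^sub>R dirderiv b X x)"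
    using X by (intro dirderiv_in_basis smooth_on_differentiable)
next
  show "net_bound N K r k (\<lambda>\<epsilon> x. \<Sum>b\<in>Basis. (u \<epsilon> x \<bullet> b) *\<^sub>R dirderiv b X x)"
    by (intro net_bound_sum[OF N K] finite_Basis net_bound_fixed_right[OF N K bounded_bilinear_scaleR]
        smooth_on_dirderiv[OF X] net_bound_linear[OF N K bounded_linear_inner_left u])
qed

lemma lie0_const: "lie0 (\<lambda>x. v) f = dirderiv v f"
  by (rule ext) (simp add: lie0_def dirderiv_def)

lemma frechet_derivative_const_fun: "frechet_derivative (\<lambda>x. v) (at x) = (\<lambda>h. 0)"
  using frechet_derivative_at[OF has_derivative_const] by metis

lemma lie1_const: "lie1 (\<lambda>x. v) f = dirderiv v f"
  by (rule ext) (simp add: lie1_def dirderiv_def frechet_derivative_const_fun)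

lemma lie2_const: "lie2 (\<lambda>x. v) f = dirderiv v f"
proof -
  have 0: "matrix (\<lambda>h::pt. 0::pt) = 0" by (simp add: matrix_def vec_eq_iff)
  have "transpose (0::tensor02) = 0" by (simp add: transpose_def vec_eq_iff)
  then show ?thesis
    by (intro ext) (simp add: lie2_def Let_def dirderiv_def frechet_derivative_const_fun 0)
qed

lemma lie0_step:
  assumes "open N" "compact K" "K \<subseteq> N" "smooth_on N X" "net_bound N K r (Suc k) u"
  shows "net_bound N K r k (\<lambda>\<epsilon>. lie0 X (u \<epsilon>))"
  using net_bound_along_field[OF assms] by (simp add: lie0_def[abs_def] dirderiv_def)

lemma net_bound_diff:
  assumes "open N" "compact K" "K \<subseteq> N" "net_bound N K r k u" "net_bound N K r k v"
  shows "net_bound N K r k (\<lambda>\<epsilon> x. u \<epsilon> x - v \<epsilon> x)"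
  using net_bound_add[OF assms(1-4) net_bound_linear[OF assms(1-3)
      bounded_linear_minus[OF bounded_linear_ident] assms(5)]] by simp

lemma lie1_step:
  assumes "open N" "compact K" "K \<subseteq> N" "smooth_on N X" "net_bound N K r (Suc k) u"
  shows "net_bound N K r k (\<lambda>\<epsilon>. lie1 X (u \<epsilon>))"
  using net_bound_diff[OF assms(1-3) net_bound_along_field[OF assms]
      net_bound_net_direction[OF assms(1-4) net_bound_SucD[OF assms(5)]]]
  by (simp add: lie1_def[abs_def] dirderiv_def)

lemma bounded_bilinear_matrix_mult: "bounded_bilinear (\<lambda>(A::tensor02) (B::tensor02). A ** B)"
  unfolding bilinear_conv_bounded_bilinear[symmetric] bilinear_def
  by (auto intro!: linearI simp: vec_eq_iff matrix_matrix_mult_def algebra_simps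
      sum.distrib sum_distrib_left)

lemma bounded_linear_transpose: "bounded_linear (transpose :: tensor02 \<Rightarrow> tensor02)"
  unfolding linear_conv_bounded_linear[symmetric]
  by (auto intro!: linearI simp: transpose_def vec_eq_iff)

lemma smooth_on_jacobian:
  assumes N: "open N" and X: "smooth_on N X"
  shows "smooth_on N (\<lambda>x. matrix (frechet_derivative X (at x)) :: tensor02)"
proof -
  define col :: "4 \<Rightarrow> pt \<Rightarrow> tensor02" where "col j w = (\<chi> i j'. if j' = j then w $ i else 0)" for j w
  have lin: "bounded_linear (col j)" for j
    unfolding linear_conv_bounded_linear[symmetric]
    by (rule linearI) (simp_all add: col_def vec_eq_iff)
  have eq: "matrix (frechet_derivative X (at x)) = (\<Sum>j\<in>UNIV. col j (dirderiv (axis j 1) X x))" for x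
    by (simp add: vec_eq_iff matrix_def col_def dirderiv_def)
  show ?thesis
    unfolding eq
    by (intro smooth_on_sum[OF N] smooth_on_linear[OF N lin] smooth_on_dirderiv[OF X]) simp
qed

lemma lie2_step:
  assumes "open N" "compact K" "K \<subseteq> N" "smooth_on N X" "net_bound N K r (Suc k) u"
  shows "net_bound N K r k (\<lambda>\<epsilon>. lie2 X (u \<epsilon>))"
proof -
  note J = smooth_on_jacobian[OF assms(1,4)] and u = net_bound_SucD[OF assms(5)]
  show ?thesis
    unfolding lie2_def[abs_def] Let_def
    using net_bound_along_field[OF assms]
    by (intro net_bound_add[OF assms(1-3)] net_bound_fixed_left[OF assms(1-3) bounded_bilinear_matrix_mult]
        net_bound_fixed_right[OF assms(1-3) bounded_bilinear_matrix_mult] J u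
        smooth_on_linear[OF assms(1) bounded_linear_transpose]) (simp add: dirderiv_def)
qed

lemma moderate_lie:
  assumes "open N"
  shows "moderate lie0 N = moderate_nets N"
    "moderate lie1 N = moderate_nets N"
    "moderate lie2 N = moderate_nets N"
proof -
  show "moderate lie0 N = moderate_nets N"
    by (rule moderate_eq_moderate_nets[OF assms lie0_const]) (rule lie0_step[OF assms])
  show "moderate lie1 N = moderate_nets N"
    by (rule moderate_eq_moderate_nets[OF assms lie1_const]) (rule lie1_step[OF assms])
  show "moderate lie2 N = moderate_nets N"
    by (rule moderate_eq_moderate_nets[OF assms lie2_const]) (rule lie2_step[OF assms])
qed

lemma negligible_lie:
  assumes "open N"
  shows "negligible_nets lie0 N = null_nets N"
    "negligible_nets lie1 N = null_nets N"
    "negligible_nets lie2 N = null_nets N"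
proof -
  show "negligible_nets lie0 N = null_nets N"
    by (rule negligible_eq_null_nets[OF assms lie0_const]) (rule lie0_step[OF assms])
  show "negligible_nets lie1 N = null_nets N"
    by (rule negligible_eq_null_nets[OF assms lie1_const]) (rule lie1_step[OF assms])
  show "negligible_nets lie2 N = null_nets N"
    by (rule negligible_eq_null_nets[OF assms lie2_const]) (rule lie2_step[OF assms])
qed

lemma moderate_netsI:
  assumes "smooth_net N u"
    and "\<And>K k. compact K \<Longrightarrow> K \<subseteq> N \<Longrightarrow> \<exists>r. net_bound N K r k u"
  shows "u \<in> moderate_nets N"
proof -
  have "\<exists>m::nat. order_bound K (- real m) k u" if K: "compact K" "K \<subseteq> N" for K k
  proof -
    obtain r where r: "net_bound N K r k u" using assms(2)[OF K] by blast
    obtain m :: nat where "- r \<le> real m" using real_arch_simple by blast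
    then have "- real m \<le> r" by simp
    then show ?thesis using net_bound_exponent_mono[OF r] by (auto simp: net_bound_def)
  qed
  then show ?thesis using assms(1) by (simp add: moderate_nets_def)
qed

lemma moderate_netsE:
  assumes "u \<in> moderate_nets N" "compact K" "K \<subseteq> N"
  obtains r where "net_bound N K r k u"
proof -
  obtain m :: nat where "order_bound K (- real m) k u"
    using assms unfolding moderate_nets_def by blast
  then have "net_bound N K (- real m) k u" using assms(1) by (simp add: net_bound_def moderate_nets_def)
  then show thesis by (rule that)
qed

lemma moderate_nets_smooth: "u \<in> moderate_nets N \<Longrightarrow> smooth_net N u"
  by (simp add: moderate_nets_def)

lemma null_netsI:
  assumes "smooth_net N u"
    and "\<And>K k r. compact K \<Longrightarrow> K \<subseteq> N \<Longrightarrow> net_bound N K r k u"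
  shows "u \<in> null_nets N"
  using assms by (simp add: null_nets_def net_bound_def)

lemma null_netsD:
  assumes "u \<in> null_nets N" "compact K" "K \<subseteq> N"
  shows "net_bound N K r k u"
proof -
  obtain m :: nat where "r \<le> real m" using real_arch_simple by blast
  moreover have "net_bound N K (real m) k u" using assms by (simp add: null_nets_def net_bound_def)
  ultimately show ?thesis by (rule net_bound_exponent_mono[rotated])
qed

lemma null_nets_smooth: "u \<in> null_nets N \<Longrightarrow> smooth_net N u"
  by (simp add: null_nets_def)

lemma null_nets_moderate: "u \<in> null_nets N \<Longrightarrow> u \<in> moderate_nets N"
  using null_netsD null_nets_smooth by (intro moderate_netsI) blast+

lemma moderate_nets_subset:
  assumes "u \<in> moderate_nets N" "N' \<subseteq> N"
  shows "u \<in> moderate_nets N'"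
  using assms smooth_net_subset[of N u N'] unfolding moderate_nets_def by blast

lemma null_nets_subset:
  assumes "u \<in> null_nets N" "N' \<subseteq> N"
  shows "u \<in> null_nets N'"
  using assms smooth_net_subset[of N u N'] unfolding null_nets_def by blast

text \<open>The neighbourhood \<open>V\<close> may depend on \<open>K\<close>: this is the uniqueness part of the sheaf property.\<close>

lemma null_nets_locally:
  assumes "smooth_net N u"
    and "\<And>K. compact K \<Longrightarrow> K \<subseteq> N \<Longrightarrow> \<exists>V. K \<subseteq> V \<and> u \<in> null_nets V"
  shows "u \<in> null_nets N"
  using assms unfolding null_nets_def by blast

lemma null_nets_small:
  assumes "u \<in> null_nets N" "compact K" "K \<subseteq> N" "\<eta> > 0"
  shows "\<forall>\<^sub>F \<epsilon> in at_right 0. \<forall>x\<in>K. norm (u \<epsilon> x) \<le> \<eta>"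
proof -
  have "sup_bigo K u 1" using net_bound_sup_bigo[OF null_netsD[OF assms(1-3)]] .
  then obtain C where C: "C \<ge> 0" "\<forall>\<^sub>F \<epsilon> in at_right 0. \<forall>x\<in>K. norm (u \<epsilon> x) \<le> C * \<epsilon> powr 1"
    by (rule sup_bigoE)
  have "\<forall>\<^sub>F \<epsilon> in at_right 0. \<epsilon> \<in> {0<..<\<eta> / (C + 1)}"
    using assms(4) C(1) by (intro eventually_at_right_real) simp
  with C(2) show ?thesis
  proof (eventually_elim, intro ballI)
    fix \<epsilon> x assume 1: "\<forall>x\<in>K. norm (u \<epsilon> x) \<le> C * \<epsilon> powr 1" "\<epsilon> \<in> {0<..<\<eta> / (C + 1)}" "x \<in> K"
    then have "norm (u \<epsilon> x) \<le> C * \<epsilon>" by force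
    also have "\<dots> \<le> (C + 1) * \<epsilon>" using 1 by simp
    also have "\<dots> \<le> \<eta>" using 1 C(1) by (simp add: field_simps)
    finally show "norm (u \<epsilon> x) \<le> \<eta>" .
  qed
qed

context
  fixes N :: "pt set"
  assumes N: "open N"
begin

lemma smooth_net_fixed: "smooth_on N f \<Longrightarrow> smooth_net N (\<lambda>\<epsilon>. f)"
  by (simp add: smooth_net_def)

lemma moderate_nets_fixed: "smooth_on N f \<Longrightarrow> (\<lambda>\<epsilon>. f) \<in> moderate_nets N"
  using net_bound_fixed[OF N] by (intro moderate_netsI smooth_net_fixed) blast+

lemma moderate_nets_linear:
  assumes "bounded_linear h" "u \<in> moderate_nets N"
  shows "(\<lambda>\<epsilon> x. h (u \<epsilon> x)) \<in> moderate_nets N"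
  by (intro moderate_netsI smooth_net_linear[OF N assms(1) moderate_nets_smooth[OF assms(2)]])
     (blast intro: net_bound_linear[OF N _ _ assms(1)] elim: moderate_netsE[OF assms(2)])

lemma null_nets_linear:
  assumes "bounded_linear h" "u \<in> null_nets N"
  shows "(\<lambda>\<epsilon> x. h (u \<epsilon> x)) \<in> null_nets N"
  by (intro null_netsI smooth_net_linear[OF N assms(1) null_nets_smooth[OF assms(2)]]
      net_bound_linear[OF N _ _ assms(1)] null_netsD[OF assms(2)])

lemma null_nets_add:
  assumes "u \<in> null_nets N" "v \<in> null_nets N"
  shows "(\<lambda>\<epsilon> x. u \<epsilon> x + v \<epsilon> x) \<in> null_nets N"
  by (intro null_netsI smooth_net_add[OF N] null_nets_smooth[OF assms(1)] null_nets_smooth[OF assms(2)]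
      net_bound_add[OF N] null_netsD[OF assms(1)] null_netsD[OF assms(2)])

lemma moderate_nets_add:
  assumes "u \<in> moderate_nets N" "v \<in> moderate_nets N"
  shows "(\<lambda>\<epsilon> x. u \<epsilon> x + v \<epsilon> x) \<in> moderate_nets N"
proof (rule moderate_netsI)
  show "smooth_net N (\<lambda>\<epsilon> x. u \<epsilon> x + v \<epsilon> x)"
    using assms by (intro smooth_net_add[OF N] moderate_nets_smooth)
  fix K k assume K: "compact K" "K \<subseteq> N"
  obtain r s where "net_bound N K r k u" "net_bound N K s k v"
    using moderate_netsE[OF assms(1) K] moderate_netsE[OF assms(2) K] by metis
  then have "net_bound N K (min r s) k u" "net_bound N K (min r s) k v"
    using net_bound_exponent_mono by (metis min.cobounded1, metis min.cobounded2)
  then show "\<exists>r. net_bound N K r k (\<lambda>\<epsilon> x. u \<epsilon> x + v \<epsilon> x)"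
    using net_bound_add[OF N K] by blast
qed

lemma moderate_nets_bilinear:
  assumes p: "bounded_bilinear p" and "u \<in> moderate_nets N" "v \<in> moderate_nets N"
  shows "(\<lambda>\<epsilon> x. p (u \<epsilon> x) (v \<epsilon> x)) \<in> moderate_nets N"
proof (rule moderate_netsI)
  show "smooth_net N (\<lambda>\<epsilon> x. p (u \<epsilon> x) (v \<epsilon> x))"
    using assms by (intro smooth_net_bilinear[OF N p] moderate_nets_smooth)
  fix K k assume K: "compact K" "K \<subseteq> N"
  obtain r s where "net_bound N K r k u" "net_bound N K s k v"
    using moderate_netsE[OF assms(2) K] moderate_netsE[OF assms(3) K] by metis
  then show "\<exists>r. net_bound N K r k (\<lambda>\<epsilon> x. p (u \<epsilon> x) (v \<epsilon> x))"
    using net_bound_bilinear[OF N K p] by blast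
qed

lemma null_nets_bilinear_left:
  assumes p: "bounded_bilinear p" and "u \<in> null_nets N" "v \<in> moderate_nets N"
  shows "(\<lambda>\<epsilon> x. p (u \<epsilon> x) (v \<epsilon> x)) \<in> null_nets N"
proof (rule null_netsI)
  show "smooth_net N (\<lambda>\<epsilon> x. p (u \<epsilon> x) (v \<epsilon> x))"
    using assms by (intro smooth_net_bilinear[OF N p] moderate_nets_smooth null_nets_smooth)
  fix K k r assume K: "compact K" "K \<subseteq> N"
  obtain s where "net_bound N K s k v" using moderate_netsE[OF assms(3) K] by metis
  from net_bound_bilinear[OF N K p null_netsD[OF assms(2) K, of "r - s"] this]
  show "net_bound N K r k (\<lambda>\<epsilon> x. p (u \<epsilon> x) (v \<epsilon> x))" by simp
qed

lemma null_nets_bilinear_right: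
  assumes p: "bounded_bilinear p" and "u \<in> moderate_nets N" "v \<in> null_nets N"
  shows "(\<lambda>\<epsilon> x. p (u \<epsilon> x) (v \<epsilon> x)) \<in> null_nets N"
  using null_nets_bilinear_left[OF bounded_bilinear.flip[OF p] assms(3,2)] .

lemma null_nets_zero: "(\<lambda>\<epsilon> x. 0) \<in> null_nets N"
  by (intro null_netsI net_bound_zero[OF N]) (simp_all add: smooth_net_def smooth_on_const)

end

lemma null_nets_uminus: "open N \<Longrightarrow> u \<in> null_nets N \<Longrightarrow> (\<lambda>\<epsilon> x. - u \<epsilon> x) \<in> null_nets N"
  using null_nets_linear[OF _ bounded_linear_minus[OF bounded_linear_ident]] .

lemma moderate_nets_uminus: "open N \<Longrightarrow> u \<in> moderate_nets N \<Longrightarrow> (\<lambda>\<epsilon> x. - u \<epsilon> x) \<in> moderate_nets N"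
  using moderate_nets_linear[OF _ bounded_linear_minus[OF bounded_linear_ident]] .

lemma moderate_nets_diff:
  "open N \<Longrightarrow> u \<in> moderate_nets N \<Longrightarrow> v \<in> moderate_nets N \<Longrightarrow> (\<lambda>\<epsilon> x. u \<epsilon> x - v \<epsilon> x) \<in> moderate_nets N"
  using moderate_nets_add[OF _ _ moderate_nets_uminus, of N u v] by simp

lemma null_nets_cong:
  assumes "open N" "\<And>\<epsilon> x. \<epsilon> \<in> {0<..1} \<Longrightarrow> x \<in> N \<Longrightarrow> u \<epsilon> x = v \<epsilon> x" "u \<in> null_nets N"
  shows "v \<in> null_nets N"
proof (rule null_netsI)
  show "smooth_net N v" using smooth_net_cong[of N u v] assms(1,2) null_nets_smooth[OF assms(3)] by blast
  fix K k r assume K: "compact K" "K \<subseteq> N"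
  show "net_bound N K r k v"
    using net_bound_cong[OF assms(1) K(2), of u v] assms(2) null_netsD[OF assms(3) K] by blast
qed

section \<open>Equality of generalized objects\<close>

definition net_eq :: "pt set \<Rightarrow> 'b::real_normed_vector net \<Rightarrow> 'b net \<Rightarrow> bool" where
  "net_eq N u v \<longleftrightarrow> u \<in> moderate_nets N \<and> v \<in> moderate_nets N \<and>
     (\<lambda>\<epsilon> x. u \<epsilon> x - v \<epsilon> x) \<in> null_nets N"

abbreviation net_class :: "pt set \<Rightarrow> 'b::real_normed_vector net \<Rightarrow> 'b net set" where
  "net_class N u \<equiv> Collect (net_eq N u)"

lemma net_eq_refl: "open N \<Longrightarrow> u \<in> moderate_nets N \<Longrightarrow> net_eq N u u"
  by (simp add: net_eq_def null_nets_zero)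

lemma net_eq_sym: "open N \<Longrightarrow> net_eq N u v \<Longrightarrow> net_eq N v u"
  using null_nets_uminus[of N "\<lambda>\<epsilon> x. u \<epsilon> x - v \<epsilon> x"] by (auto simp: net_eq_def)

lemma net_eq_trans: "open N \<Longrightarrow> net_eq N u v \<Longrightarrow> net_eq N v w \<Longrightarrow> net_eq N u w"
  using null_nets_add[of N "\<lambda>\<epsilon> x. u \<epsilon> x - v \<epsilon> x" "\<lambda>\<epsilon> x. v \<epsilon> x - w \<epsilon> x"] by (auto simp: net_eq_def)

lemma net_eqD: "net_eq N u v \<Longrightarrow> u \<in> moderate_nets N" "net_eq N u v \<Longrightarrow> v \<in> moderate_nets N"
  "net_eq N u v \<Longrightarrow> (\<lambda>\<epsilon> x. u \<epsilon> x - v \<epsilon> x) \<in> null_nets N"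
  by (auto simp: net_eq_def)

lemma net_eq_subset: "net_eq N u v \<Longrightarrow> N' \<subseteq> N \<Longrightarrow> net_eq N' u v"
  by (auto simp: net_eq_def intro: moderate_nets_subset null_nets_subset)

lemma net_eq_linear:
  assumes "open N" "bounded_linear h" "net_eq N u v"
  shows "net_eq N (\<lambda>\<epsilon> x. h (u \<epsilon> x)) (\<lambda>\<epsilon> x. h (v \<epsilon> x))"
  using null_nets_linear[OF assms(1,2) net_eqD(3)[OF assms(3)]]
    moderate_nets_linear[OF assms(1,2) net_eqD(1)[OF assms(3)]]
    moderate_nets_linear[OF assms(1,2) net_eqD(2)[OF assms(3)]]
  by (simp add: net_eq_def linear_diff[OF bounded_linear.linear[OF assms(2)]])

text \<open>The usual splitting \<open>uv - u'v' = (u - u')v + u'(v - v')\<close>: negligible nets form an ideal among the moderate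
  ones.\<close>

lemma net_eq_bilinear:
  assumes N: "open N" and p: "bounded_bilinear p" and "net_eq N u u'" "net_eq N v v'"
  shows "net_eq N (\<lambda>\<epsilon> x. p (u \<epsilon> x) (v \<epsilon> x)) (\<lambda>\<epsilon> x. p (u' \<epsilon> x) (v' \<epsilon> x))"
proof -
  note a = net_eqD[OF assms(3)] net_eqD[OF assms(4)]
  have "(\<lambda>\<epsilon> x. p (u \<epsilon> x - u' \<epsilon> x) (v \<epsilon> x) + p (u' \<epsilon> x) (v \<epsilon> x - v' \<epsilon> x)) \<in> null_nets N"
    by (intro null_nets_add[OF N] null_nets_bilinear_left[OF N p a(3,4)]
        null_nets_bilinear_right[OF N p a(2,6)])
  then have "(\<lambda>\<epsilon> x. p (u \<epsilon> x) (v \<epsilon> x) - p (u' \<epsilon> x) (v' \<epsilon> x)) \<in> null_nets N"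
    by (simp add: bounded_bilinear.diff_left[OF p] bounded_bilinear.diff_right[OF p])
  then show ?thesis
    using a by (simp add: net_eq_def moderate_nets_bilinear[OF N p])
qed

lemma net_eq_diff:
  assumes N: "open N" and "net_eq N u u'" "net_eq N v v'"
  shows "net_eq N (\<lambda>\<epsilon> x. u \<epsilon> x - v \<epsilon> x) (\<lambda>\<epsilon> x. u' \<epsilon> x - v' \<epsilon> x)"
proof -
  note a = net_eqD[OF assms(2)] net_eqD[OF assms(3)]
  have "(\<lambda>\<epsilon> x. (u \<epsilon> x - u' \<epsilon> x) + - (v \<epsilon> x - v' \<epsilon> x)) \<in> null_nets N"
    by (intro null_nets_add[OF N] null_nets_uminus[OF N] a)
  then show ?thesis
    using a by (simp add: net_eq_def moderate_nets_diff[OF N] algebra_simps)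
qed

lemma net_class_eq: "open N \<Longrightarrow> net_eq N u v \<Longrightarrow> net_class N u = net_class N v"
  by (blast intro: net_eq_sym net_eq_trans)

lemma net_class_eq_iff:
  assumes "open N" "u \<in> moderate_nets N" "v \<in> moderate_nets N"
  shows "net_class N u = net_class N v \<longleftrightarrow> net_eq N u v"
proof
  assume "net_class N u = net_class N v"
  then show "net_eq N u v" using net_eq_refl[OF assms(1,3)] by blast
qed (rule net_class_eq[OF assms(1)])

lemma colombeau_rel_lie:
  assumes "open N"
  shows "colombeau_rel lie0 N = {(u, v). net_eq N u v}"
    and "colombeau_rel lie1 N = {(u, v). net_eq N u v}"
    and "colombeau_rel lie2 N = {(u, v). net_eq N u v}"
  by (simp_all add: colombeau_rel_def net_eq_def moderate_lie[OF assms] negligible_lie[OF assms])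

lemma colombeau_lie:
  assumes "open N"
  shows "G00 N = net_class N ` moderate_nets N"
    and "G10 N = net_class N ` moderate_nets N"
    and "G02 N = net_class N ` moderate_nets N"
  by (simp_all add: colombeau_def colombeau_rel_lie[OF assms] moderate_lie[OF assms] quotient_def
      Image_singleton UNION_singleton_eq_range)

lemma lie0_class: "open N \<Longrightarrow> colombeau_rel lie0 N `` {u} = net_class N u"
  by (auto simp: colombeau_rel_lie)

text \<open>Operations on representatives are well defined on sets of nets with negligible differences. Classes are
  such sets, also after restriction, where they cease to be classes; and so is the embedded metric,
  which is given by local conditions.\<close>

definition coherent :: "pt set \<Rightarrow> 'b::real_normed_vector net set \<Rightarrow> bool" where
  "coherent N S \<longleftrightarrow> (\<forall>s\<in>S. \<forall>s'\<in>S. net_eq N s s')"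

lemma coherent_net_class: "open N \<Longrightarrow> coherent N (net_class N u)"
  unfolding coherent_def mem_Collect_eq using net_eq_sym net_eq_trans by blast

lemma coherent_subset: "coherent N S \<Longrightarrow> N' \<subseteq> N \<Longrightarrow> coherent N' S"
  unfolding coherent_def by (blast intro: net_eq_subset)

lemma Union_constant:
  assumes "a \<in> A" "\<And>x. x \<in> A \<Longrightarrow> F x = C"
  shows "(\<Union>x\<in>A. F x) = C"
  using assms by blast

lemma Union_constant2:
  assumes "a \<in> A" "b \<in> B" "\<And>x y. x \<in> A \<Longrightarrow> y \<in> B \<Longrightarrow> F x y = C"
  shows "(\<Union>x\<in>A. \<Union>y\<in>B. F x y) = C"
  using assms by blast

lemma Union_net_class:
  assumes "open N" "a \<in> A" "\<And>x. x \<in> A \<Longrightarrow> net_eq N (F x) (F a)"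
  shows "(\<Union>x\<in>A. net_class N (F x)) = net_class N (F a)"
  using assms by (intro Union_constant[OF assms(2)] net_class_eq)

lemma gzero_eq: "open N \<Longrightarrow> gzero N = net_class N (\<lambda>\<epsilon> x. 0)"
  by (simp add: gzero_def lie0_class)

lemma gmult_eq:
  assumes "open N" "a \<in> moderate_nets N" "b \<in> moderate_nets N"
  shows "gmult N (net_class N a) (net_class N b) = net_class N (\<lambda>\<epsilon> x. a \<epsilon> x * b \<epsilon> x)"
proof -
  have "net_eq N (\<lambda>\<epsilon> x. a' \<epsilon> x * b' \<epsilon> x) (\<lambda>\<epsilon> x. a \<epsilon> x * b \<epsilon> x)"
    if "net_eq N a a'" "net_eq N b b'" for a' b'
    using net_eq_sym[OF assms(1) net_eq_bilinear[OF assms(1) bounded_bilinear_mult that]] .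
  then have "net_class N (\<lambda>\<epsilon> x. a' \<epsilon> x * b' \<epsilon> x) = net_class N (\<lambda>\<epsilon> x. a \<epsilon> x * b \<epsilon> x)"
    if "net_eq N a a'" "net_eq N b b'" for a' b'
    using net_class_eq[OF assms(1)] that by blast
  note * = this
  show ?thesis
    unfolding gmult_def lie0_class[OF assms(1)]
  proof (rule Union_constant2)
    show "a \<in> net_class N a" "b \<in> net_class N b"
      using net_eq_refl[OF assms(1)] assms by simp_all
  qed (rule *, simp_all only: mem_Collect_eq)
qed

lemma gdiff_eq:
  assumes "open N" "a \<in> moderate_nets N" "b \<in> moderate_nets N"
  shows "gdiff N (net_class N a) (net_class N b) = net_class N (\<lambda>\<epsilon> x. a \<epsilon> x - b \<epsilon> x)"
proof -
  have "net_eq N (\<lambda>\<epsilon> x. a' \<epsilon> x - b' \<epsilon> x) (\<lambda>\<epsilon> x. a \<epsilon> x - b \<epsilon> x)"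
    if "net_eq N a a'" "net_eq N b b'" for a' b'
    using net_eq_sym[OF assms(1) net_eq_diff[OF assms(1) that]] .
  then have "net_class N (\<lambda>\<epsilon> x. a' \<epsilon> x - b' \<epsilon> x) = net_class N (\<lambda>\<epsilon> x. a \<epsilon> x - b \<epsilon> x)"
    if "net_eq N a a'" "net_eq N b b'" for a' b'
    using net_class_eq[OF assms(1)] that by blast
  note * = this
  show ?thesis
    unfolding gdiff_def lie0_class[OF assms(1)]
  proof (rule Union_constant2)
    show "a \<in> net_class N a" "b \<in> net_class N b"
      using net_eq_refl[OF assms(1)] assms by simp_all
  qed (rule *, simp_all only: mem_Collect_eq)
qed

lemma bounded_bilinear_matrix_vector: "bounded_bilinear (\<lambda>(A::tensor02) (w::pt). A *v w)"
  unfolding bilinear_conv_bounded_bilinear[symmetric] bilinear_def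
  by (auto intro!: linearI simp: vec_eq_iff matrix_vector_mult_def algebra_simps
      sum.distrib sum_distrib_left)

lemma bilin_eq_inner: "bilin A v w = v \<bullet> (A *v w)"
  by (simp add: bilin_def inner_vec_def matrix_vector_mult_def sum_distrib_left mult_ac)

lemma net_eq_bilin:
  assumes "open N" "net_eq N s s'" "net_eq N v v'" "net_eq N w w'"
  shows "net_eq N (\<lambda>\<epsilon> x. bilin (s \<epsilon> x) (v \<epsilon> x) (w \<epsilon> x)) (\<lambda>\<epsilon> x. bilin (s' \<epsilon> x) (v' \<epsilon> x) (w' \<epsilon> x))"
  unfolding bilin_eq_inner
  by (intro net_eq_bilinear[OF assms(1) bounded_bilinear_inner] assms
      net_eq_bilinear[OF assms(1) bounded_bilinear_matrix_vector])

lemma moderate_bilin: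
  assumes "open N" "s \<in> moderate_nets N" "v \<in> moderate_nets N" "w \<in> moderate_nets N"
  shows "(\<lambda>\<epsilon> x. bilin (s \<epsilon> x) (v \<epsilon> x) (w \<epsilon> x)) \<in> moderate_nets N"
  by (rule net_eqD(1)[OF net_eq_bilin[where s' = s and v' = v and w' = w]])
     (use assms in \<open>simp_all only: net_eq_refl\<close>)

text \<open>The components of a vector field in a chart are its derivatives of the chart map, and these depend linearly
  on the field, with smooth coefficients.\<close>

lemma net_eq_dirderiv:
  assumes N: "open N" and \<phi>: "smooth_on N \<phi>" and uv: "net_eq N u v"
  shows "net_eq N (\<lambda>\<epsilon> x. dirderiv (u \<epsilon> x) \<phi> x) (\<lambda>\<epsilon> x. dirderiv (v \<epsilon> x) \<phi> x)"
proof -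
  have eq: "dirderiv w \<phi> x = (\<Sum>b\<in>Basis. (w \<bullet> b) *\<^sub>R dirderiv b \<phi> x)" if "x \<in> N" for w x
    using smooth_on_differentiable[OF \<phi> that] by (rule dirderiv_in_basis)
  have sm: "smooth_net N (\<lambda>\<epsilon> x. dirderiv (w \<epsilon> x) \<phi> x)" if "smooth_net N w" for w
  proof (subst smooth_net_cong[OF N])
    show "smooth_net N (\<lambda>\<epsilon> x. \<Sum>b\<in>Basis. (w \<epsilon> x \<bullet> b) *\<^sub>R dirderiv b \<phi> x)"
      unfolding smooth_net_def
    proof
      fix \<epsilon> :: real assume "\<epsilon> \<in> {0<..1}"
      then have "smooth_on N (w \<epsilon>)" using that by (simp add: smooth_net_def)
      then show "smooth_on N (\<lambda>x. \<Sum>b\<in>Basis. (w \<epsilon> x \<bullet> b) *\<^sub>R dirderiv b \<phi> x)"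
        by (intro smooth_on_sum[OF N] finite_Basis smooth_on_bilinear[OF N bounded_bilinear_scaleR]
            smooth_on_linear[OF N bounded_linear_inner_left] smooth_on_dirderiv[OF \<phi>])
    qed
  qed (rule eq)
  have mod: "(\<lambda>\<epsilon> x. dirderiv (w \<epsilon> x) \<phi> x) \<in> moderate_nets N" if w: "w \<in> moderate_nets N" for w
  proof (intro moderate_netsI sm moderate_nets_smooth[OF w])
    fix K k assume K: "compact K" "K \<subseteq> N"
    obtain r where "net_bound N K r k w" using moderate_netsE[OF w K] .
    then show "\<exists>r. net_bound N K r k (\<lambda>\<epsilon> x. dirderiv (w \<epsilon> x) \<phi> x)"
      using net_bound_net_direction[OF N K \<phi>] by (intro exI)
  qed
  have "(\<lambda>\<epsilon> x. dirderiv (u \<epsilon> x - v \<epsilon> x) \<phi> x) \<in> null_nets N"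
    by (intro null_netsI sm null_nets_smooth[OF net_eqD(3)[OF uv]]
        net_bound_net_direction[OF N _ _ \<phi>] null_netsD[OF net_eqD(3)[OF uv]])
  moreover have "dirderiv (u \<epsilon> x - v \<epsilon> x) \<phi> x = dirderiv (u \<epsilon> x) \<phi> x - dirderiv (v \<epsilon> x) \<phi> x" if "x \<in> N" for \<epsilon> x
    by (rule linear_diff[OF has_derivative_linear[OF has_derivative_dirderiv[OF
            smooth_on_differentiable[OF \<phi> that]]]])
  ultimately have "(\<lambda>\<epsilon> x. dirderiv (u \<epsilon> x) \<phi> x - dirderiv (v \<epsilon> x) \<phi> x) \<in> null_nets N"
    by (intro null_nets_cong[OF N _ \<open>(\<lambda>\<epsilon> x. dirderiv (u \<epsilon> x - v \<epsilon> x) \<phi> x) \<in> null_nets N\<close>])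
  then show ?thesis using mod net_eqD[OF uv] by (simp add: net_eq_def)
qed

subsection \<open>Components in a chart\<close>

lemma chart_open: "chart N W \<phi> \<Longrightarrow> open W" and chart_subset: "chart N W \<phi> \<Longrightarrow> W \<subseteq> N"
  and chart_smooth: "chart N W \<phi> \<Longrightarrow> smooth_on W \<phi>"
  by (auto simp: chart_def)

lemma smooth_on_coord_field:
  assumes "chart N W \<phi>"
  shows "smooth_on W (coord_field W \<phi> i)"
proof -
  have "smooth_on W (\<lambda>x. dirderiv (axis i 1) (inv_into W \<phi>) (\<phi> x))"
    using assms by (intro smooth_on_compose[where S = "\<phi> ` W" and f = \<phi>, OF _ _ _ smooth_on_dirderiv])
      (simp_all add: chart_def)
  then show ?thesis by (simp add: coord_field_def[abs_def] dirderiv_def)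
qed

text \<open>The coefficients are those of \<open>d\<phi>(v)\<close>, and differentiating \<open>\<phi>\<^sup>-\<^sup>1 \<circ> \<phi>\<close> gives back \<open>v\<close>.\<close>

lemma coord_field_decomposition:
  assumes "chart N W \<phi>" "x \<in> W"
  shows "(\<Sum>i\<in>UNIV. (dirderiv v \<phi> x $ i) *\<^sub>R coord_field W \<phi> i x) = v"
proof -
  let ?g = "inv_into W \<phi>"
  have \<phi>: "\<phi> differentiable (at x)" and g: "?g differentiable (at (\<phi> x))"
    using assms smooth_on_differentiable[of W \<phi> x] smooth_on_differentiable[of "\<phi> ` W" ?g "\<phi> x"]
    by (simp_all add: chart_def)
  have lin: "linear (\<lambda>w. dirderiv w ?g (\<phi> x))"
    using has_derivative_linear[OF has_derivative_dirderiv[OF g]] .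
  have "(\<Sum>i\<in>UNIV. (dirderiv v \<phi> x $ i) *\<^sub>R coord_field W \<phi> i x)
      = (\<Sum>i\<in>UNIV. dirderiv ((dirderiv v \<phi> x $ i) *\<^sub>R axis i 1) ?g (\<phi> x))"
    by (simp add: coord_field_def dirderiv_def[symmetric] linear_cmul[OF lin])
  also have "\<dots> = dirderiv (\<Sum>i\<in>UNIV. (dirderiv v \<phi> x $ i) *\<^sub>R axis i 1) ?g (\<phi> x)"
    using linear_sum[OF lin, of "\<lambda>i. (dirderiv v \<phi> x $ i) *\<^sub>R axis i 1" UNIV] by simp
  also have "(\<Sum>i\<in>UNIV. (dirderiv v \<phi> x $ i) *\<^sub>R axis i 1) = dirderiv v \<phi> x"
    using basis_expansion[of "dirderiv v \<phi> x"] by (simp add: scalar_mult_eq_scaleR)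
  also have "dirderiv (dirderiv v \<phi> x) ?g (\<phi> x) = dirderiv v (\<lambda>y. ?g (\<phi> y)) x"
    using dirderiv_eq[OF dirderiv_compose(1)[OF \<phi> g]] by simp
  also have "\<dots> = dirderiv v (\<lambda>y. y) x"
    using assms by (intro dirderiv_cong_open[of W]) (auto simp: chart_def)
  also have "\<dots> = v" by (rule dirderiv_eq[OF has_derivative_ident])
  finally show ?thesis .
qed

lemma gcomp2_eq:
  assumes "chart N W \<phi>" "coherent W S" "s \<in> S"
  shows "gcomp2 W \<phi> S i j =
      net_class W (\<lambda>\<epsilon> x. bilin (s \<epsilon> x) (coord_field W \<phi> i x) (coord_field W \<phi> j x))"
proof -
  note W = chart_open[OF assms(1)]
  have c: "net_eq W (\<lambda>\<epsilon>. coord_field W \<phi> i) (\<lambda>\<epsilon>. coord_field W \<phi> i)" for i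
    by (intro net_eq_refl[OF W] moderate_nets_fixed[OF W] smooth_on_coord_field[OF assms(1)])
  show ?thesis
    unfolding gcomp2_def lie0_class[OF W]
    using assms(2,3) by (intro Union_net_class[OF W] net_eq_bilin[OF W] c) (auto simp: coherent_def)
qed

lemma moderate_component2:
  assumes "chart N W \<phi>" "s \<in> moderate_nets W"
  shows "(\<lambda>\<epsilon> x. bilin (s \<epsilon> x) (coord_field W \<phi> i x) (coord_field W \<phi> j x)) \<in> moderate_nets W"
  using assms chart_open[OF assms(1)] smooth_on_coord_field[OF assms(1)]
  by (intro moderate_bilin moderate_nets_fixed)

lemma net_eq_component1:
  assumes "chart N W \<phi>" "net_eq W u v"
  shows "net_eq W (\<lambda>\<epsilon> x. dirderiv (u \<epsilon> x) \<phi> x $ i) (\<lambda>\<epsilon> x. dirderiv (v \<epsilon> x) \<phi> x $ i)"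
  by (intro net_eq_linear[where h = "\<lambda>v. v $ i"] net_eq_dirderiv chart_open[OF assms(1)]
      chart_smooth[OF assms(1)] assms(2) bounded_linear_vec_nth)

lemma gcomp1_eq:
  assumes "chart N W \<phi>" "coherent W X" "v \<in> X"
  shows "gcomp1 W \<phi> X i = net_class W (\<lambda>\<epsilon> x. dirderiv (v \<epsilon> x) \<phi> x $ i)"
proof -
  note W = chart_open[OF assms(1)]
  show ?thesis
    unfolding gcomp1_def lie0_class[OF W] dirderiv_def[symmetric]
    using assms(2,3) by (intro Union_net_class[OF W] net_eq_component1[OF assms(1)]) (auto simp: coherent_def)
qed

lemma geval2_eq:
  assumes N: "open N" and "coherent N S" "coherent N X" "s \<in> S" "v \<in> X"
  shows "geval2 N S X X = net_class N (\<lambda>\<epsilon> x. bilin (s \<epsilon> x) (v \<epsilon> x) (v \<epsilon> x))"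
proof -
  have "net_class N (\<lambda>\<epsilon> x. bilin (s' \<epsilon> x) (v' \<epsilon> x) (w' \<epsilon> x)) = net_class N (\<lambda>\<epsilon> x. bilin (s \<epsilon> x) (v \<epsilon> x) (v \<epsilon> x))"
    if "s' \<in> S" "v' \<in> X" "w' \<in> X" for s' v' w'
    using assms that by (intro net_class_eq[OF N] net_eq_bilin[OF N]) (auto simp: coherent_def)
  then show ?thesis
    unfolding geval2_def lie0_class[OF N]
    by (intro Union_constant[OF assms(4)] Union_constant2[OF assms(5) assms(5)])
qed

section \<open>Non-negativity as local convergence in the mean\<close>

text \<open>Testing with all \<open>w\<close> amounts to \<open>L\<^sup>1\<close> convergence of the negative parts on compact sets: the negative parts have a
  sign, so a cut-off function that equals \<open>1\<close> on \<open>K\<close> controls the integral over \<open>K\<close>, and \<open>w\<close> is bounded on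
  its support.\<close>

definition nonneg_net :: "pt set \<Rightarrow> real net \<Rightarrow> bool" where
  "nonneg_net N u \<longleftrightarrow> (\<forall>K. compact K \<longrightarrow> K \<subseteq> N \<longrightarrow>
     ((\<lambda>\<epsilon>. LINT x:K|lborel. min (u \<epsilon> x) 0) \<longlongrightarrow> 0) (at_right 0))"

lemma smooth_net_continuous: "smooth_net N u \<Longrightarrow> \<epsilon> \<in> {0<..1} \<Longrightarrow> continuous_on N (u \<epsilon>)"
  by (simp add: smooth_net_def smooth_on_continuous)

lemma set_integrable_compact:
  fixes f :: "pt \<Rightarrow> real"
  assumes "compact K" "continuous_on K f"
  shows "set_integrable lborel K f"
  unfolding set_integrable_def using borel_integrable_compact[OF assms] .

lemma set_integrable_negative_part:
  fixes u :: "real net"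
  assumes "smooth_net N u" "compact K" "K \<subseteq> N" "\<epsilon> \<in> {0<..1}"
  shows "set_integrable lborel K (\<lambda>x. min (u \<epsilon> x) 0)"
  using continuous_on_subset[OF smooth_net_continuous[OF assms(1,4)] assms(3)]
  by (intro set_integrable_compact[OF assms(2)] continuous_on_min[OF _ continuous_on_const])

lemma negative_part_integral_nonpos: "(LINT x:K|lborel. min (u x) 0) \<le> (0::real)" for u :: "pt \<Rightarrow> real"
proof -
  have "0 \<le> (LINT x|lborel. - (indicat_real K x *\<^sub>R min (u x) 0))"
    by (rule integral_nonneg_AE) (simp add: indicator_def min_le_iff_disj)
  then show ?thesis by (simp add: set_lebesgue_integral_def)
qed

text \<open>Locally bounded factors enter through \<open>C\<close>, negligible changes through \<open>\<eta>\<close>: an error \<open>\<eta>\<close> changes the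
  integral over \<open>K\<close> by at most \<open>\<eta>\<close> times the measure of \<open>K\<close>.\<close>

lemma nonneg_net_lower_bound:
  assumes u: "smooth_net N u" and v: "smooth_net N v" and nn: "nonneg_net N u"
    and bound: "\<And>K. compact K \<Longrightarrow> K \<subseteq> N \<Longrightarrow> \<exists>C\<ge>0. \<forall>\<eta>>0. \<forall>\<^sub>F \<epsilon> in at_right 0.
       \<forall>x\<in>K. C * min (u \<epsilon> x) 0 - \<eta> \<le> v \<epsilon> x"
  shows "nonneg_net N v"
  unfolding nonneg_net_def
proof (intro allI impI)
  fix K assume K: "compact K" "K \<subseteq> N"
  let ?I = "\<lambda>u \<epsilon>. LINT x:K|lborel. min (u \<epsilon> x) 0"
  obtain C where C: "C \<ge> 0" "\<And>\<eta>. \<eta> > 0 \<Longrightarrow> \<forall>\<^sub>F \<epsilon> in at_right 0.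
       \<forall>x\<in>K. C * min (u \<epsilon> x) 0 - \<eta> \<le> v \<epsilon> x"
    using bound[OF K] by blast
  have u0: "(?I u \<longlongrightarrow> 0) (at_right 0)" using nn K by (simp add: nonneg_net_def)
  show "(?I v \<longlongrightarrow> 0) (at_right 0)"
  proof (rule tendstoI)
    fix e :: real assume e: "e > 0"
    \<comment> \<open>The constant \<open>1\<close> is added because \<open>K\<close> may have measure zero.\<close>
    define m where "m = measure lborel K"
    define \<eta> where "\<eta> = e / (2 * (m + 1))"
    have m0: "m \<ge> 0" by (simp only: m_def measure_nonneg)
    then have \<eta>: "\<eta> > 0" using e by (simp add: \<eta>_def)
    have "\<eta> * m = (e / 2) * (m / (m + 1))"
      using m0 by (simp add: \<eta>_def)
    also have "\<dots> < e / 2 * 1" using e m0 by (intro mult_strict_left_mono) (auto simp: field_simps)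
    finally have \<eta>2: "\<eta> * m < e / 2" by simp
    have "\<forall>\<^sub>F \<epsilon> in at_right 0. dist (?I u \<epsilon>) 0 < e / (2 * (C + 1))"
      using tendstoD[OF u0] e C(1) by simp
    with C(2)[OF \<eta>] eventually_unit_interval
    show "\<forall>\<^sub>F \<epsilon> in at_right 0. dist (?I v \<epsilon>) 0 < e"
    proof eventually_elim
      fix \<epsilon> :: real assume b: "\<forall>x\<in>K. C * min (u \<epsilon> x) 0 - \<eta> \<le> v \<epsilon> x" and e1: "\<epsilon> \<in> {0<..1}"
        and d: "dist (?I u \<epsilon>) 0 < e / (2 * (C + 1))"
      have iu: "set_integrable lborel K (\<lambda>x. min (u \<epsilon> x) 0)"
        and iv: "set_integrable lborel K (\<lambda>x. min (v \<epsilon> x) 0)"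
        using set_integrable_negative_part[OF _ K e1] u v by auto
      have ie: "set_integrable lborel K (\<lambda>x. \<eta>)"
        by (intro set_integrable_compact[OF K(1)] continuous_on_const)
      have ile: "set_integrable lborel K (\<lambda>x. C * min (u \<epsilon> x) 0 - \<eta>)"
        using iu ie by (intro set_integral_diff(1) set_integrable_mult_right)
      have cst: "(LINT x:K|lborel. \<eta>) = \<eta> * m"
        unfolding m_def using set_integral_const[of K lborel \<eta>] emeasure_compact_finite[OF K(1)] borel_compact[OF K(1)]
        by (simp add: mult.commute less_top[symmetric])
      have "(LINT x:K|lborel. C * min (u \<epsilon> x) 0 - \<eta>) = (LINT x:K|lborel. C * min (u \<epsilon> x) 0) - (LINT x:K|lborel. \<eta>)"
        by (rule set_integral_diff(2)[OF set_integrable_mult_right[OF _] ie]) (rule iu)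
      then have "C * ?I u \<epsilon> - \<eta> * m = (LINT x:K|lborel. C * min (u \<epsilon> x) 0 - \<eta>)"
        unfolding cst by (simp only: set_integral_mult_right)
      also have "\<dots> \<le> ?I v \<epsilon>"
      proof (rule set_integral_mono[OF ile iv])
        fix x assume "x \<in> K"
        moreover have "C * min (u \<epsilon> x) 0 \<le> 0" using C(1) by (intro mult_nonneg_nonpos) auto
        ultimately show "C * min (u \<epsilon> x) 0 - \<eta> \<le> min (v \<epsilon> x) 0" using b \<eta> by auto
      qed
      finally have low: "C * ?I u \<epsilon> - \<eta> * m \<le> ?I v \<epsilon>" .
      have iu0: "?I u \<epsilon> \<le> 0" and iv0: "?I v \<epsilon> \<le> 0" by (rule negative_part_integral_nonpos)+
      have "C * (- ?I u \<epsilon>) \<le> (C + 1) * (- ?I u \<epsilon>)" using iu0 by (intro mult_right_mono) auto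
      also have "\<dots> \<le> (C + 1) * (e / (2 * (C + 1)))" using d C(1) iu0 by (intro mult_left_mono) auto
      also have "\<dots> = e / 2" using C(1) by (simp add: divide_simps)
      finally have "C * (- ?I u \<epsilon>) \<le> e / 2" .
      then show "dist (?I v \<epsilon>) 0 < e" using low iv0 \<eta>2 by auto
    qed
  qed
qed

lemma nonneg_net_add:
  assumes u: "smooth_net N u" and v: "smooth_net N v" and "open N"
    and nn: "nonneg_net N u" "nonneg_net N v"
  shows "nonneg_net N (\<lambda>\<epsilon> x. u \<epsilon> x + v \<epsilon> x)"
  unfolding nonneg_net_def
proof (intro allI impI)
  fix K assume K: "compact K" "K \<subseteq> N"
  let ?I = "\<lambda>u \<epsilon>. LINT x:K|lborel. min (u \<epsilon> x) 0"
  have "((\<lambda>\<epsilon>. ?I u \<epsilon> + ?I v \<epsilon>) \<longlongrightarrow> 0 + 0) (at_right 0)"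
    using nn K by (intro tendsto_add) (auto simp: nonneg_net_def)
  then have lim: "((\<lambda>\<epsilon>. ?I u \<epsilon> + ?I v \<epsilon>) \<longlongrightarrow> 0) (at_right 0)" by simp
  have low: "\<forall>\<^sub>F \<epsilon> in at_right 0. ?I u \<epsilon> + ?I v \<epsilon> \<le> ?I (\<lambda>\<epsilon> x. u \<epsilon> x + v \<epsilon> x) \<epsilon>"
  proof (rule eventually_mono[OF eventually_unit_interval])
    fix \<epsilon> :: real assume e1: "\<epsilon> \<in> {0<..1}"
    note i = set_integrable_negative_part[OF _ K e1]
    show "?I u \<epsilon> + ?I v \<epsilon> \<le> ?I (\<lambda>\<epsilon> x. u \<epsilon> x + v \<epsilon> x) \<epsilon>"
      unfolding set_integral_add(2)[OF i[OF u] i[OF v], symmetric]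
      by (rule set_integral_mono[OF set_integral_add(1)[OF i[OF u] i[OF v]] i[OF smooth_net_add[OF assms(3) u v]]])
         (simp add: min_def)
  qed
  show "(?I (\<lambda>\<epsilon> x. u \<epsilon> x + v \<epsilon> x) \<longlongrightarrow> 0) (at_right 0)"
    by (rule tendsto_sandwich[OF low always_eventually[rule_format] lim tendsto_const])
       (rule negative_part_integral_nonpos)
qed

lemma nonneg_net_eq:
  assumes N: "open N" and "net_eq N u v" "nonneg_net N u"
  shows "nonneg_net N v"
proof (rule nonneg_net_lower_bound[OF _ _ assms(3)])
  show "smooth_net N u" "smooth_net N v" using net_eqD[OF assms(2)] by (auto intro: moderate_nets_smooth)
  fix K assume K: "compact K" "K \<subseteq> N"
  have "\<forall>\<^sub>F \<epsilon> in at_right 0. \<forall>x\<in>K. 1 * min (u \<epsilon> x) 0 - \<eta> \<le> v \<epsilon> x" if "\<eta> > 0" for \<eta> :: real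
  proof (rule eventually_mono[OF null_nets_small[OF net_eqD(3)[OF assms(2)] K that]], rule ballI)
    fix \<epsilon> x assume "\<forall>x\<in>K. norm (u \<epsilon> x - v \<epsilon> x) \<le> \<eta>" "x \<in> K"
    then have "\<bar>u \<epsilon> x - v \<epsilon> x\<bar> \<le> \<eta>" by simp
    then show "1 * min (u \<epsilon> x) 0 - \<eta> \<le> v \<epsilon> x" by (auto simp: min_def)
  qed
  then show "\<exists>C\<ge>0. \<forall>\<eta>>0. \<forall>\<^sub>F \<epsilon> in at_right 0. \<forall>x\<in>K. C * min (u \<epsilon> x) 0 - \<eta> \<le> v \<epsilon> x"
    by (intro exI[of _ 1]) auto
qed

lemma test_function_zero_outside: "x \<notin> supp w \<Longrightarrow> w x = 0"
  unfolding supp_def using closure_subset[of "{x. w x \<noteq> 0}"] by auto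

lemma test_integral_on_support:
  assumes "test_function N w" "supp w \<subseteq> K" "K \<subseteq> N"
  shows "(LINT x:N|lborel. f x * w x) = (LINT x:K|lborel. f x * w x)"
proof -
  have "indicat_real N x *\<^sub>R (f x * w x) = indicat_real K x *\<^sub>R (f x * w x)" for x
    using test_function_zero_outside[of x w] assms(2,3) by (auto simp: indicator_def)
  then show ?thesis by (simp only: set_lebesgue_integral_def)
qed

lemma gnonneg_net_class:
  assumes N: "open N" and u: "u \<in> moderate_nets N"
  shows "gnonneg N (net_class N u) \<longleftrightarrow> nonneg_net N u"
proof
  assume "gnonneg N (net_class N u)"
  then obtain v where uv: "net_eq N u v" and test: "\<And>w. test_function N w \<Longrightarrow>
     ((\<lambda>\<epsilon>. LINT x:N|lborel. min (v \<epsilon> x) 0 * w x) \<longlongrightarrow> 0) (at_right 0)"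
    unfolding gnonneg_def by blast
  have v: "smooth_net N v" using moderate_nets_smooth[OF net_eqD(2)[OF uv]] .
  have "nonneg_net N v"
    unfolding nonneg_net_def
  proof (intro allI impI)
    fix K assume K: "compact K" "K \<subseteq> N"
    let ?I = "\<lambda>\<epsilon>. LINT x:K|lborel. min (v \<epsilon> x) 0"
    obtain c Q where c: "test_function N c" "K \<subseteq> Q" "\<And>x. x \<in> Q \<Longrightarrow> c x = 1" "\<And>x. 0 \<le> c x"
      using cutoff_exists[OF K(1) N K(2)] by metis
    define K' where "K' = K \<union> supp c"
    have K': "compact K'" "K' \<subseteq> N" "supp c \<subseteq> K'" "K \<subseteq> K'"
      using c(1) K by (auto simp: K'_def test_function_def)
    have cont: "continuous_on K' c"
      using c(1) continuous_on_subset[OF smooth_on_continuous, of UNIV c K'] by (simp add: test_function_def)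
    have low: "\<forall>\<^sub>F \<epsilon> in at_right 0. (LINT x:N|lborel. min (v \<epsilon> x) 0 * c x) \<le> ?I \<epsilon>"
    proof (rule eventually_mono[OF eventually_unit_interval])
      fix \<epsilon> :: real assume e1: "\<epsilon> \<in> {0<..1}"
      have cv: "continuous_on K' (v \<epsilon>)"
        using continuous_on_subset[OF smooth_net_continuous[OF v e1] K'(2)] .
      have "(LINT x:K'|lborel. min (v \<epsilon> x) 0 * c x) \<le> ?I \<epsilon>"
        unfolding set_lebesgue_integral_def
      proof (rule integral_mono)
        show "integrable lborel (\<lambda>x. indicat_real K' x *\<^sub>R (min (v \<epsilon> x) 0 * c x))"
          using set_integrable_compact[OF K'(1) continuous_on_mult[OF continuous_on_min[OF cv continuous_on_const] cont]]
          by (simp add: set_integrable_def)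
        show "integrable lborel (\<lambda>x. indicat_real K x *\<^sub>R min (v \<epsilon> x) 0)"
          using set_integrable_negative_part[OF v K e1] by (simp add: set_integrable_def)
        fix x
        have "min (v \<epsilon> x) 0 * c x \<le> 0" using c(4)[of x] by (simp add: mult_nonpos_nonneg)
        then show "indicat_real K' x *\<^sub>R (min (v \<epsilon> x) 0 * c x) \<le> indicat_real K x *\<^sub>R min (v \<epsilon> x) 0"
          using c(2,3) K'(4) by (auto simp: indicator_def subset_iff)
      qed
      then show "(LINT x:N|lborel. min (v \<epsilon> x) 0 * c x) \<le> ?I \<epsilon>"
        by (simp add: test_integral_on_support[OF c(1) K'(3,2)])
    qed
    show "(?I \<longlongrightarrow> 0) (at_right 0)"
      by (rule tendsto_sandwich[OF low always_eventually[rule_format] test[OF c(1)] tendsto_const])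
         (rule negative_part_integral_nonpos)
  qed
  then show "nonneg_net N u" using nonneg_net_eq[OF N net_eq_sym[OF N uv]] by blast
next
  assume nn: "nonneg_net N u"
  have "((\<lambda>\<epsilon>. LINT x:N|lborel. min (u \<epsilon> x) 0 * w x) \<longlongrightarrow> 0) (at_right 0)" if w: "test_function N w" for w
  proof -
    have K: "compact (supp w)" "supp w \<subseteq> N" using w by (auto simp: test_function_def)
    let ?I = "\<lambda>\<epsilon>. LINT x:supp w|lborel. min (u \<epsilon> x) 0"
    have cont: "continuous_on (supp w) w"
      using w continuous_on_subset[OF smooth_on_continuous, of UNIV w "supp w"] by (simp add: test_function_def)
    obtain B where B: "\<And>x. x \<in> supp w \<Longrightarrow> \<bar>w x\<bar> \<le> B"
      using compact_imp_bounded[OF compact_continuous_image[OF cont K(1)]] by (auto simp: bounded_iff)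
    have "((\<lambda>\<epsilon>. \<bar>B\<bar> * - ?I \<epsilon>) \<longlongrightarrow> \<bar>B\<bar> * - 0) (at_right 0)"
      using nn K by (intro tendsto_intros) (auto simp: nonneg_net_def)
    then have lim: "((\<lambda>\<epsilon>. \<bar>B\<bar> * - ?I \<epsilon>) \<longlongrightarrow> 0) (at_right 0)" by simp
    have up: "\<forall>\<^sub>F \<epsilon> in at_right 0. norm (LINT x:N|lborel. min (u \<epsilon> x) 0 * w x) \<le> \<bar>B\<bar> * - ?I \<epsilon>"
    proof (rule eventually_mono[OF eventually_unit_interval])
      fix \<epsilon> :: real assume e1: "\<epsilon> \<in> {0<..1}"
      have i: "set_integrable lborel (supp w) (\<lambda>x. min (u \<epsilon> x) 0)"
        using set_integrable_negative_part[OF moderate_nets_smooth[OF u] K e1] .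
      have cu: "continuous_on (supp w) (u \<epsilon>)"
        using continuous_on_subset[OF smooth_net_continuous[OF moderate_nets_smooth[OF u] e1] K(2)] .
      have "norm (LINT x:supp w|lborel. min (u \<epsilon> x) 0 * w x) \<le> (LINT x:supp w|lborel. norm (min (u \<epsilon> x) 0 * w x))"
        by (rule set_integral_norm_bound[OF set_integrable_compact[OF K(1)
              continuous_on_mult[OF continuous_on_min[OF cu continuous_on_const] cont]]])
      also have "\<dots> \<le> (LINT x:supp w|lborel. (- \<bar>B\<bar>) * min (u \<epsilon> x) 0)"
      proof (rule set_integral_mono)
        show "set_integrable lborel (supp w) (\<lambda>x. norm (min (u \<epsilon> x) 0 * w x))"
          by (intro set_integrable_compact[OF K(1)] continuous_on_norm
              continuous_on_mult[OF continuous_on_min[OF cu continuous_on_const] cont])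
        show "set_integrable lborel (supp w) (\<lambda>x. (- \<bar>B\<bar>) * min (u \<epsilon> x) 0)"
          using i by (rule set_integrable_mult_right)
        fix x assume "x \<in> supp w"
        then have "\<bar>w x\<bar> \<le> \<bar>B\<bar>" using B[of x] by simp
        then have "\<bar>min (u \<epsilon> x) 0\<bar> * \<bar>w x\<bar> \<le> \<bar>min (u \<epsilon> x) 0\<bar> * \<bar>B\<bar>" by (rule mult_left_mono) simp
        then show "norm (min (u \<epsilon> x) 0 * w x) \<le> (- \<bar>B\<bar>) * min (u \<epsilon> x) 0"
          by (simp add: abs_mult mult.commute)
      qed
      also have "\<dots> = (- \<bar>B\<bar>) * ?I \<epsilon>" by (rule set_integral_mult_right)
      also have "\<dots> = \<bar>B\<bar> * - ?I \<epsilon>" by simp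
      finally show "norm (LINT x:N|lborel. min (u \<epsilon> x) 0 * w x) \<le> \<bar>B\<bar> * - ?I \<epsilon>"
        by (simp add: test_integral_on_support[OF w subset_refl K(2)])
    qed
    show ?thesis by (rule Lim_null_comparison[OF up lim])
  qed
  then show "gnonneg N (net_class N u)"
    unfolding gnonneg_def using net_eq_refl[OF N u] by blast
qed

section \<open>Uniform convergence of the embedded metric\<close>

lemma lborel_integral_affine:
  fixes h :: "pt \<Rightarrow> real"
  assumes c: "c \<noteq> 0" and h[measurable]: "h \<in> borel_measurable borel"
  shows "(LINT y|lborel. h y) = \<bar>c\<bar> ^ 4 * (LINT z|lborel. h (t + c *\<^sub>R z))"
proof -
  have "(LINT y|lborel. h y) =
      (LINT y|density (distr lborel borel (\<lambda>x. t + c *\<^sub>R x)) (\<lambda>_. \<bar>c\<bar> ^ DIM(pt)). h y)"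
    using lborel_affine[OF c, of t] by simp
  also have "\<dots> = (LINT z|lborel. \<bar>c\<bar> ^ 4 *\<^sub>R h (t + c *\<^sub>R z))"
    by (subst integral_density) (auto simp: integral_distr)
  finally show ?thesis by simp
qed

text \<open>The substitution \<open>y = x - \<epsilon> z\<close> cancels the factor \<open>\<epsilon>\<^sup>-\<^sup>4\<close> of the mollifier.\<close>

lemma convolve_rescaled:
  assumes "\<epsilon> > 0" "continuous_on UNIV L" "continuous_on UNIV (\<psi> \<epsilon>)"
  shows "convolve L (rho \<psi> \<epsilon>) x = (LINT z|lborel. L (x - \<epsilon> *\<^sub>R z) * \<psi> \<epsilon> z)"
proof -
  have "continuous_on UNIV (\<lambda>y. L y * rho \<psi> \<epsilon> (x - y))"
    unfolding rho_def using assms(1)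
    by (intro continuous_intros assms(2) continuous_on_compose2[OF assms(3)]) auto
  then have "(\<lambda>y. L y * rho \<psi> \<epsilon> (x - y)) \<in> borel_measurable borel"
    by (rule borel_measurable_continuous_onI)
  from lborel_integral_affine[OF _ this, of "- \<epsilon>" x] assms(1)
  have "convolve L (rho \<psi> \<epsilon>) x = \<epsilon> ^ 4 * (LINT z|lborel. L (x - \<epsilon> *\<^sub>R z) * rho \<psi> \<epsilon> (\<epsilon> *\<^sub>R z))"
    by (simp add: convolve_def)
  also have "\<dots> = (LINT z|lborel. \<epsilon> ^ 4 * (L (x - \<epsilon> *\<^sub>R z) * rho \<psi> \<epsilon> (\<epsilon> *\<^sub>R z)))" by simp
  also have "\<dots> = (LINT z|lborel. L (x - \<epsilon> *\<^sub>R z) * \<psi> \<epsilon> z)"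
    using assms(1) by (intro Bochner_Integration.integral_cong refl) (simp add: rho_def)
  finally show ?thesis .
qed

lemma integrable_times_supported:
  fixes f \<phi> :: "pt \<Rightarrow> real"
  assumes "continuous_on UNIV f" "continuous_on UNIV \<phi>" "supp \<phi> \<subseteq> ball 0 1"
  shows "integrable lborel (\<lambda>z. f z * \<phi> z)"
proof -
  have "integrable lborel (\<lambda>z. indicator (cball 0 1) z *\<^sub>R (f z * \<phi> z))"
    using assms(1,2)
    by (intro borel_integrable_compact compact_cball continuous_on_mult)
       (rule continuous_on_subset, assumption, simp)+
  moreover have "indicator (cball 0 1) z *\<^sub>R (f z * \<phi> z) = f z * \<phi> z" for z
  proof (cases "z \<in> cball 0 1")
    case False
    then have "z \<notin> supp \<phi>" using assms(3) by auto
    then have "\<phi> z = 0" by (rule test_function_zero_outside)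
    then show ?thesis by simp
  qed simp
  ultimately show ?thesis by (simp only:)
qed

text \<open>The rescaled mollifiers have mass one, bounded total variation and shrinking supports, and \<open>L\<close> is uniformly
  continuous near \<open>K\<close>.\<close>

lemma convolve_tendsto_uniformly:
  assumes L: "continuous_on UNIV L" and moll: "admissible_mollifier \<psi>" and K: "compact K" and "\<eta> > 0"
  shows "\<forall>\<^sub>F \<epsilon> in at_right 0. \<forall>x\<in>K. \<bar>convolve L (rho \<psi> \<epsilon>) x - L x\<bar> \<le> \<eta>"
proof -
  define S where "S = {x + y |x y. x \<in> K \<and> y \<in> cball 0 (1::real)}"
  have "compact S" unfolding S_def by (intro compact_sums K compact_cball)
  then have "uniformly_continuous_on S L"
    using continuous_on_subset[OF L] by (intro compact_uniformly_continuous) auto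
  then obtain d where d: "d > 0" "\<And>x x'. x \<in> S \<Longrightarrow> x' \<in> S \<Longrightarrow> dist x' x < d \<Longrightarrow> dist (L x') (L x) < \<eta> / 2"
    using \<open>\<eta> > 0\<close> unfolding uniformly_continuous_on_def by (metis half_gt_zero)
  obtain \<epsilon>0 where \<epsilon>0: "\<epsilon>0 > 0" "\<And>\<epsilon>. \<epsilon> \<in> {0<..1} \<Longrightarrow> \<epsilon> \<le> \<epsilon>0 \<Longrightarrow> (LINT x|lborel. \<bar>\<psi> \<epsilon> x\<bar>) \<le> 1 + 1"
    using moll unfolding admissible_mollifier_def by (metis zero_less_one)
  have "\<forall>\<^sub>F \<epsilon> in at_right 0. \<epsilon> \<in> {0<..<min \<epsilon>0 (min 1 d)}"
    using d(1) \<epsilon>0(1) by (intro eventually_at_right_real) simp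
  then show ?thesis
  proof (rule eventually_mono, intro ballI)
    fix \<epsilon> x assume e: "\<epsilon> \<in> {0<..<min \<epsilon>0 (min 1 d)}" and x: "x \<in> K"
    then have e1: "\<epsilon> \<in> {0<..1}" by auto
    have c\<psi>: "continuous_on UNIV (\<psi> \<epsilon>)" and s\<psi>: "supp (\<psi> \<epsilon>) \<subseteq> ball 0 1" and one: "(LINT x|lborel. \<psi> \<epsilon> x) = 1"
      using moll e1 by (auto simp: admissible_mollifier_def intro: smooth_on_continuous)
    have cL: "continuous_on UNIV (\<lambda>z. L (x - \<epsilon> *\<^sub>R z))"
      by (intro continuous_on_compose2[OF L] continuous_intros) auto
    have i1: "integrable lborel (\<lambda>z. L (x - \<epsilon> *\<^sub>R z) * \<psi> \<epsilon> z)"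
      by (rule integrable_times_supported[OF cL c\<psi> s\<psi>])
    have i2: "integrable lborel (\<lambda>z. L x * \<psi> \<epsilon> z)"
      by (rule integrable_times_supported[OF continuous_on_const c\<psi> s\<psi>])
    have i3: "integrable lborel (\<lambda>z. \<eta> / 2 * \<bar>\<psi> \<epsilon> z\<bar>)"
      using integrable_abs[OF integrable_times_supported[OF continuous_on_const c\<psi> s\<psi>, of 1]] by simp
    have "convolve L (rho \<psi> \<epsilon>) x - L x = (LINT z|lborel. L (x - \<epsilon> *\<^sub>R z) * \<psi> \<epsilon> z) - (LINT z|lborel. L x * \<psi> \<epsilon> z)"
      using convolve_rescaled[of \<epsilon> L \<psi> x] e L c\<psi> one by simp
    also have "\<dots> = (LINT z|lborel. L (x - \<epsilon> *\<^sub>R z) * \<psi> \<epsilon> z - L x * \<psi> \<epsilon> z)"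
      by (rule Bochner_Integration.integral_diff[OF i1 i2, symmetric])
    finally have "\<bar>convolve L (rho \<psi> \<epsilon>) x - L x\<bar> \<le> (LINT z|lborel. \<bar>L (x - \<epsilon> *\<^sub>R z) * \<psi> \<epsilon> z - L x * \<psi> \<epsilon> z\<bar>)"
      using integral_abs_bound by simp
    also have "\<dots> \<le> (LINT z|lborel. \<eta> / 2 * \<bar>\<psi> \<epsilon> z\<bar>)"
    proof (rule integral_mono[OF integrable_abs[OF Bochner_Integration.integrable_diff[OF i1 i2]] i3])
      fix z
      show "\<bar>L (x - \<epsilon> *\<^sub>R z) * \<psi> \<epsilon> z - L x * \<psi> \<epsilon> z\<bar> \<le> \<eta> / 2 * \<bar>\<psi> \<epsilon> z\<bar>"
      proof (cases "norm z < 1")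
        case True
        have n: "norm (\<epsilon> *\<^sub>R z) \<le> \<epsilon>" using True e by (simp add: mult_left_le)
        have n1: "norm (\<epsilon> *\<^sub>R z) \<le> 1" by (rule order_trans[OF n]) (use e in auto)
        have "x - \<epsilon> *\<^sub>R z \<in> S"
          unfolding S_def using x n1
          by (rule_tac CollectI, rule_tac exI[of _ x], rule_tac exI[of _ "- (\<epsilon> *\<^sub>R z)"])
            (simp del: norm_scaleR)
        moreover have "x \<in> S" unfolding S_def using x
          by (rule_tac CollectI, rule_tac exI[of _ x], rule_tac exI[of _ 0]) simp
        moreover have "dist (x - \<epsilon> *\<^sub>R z) x < d" using le_less_trans[OF n, of d] e by (simp add: dist_norm)
        ultimately have "\<bar>L (x - \<epsilon> *\<^sub>R z) - L x\<bar> \<le> \<eta> / 2"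
          using d(2)[of x "x - \<epsilon> *\<^sub>R z"] by (simp add: dist_real_def)
        then have "\<bar>L (x - \<epsilon> *\<^sub>R z) - L x\<bar> * \<bar>\<psi> \<epsilon> z\<bar> \<le> \<eta> / 2 * \<bar>\<psi> \<epsilon> z\<bar>" by (rule mult_right_mono) simp
        then show ?thesis by (simp add: abs_mult[symmetric] left_diff_distrib)
      next
        case False
        then have "z \<notin> supp (\<psi> \<epsilon>)" using s\<psi> by auto
        then have "\<psi> \<epsilon> z = 0" by (rule test_function_zero_outside)
        then show ?thesis by simp
      qed
    qed
    also have "\<dots> = \<eta> / 2 * (LINT z|lborel. \<bar>\<psi> \<epsilon> z\<bar>)" by simp
    also have "\<dots> \<le> \<eta> / 2 * 2" using \<epsilon>0(2)[OF e1] e \<open>\<eta> > 0\<close> by (intro mult_left_mono) auto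
    finally show "\<bar>convolve L (rho \<psi> \<epsilon>) x - L x\<bar> \<le> \<eta>" by simp
  qed
qed

lemma relatively_compact_neighbourhood:
  fixes K M :: "pt set"
  assumes "compact K" "open M" "K \<subseteq> M"
  obtains V c where "open V" "K \<subseteq> V" "compact (closure V)" "closure V \<subseteq> M" "test_function M c"
    "\<exists>Q. open Q \<and> closure V \<subseteq> Q \<and> (\<forall>x\<in>Q. c x = 1)"
proof -
  obtain b Q where b: "test_function M b" "K \<subseteq> Q" "\<And>x. x \<in> Q \<Longrightarrow> b x = 1"
    using cutoff_exists[OF assms] by metis
  define V where "V = {x. b x > 1 / 2}"
  have cb: "continuous_on UNIV b" using b(1) by (auto simp: test_function_def intro: smooth_on_continuous)
  have "open V" unfolding V_def by (intro open_Collect_less continuous_on_const cb)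
  moreover have "K \<subseteq> V" using b(2,3) by (force simp: V_def)
  moreover have cl: "closure V \<subseteq> supp b" unfolding supp_def V_def by (rule closure_mono) auto
  moreover have "supp b \<subseteq> M" "compact (supp b)" using b(1) by (auto simp: test_function_def)
  moreover have clc: "compact (closure V)"
    using cl \<open>compact (supp b)\<close> compact_Int_closed[of "supp b" "closure V"] by (simp add: Int_absorb1)
  moreover have clM: "closure V \<subseteq> M" using cl \<open>supp b \<subseteq> M\<close> by blast
  moreover obtain c Q' where "test_function M c" "open Q'" "closure V \<subseteq> Q'" "\<And>x. x \<in> Q' \<Longrightarrow> c x = 1"
    using cutoff_exists[OF clc assms(2) clM] by metis
  ultimately show thesis by (intro that[of V c]) auto
qed

text \<open>A neighbourhood and a cut-off function that the definition of the embedding admits; there the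
  mollified components represent the embedded metric.\<close>

lemma iota_null_near:
  assumes "open M" "compact K" "K \<subseteq> M"
  obtains V c where "open V" "K \<subseteq> V" "V \<subseteq> M" "test_function M c" "\<forall>x\<in>V. c x = 1"
    "\<forall>u\<in>iota \<psi> M g.
       (\<lambda>\<epsilon> x. u \<epsilon> x - (\<chi> i j. convolve (\<lambda>y. c y * g y $ i $ j) (rho \<psi> \<epsilon>) x)) \<in> null_nets V"
proof -
  obtain V c where V: "open V" "K \<subseteq> V" "compact (closure V)" "closure V \<subseteq> M" "test_function M c"
    and Q: "\<exists>Q. open Q \<and> closure V \<subseteq> Q \<and> (\<forall>x\<in>Q. c x = 1)"
    using relatively_compact_neighbourhood[OF assms(2,1,3)] by metis
  have "(\<lambda>\<epsilon> x. u \<epsilon> x - (\<chi> i j. convolve (\<lambda>y. c y * g y $ i $ j) (rho \<psi> \<epsilon>) x)) \<in> null_nets V"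
    if "u \<in> iota \<psi> M g" for u
    using that V Q unfolding iota_def negligible_lie(3)[OF V(1), symmetric] by blast
  moreover have "V \<subseteq> M" "\<forall>x\<in>V. c x = 1" using V(4) Q closure_subset[of V] by blast+
  ultimately show thesis by (intro that[OF V(1,2) _ V(5)] ballI) simp_all
qed

lemma iota_coherent:
  assumes M: "open M"
  shows "coherent M (iota \<psi> M g)"
  unfolding coherent_def
proof (intro ballI)
  fix u v assume uv: "u \<in> iota \<psi> M g" "v \<in> iota \<psi> M g"
  then have mod: "u \<in> moderate_nets M" "v \<in> moderate_nets M"
    by (simp_all add: iota_def moderate_lie[OF M])
  have "(\<lambda>\<epsilon> x. u \<epsilon> x - v \<epsilon> x) \<in> null_nets M"
  proof (rule null_nets_locally)
    show "smooth_net M (\<lambda>\<epsilon> x. u \<epsilon> x - v \<epsilon> x)"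
      using moderate_nets_diff[OF M mod] by (rule moderate_nets_smooth)
    fix K assume K: "compact K" "K \<subseteq> M"
    obtain V c where V: "open V" "K \<subseteq> V" "V \<subseteq> M" "test_function M c" "\<forall>x\<in>V. c x = 1"
      and null: "\<forall>u\<in>iota \<psi> M g.
       (\<lambda>\<epsilon> x. u \<epsilon> x - (\<chi> i j. convolve (\<lambda>y. c y * g y $ i $ j) (rho \<psi> \<epsilon>) x)) \<in> null_nets V"
      by (rule iota_null_near[OF M K])
    have "(\<lambda>\<epsilon> x. u \<epsilon> x - v \<epsilon> x) \<in> null_nets V"
      using null_nets_add[OF V(1) bspec[OF null uv(1)] null_nets_uminus[OF V(1) bspec[OF null uv(2)]]] by simp
    then show "\<exists>V. K \<subseteq> V \<and> (\<lambda>\<epsilon> x. u \<epsilon> x - v \<epsilon> x) \<in> null_nets V" using V(2) by blast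
  qed
  then show "net_eq M u v" using mod by (simp add: net_eq_def)
qed

text \<open>On the complement of the support of \<open>c\<close> the product vanishes, whatever \<open>f\<close> is there.\<close>

lemma continuous_on_cutoff:
  fixes f :: "pt \<Rightarrow> real"
  assumes "open M" "test_function M c" "continuous_on M f"
  shows "continuous_on UNIV (\<lambda>y. c y * f y)"
proof -
  have cc: "continuous_on UNIV c" using assms(2) by (auto simp: test_function_def intro: smooth_on_continuous)
  have "continuous_on M (\<lambda>y. c y * f y)"
    by (rule continuous_on_mult[OF continuous_on_subset[OF cc subset_UNIV] assms(3)])
  moreover have "continuous_on (- supp c) (\<lambda>y. c y * f y)"
  proof (subst continuous_on_cong[OF refl])
    show "c y * f y = 0" if "y \<in> - supp c" for y
      using that test_function_zero_outside[of y c] by simp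
  qed (rule continuous_on_const)
  moreover have "M \<union> - supp c = UNIV" using assms(2) by (auto simp: test_function_def)
  ultimately show ?thesis
    using continuous_on_open_Un[OF assms(1), of "- supp c"] by (simp add: supp_def open_Compl)
qed

lemma norm_tensor_le_sum: "norm (A :: tensor02) \<le> (\<Sum>i\<in>UNIV. \<Sum>j\<in>UNIV. \<bar>A $ i $ j\<bar>)"
proof -
  have "norm A \<le> (\<Sum>i\<in>UNIV. norm (A $ i))" by (simp add: norm_vec_def L2_set_le_sum)
  also have "\<dots> \<le> (\<Sum>i\<in>UNIV. \<Sum>j\<in>UNIV. \<bar>A $ i $ j\<bar>)"
    by (intro sum_mono norm_le_l1_cart)
  finally show ?thesis .
qed

lemma iota_tendsto_uniformly:
  assumes M: "open M" and moll: "admissible_mollifier \<psi>" and g: "continuous_on M g"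
    and u: "u \<in> iota \<psi> M g" and K: "compact K" "K \<subseteq> M" and "\<eta> > 0"
  shows "\<forall>\<^sub>F \<epsilon> in at_right 0. \<forall>x\<in>K. norm (u \<epsilon> x - g x) \<le> \<eta>"
proof -
  obtain V c where V: "open V" "K \<subseteq> V" "V \<subseteq> M" "test_function M c" "\<forall>x\<in>V. c x = 1"
    and null: "\<forall>u\<in>iota \<psi> M g.
       (\<lambda>\<epsilon> x. u \<epsilon> x - (\<chi> i j. convolve (\<lambda>y. c y * g y $ i $ j) (rho \<psi> \<epsilon>) x)) \<in> null_nets V"
    by (rule iota_null_near[OF M K])
  let ?w = "\<lambda>i j \<epsilon> x. convolve (\<lambda>y. c y * g y $ i $ j) (rho \<psi> \<epsilon>) x"
  have "continuous_on UNIV (\<lambda>y. c y * g y $ i $ j)" for i j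
    by (intro continuous_on_cutoff[OF M V(4)] continuous_intros g)
  \<comment> \<open>The \<open>16\<close> components together may use \<open>\<eta> / 2\<close>.\<close>
  then have "\<forall>\<^sub>F \<epsilon> in at_right 0. \<forall>x\<in>K. \<bar>?w i j \<epsilon> x - c x * g x $ i $ j\<bar> \<le> \<eta> / 32" for i j
    using \<open>\<eta> > 0\<close> by (intro convolve_tendsto_uniformly[OF _ moll K(1)]) auto
  then have "\<forall>\<^sub>F \<epsilon> in at_right 0. \<forall>i j. \<forall>x\<in>K. \<bar>?w i j \<epsilon> x - c x * g x $ i $ j\<bar> \<le> \<eta> / 32"
    by (simp add: eventually_all_finite)
  moreover have "\<forall>\<^sub>F \<epsilon> in at_right 0. \<forall>x\<in>K. norm (u \<epsilon> x - (\<chi> i j. ?w i j \<epsilon> x)) \<le> \<eta> / 2"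
    using \<open>\<eta> > 0\<close> by (intro null_nets_small[OF bspec[OF null u] K(1) V(2)]) simp
  ultimately show ?thesis
  proof (eventually_elim, intro ballI)
    fix \<epsilon> x assume w: "\<forall>i j. \<forall>x\<in>K. \<bar>?w i j \<epsilon> x - c x * g x $ i $ j\<bar> \<le> \<eta> / 32"
      and n: "\<forall>x\<in>K. norm (u \<epsilon> x - (\<chi> i j. ?w i j \<epsilon> x)) \<le> \<eta> / 2" and x: "x \<in> K"
    have "c x = 1" using V(2,5) x by blast
    then have "\<bar>?w i j \<epsilon> x - g x $ i $ j\<bar> \<le> \<eta> / 32" for i j using w x by force
    then have "(\<Sum>i\<in>UNIV. \<Sum>j\<in>UNIV. \<bar>((\<chi> i j. ?w i j \<epsilon> x) - g x) $ i $ j\<bar>)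
        \<le> (\<Sum>i\<in>(UNIV :: 4 set). \<Sum>j\<in>(UNIV :: 4 set). \<eta> / 32)"
      by (intro sum_mono) simp
    then have "norm ((\<chi> i j. ?w i j \<epsilon> x) - g x) \<le> \<eta> / 2"
      using norm_tensor_le_sum[of "(\<chi> i j. ?w i j \<epsilon> x) - g x"] by simp
    then show "norm (u \<epsilon> x - g x) \<le> \<eta>"
      using n x norm_triangle_ineq[of "u \<epsilon> x - (\<chi> i j. ?w i j \<epsilon> x)" "(\<chi> i j. ?w i j \<epsilon> x) - g x"] by force
  qed
qed

section \<open>Real powers of locally bounded positive nets\<close>

text \<open>The bounds need to hold for small \<open>\<epsilon>\<close> only, and how small may depend on \<open>K\<close>. So no single member of the
  net has to be positive on all of \<open>N\<close>.\<close>

definition locally_bounded_positive :: "pt set \<Rightarrow> real net \<Rightarrow> bool" where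
  "locally_bounded_positive N s \<longleftrightarrow> (\<forall>K. compact K \<longrightarrow> K \<subseteq> N \<longrightarrow>
     (\<exists>c>0. \<exists>C. \<forall>\<^sub>F \<epsilon> in at_right 0. \<forall>x\<in>K. c \<le> s \<epsilon> x \<and> s \<epsilon> x \<le> C))"

lemma locally_bounded_positiveE:
  assumes "locally_bounded_positive N s" "compact K" "K \<subseteq> N"
  obtains c C where "c > 0" "\<forall>\<^sub>F \<epsilon> in at_right 0. \<forall>x\<in>K. c \<le> s \<epsilon> x \<and> s \<epsilon> x \<le> C"
  using assms unfolding locally_bounded_positive_def by blast

lemma has_derivative_powr_dirderiv:
  fixes f :: "'a::real_normed_vector \<Rightarrow> real"
  assumes "f differentiable (at x)" "f x > 0"
  shows "((\<lambda>y. f y powr a) has_derivative (\<lambda>v. a * (f x powr (a - 1) * dirderiv v f x))) (at x)"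
proof -
  have "((\<lambda>t. t powr a) has_derivative (\<lambda>h. (a * f x powr (a - 1)) * h)) (at (f x))"
    using has_real_derivative_powr[OF assms(2), of a] by (simp add: has_field_derivative_def)
  from diff_chain_at[OF has_derivative_dirderiv[OF assms(1)] this]
  show ?thesis by (simp add: o_def mult.assoc)
qed

lemma smooth_net_powr:
  fixes Q :: "real net"
  assumes "open N" "smooth_net N Q" "\<And>\<epsilon> x. \<epsilon> \<in> {0<..1} \<Longrightarrow> x \<in> N \<Longrightarrow> Q \<epsilon> x > 0"
  shows "smooth_net N (\<lambda>\<epsilon> x. Q \<epsilon> x powr a)"
  unfolding smooth_net_def
proof
  fix \<epsilon> :: real assume "\<epsilon> \<in> {0<..1}"
  then show "smooth_on N (\<lambda>x. Q \<epsilon> x powr a)"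
    using assms by (intro smooth_on_compose[OF assms(1) open_greaterThan _ smooth_on_powr])
      (auto simp: smooth_net_def)
qed

lemma sup_bigo_powr_0:
  fixes Q :: "real net"
  assumes "c > 0" "\<forall>\<^sub>F \<epsilon> in at_right 0. \<forall>x\<in>K. c \<le> Q \<epsilon> x \<and> Q \<epsilon> x \<le> C"
  shows "sup_bigo K (\<lambda>\<epsilon> x. Q \<epsilon> x powr a) 0"
proof (rule sup_bigo_bounded)
  show "\<forall>\<^sub>F \<epsilon> in at_right 0. \<forall>x\<in>K. norm (Q \<epsilon> x powr a) \<le> max (c powr a) (C powr a)"
    using assms(2)
  proof (rule eventually_mono, intro ballI)
    fix \<epsilon> x assume "\<forall>x\<in>K. c \<le> Q \<epsilon> x \<and> Q \<epsilon> x \<le> C" "x \<in> K"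
    then have "c \<le> Q \<epsilon> x" "Q \<epsilon> x \<le> C" by auto
    then have "Q \<epsilon> x powr a \<le> c powr a \<or> Q \<epsilon> x powr a \<le> C powr a"
      using assms(1) powr_mono2[of a "Q \<epsilon> x" C] powr_mono2'[of a c "Q \<epsilon> x"] by (cases "a \<ge> 0") auto
    then show "norm (Q \<epsilon> x powr a) \<le> max (c powr a) (C powr a)" by auto
  qed
qed

text \<open>One induction over the order serves all exponents, since differentiation maps the power \<open>a\<close> to the
  power \<open>a - 1\<close>.\<close>

lemma moderate_nets_powr:
  assumes N: "open N" and Q: "Q \<in> moderate_nets N"
    and pos: "\<And>\<epsilon> x. \<epsilon> \<in> {0<..1} \<Longrightarrow> x \<in> N \<Longrightarrow> Q \<epsilon> x > 0" and lb: "locally_bounded_positive N Q"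
  shows "(\<lambda>\<epsilon> x. Q \<epsilon> x powr a) \<in> moderate_nets N"
proof (rule moderate_netsI)
  note sQ = moderate_nets_smooth[OF Q]
  show "smooth_net N (\<lambda>\<epsilon> x. Q \<epsilon> x powr a)" by (rule smooth_net_powr[OF N sQ pos])
  fix K k assume K: "compact K" "K \<subseteq> N"
  obtain c C where c: "c > 0" "\<forall>\<^sub>F \<epsilon> in at_right 0. \<forall>x\<in>K. c \<le> Q \<epsilon> x \<and> Q \<epsilon> x \<le> C"
    using locally_bounded_positiveE[OF lb K] .
  note b0 = sup_bigo_powr_0[OF c]
  show "\<exists>r. net_bound N K r k (\<lambda>\<epsilon> x. Q \<epsilon> x powr a)"
  proof (induction k arbitrary: a)
    case 0
    show ?case using b0 smooth_net_powr[OF N sQ pos] by (auto simp: net_bound_0)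
  next
    case (Suc k)
    obtain r where r: "net_bound N K r k (\<lambda>\<epsilon> x. Q \<epsilon> x powr (a - 1))" using Suc by blast
    obtain s where s: "net_bound N K s (Suc k) Q" using moderate_netsE[OF Q K] .
    have "net_bound N K (r + s) k (\<lambda>\<epsilon>. dirderiv v (\<lambda>x. Q \<epsilon> x powr a))" for v
    proof (subst net_bound_cong[OF N K(2)])
      fix \<epsilon> :: real and x assume "\<epsilon> \<in> {0<..1}" "x \<in> N"
      then show "dirderiv v (\<lambda>x. Q \<epsilon> x powr a) x = a * (Q \<epsilon> x powr (a - 1) * dirderiv v (Q \<epsilon>) x)"
        using pos smooth_net_differentiable[OF sQ]
        by (intro dirderiv_eq[OF has_derivative_powr_dirderiv]) auto
    next
      show "net_bound N K (r + s) k (\<lambda>\<epsilon> x. a * (Q \<epsilon> x powr (a - 1) * dirderiv v (Q \<epsilon>) x))"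
        using s by (intro net_bound_linear[OF N K bounded_linear_mult_right]
            net_bound_bilinear[OF N K bounded_bilinear_mult] r) (simp add: net_bound_Suc)
    qed
    then have "net_bound N K (min 0 (r + s)) k (\<lambda>\<epsilon>. dirderiv v (\<lambda>x. Q \<epsilon> x powr a))" for v
      by (rule net_bound_exponent_mono) simp
    moreover have "sup_bigo K (\<lambda>\<epsilon> x. Q \<epsilon> x powr a) (min 0 (r + s))"
      by (rule sup_bigo_exponent_mono[OF b0]) simp
    ultimately show ?case using smooth_net_powr[OF N sQ pos] net_bound_Suc by blast
  qed
qed

text \<open>Every derivative of \<open>d\<close> is a moderate multiple of \<open>d\<close>, so a bound on the values propagates to all orders.\<close>

lemma null_nets_linear_equation:
  fixes d :: "real net"
  assumes N: "open N" and d: "smooth_net N d"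
    and zeroth: "\<And>K r. compact K \<Longrightarrow> K \<subseteq> N \<Longrightarrow> sup_bigo K d r"
    and m: "\<And>v. m v \<in> moderate_nets N"
    and eq: "\<And>v \<epsilon> x. \<epsilon> \<in> {0<..1} \<Longrightarrow> x \<in> N \<Longrightarrow> dirderiv v (d \<epsilon>) x = m v \<epsilon> x * d \<epsilon> x"
  shows "d \<in> null_nets N"
proof (rule null_netsI[OF d])
  fix K k r assume K: "compact K" "K \<subseteq> N"
  show "net_bound N K r k d"
  proof (induction k arbitrary: r)
    case 0
    show ?case using d zeroth[OF K] by (simp add: net_bound_0)
  next
    case (Suc k)
    have "net_bound N K r k (\<lambda>\<epsilon>. dirderiv v (d \<epsilon>))" for v
    proof (subst net_bound_cong[OF N K(2)])
      show "dirderiv v (d \<epsilon>) x = m v \<epsilon> x * d \<epsilon> x" if "\<epsilon> \<in> {0<..1}" "x \<in> N" for \<epsilon> x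
        using eq[OF that] .
      obtain s where s: "net_bound N K s k (m v)" using moderate_netsE[OF m K] .
      from net_bound_bilinear[OF N K bounded_bilinear_mult s Suc[of "r - s"]]
      show "net_bound N K r k (\<lambda>\<epsilon> x. m v \<epsilon> x * d \<epsilon> x)" by simp
    qed
    then show ?case using d zeroth[OF K] net_bound_Suc by blast
  qed
qed

text \<open>As a function of \<open>\<epsilon>\<close>, \<open>flat_exp 0 \<epsilon> = exp (- 1 / \<epsilon>)\<close> tends to zero faster than every power.\<close>

lemma sup_bigo_flat_exp: "sup_bigo K (\<lambda>\<epsilon> x. flat_exp 0 \<epsilon>) r"
proof -
  obtain m :: nat where m: "r \<le> real m" using real_arch_simple by blast
  have "(flat_exp m \<longlongrightarrow> 0) (at_right 0)"
    using flat_exp_tendsto_0 by (simp add: filterlim_at_split)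
  from tendstoD[OF this zero_less_one]
  have "\<forall>\<^sub>F \<epsilon> in at_right 0. \<forall>x\<in>K. norm (flat_exp 0 \<epsilon>) \<le> 1 * \<epsilon> powr real m"
  proof (rule eventually_at_right_mono[rotated], intro ballI)
    fix \<epsilon> :: real assume "\<epsilon> \<in> {0<..1}" "dist (flat_exp m \<epsilon>) 0 < 1"
    then show "norm (flat_exp 0 \<epsilon>) \<le> 1 * \<epsilon> powr real m"
      by (simp add: flat_exp_def powr_realpow field_simps)
  qed
  then have "sup_bigo K (\<lambda>\<epsilon> x. flat_exp 0 \<epsilon>) (real m)" unfolding sup_bigo_def by blast
  then show ?thesis using m by (rule sup_bigo_exponent_mono)
qed

lemma null_nets_flat_exp: "open N \<Longrightarrow> (\<lambda>\<epsilon> x. flat_exp 0 \<epsilon>) \<in> null_nets N"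
proof (rule null_nets_linear_equation[where m = "\<lambda>v \<epsilon> x. 0"])
  assume N: "open N"
  show "(\<lambda>\<epsilon> x. 0) \<in> moderate_nets N" by (intro null_nets_moderate null_nets_zero N)
  show "dirderiv v (\<lambda>x. flat_exp 0 \<epsilon>) x = 0 * flat_exp 0 \<epsilon>" for v x :: pt and \<epsilon>
    using dirderiv_eq[OF has_derivative_const] by simp
qed (simp_all add: smooth_net_def smooth_on_const sup_bigo_flat_exp)

text \<open>The plain square root of \<open>s\<close> is not defined, since no \<open>s \<epsilon>\<close> has to be positive on all of \<open>N\<close>. Instead,
  with \<open>\<delta> = exp (- 1 / \<epsilon>)\<close>, the root \<open>f = Q\<^sup>1\<^sup>/\<^sup>4\<close> of \<open>Q = s\<^sup>2 + \<delta> > 0\<close> is smooth for every \<open>\<epsilon>\<close>. The error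
  \<open>d = f\<^sup>2 - s\<close> satisfies \<open>(f\<^sup>2 + s) d = \<delta>\<close>, so it is at most \<open>\<delta> / c\<close> where \<open>s \<ge> c > 0\<close>, and it solves the
  linear equation \<open>d' = - s' Q\<^sup>-\<^sup>1\<^sup>/\<^sup>2 d\<close>. Both together make it negligible.\<close>

lemma square_root_net:
  assumes N: "open N" and s: "s \<in> moderate_nets N" and lb: "locally_bounded_positive N s"
  obtains f where "f \<in> moderate_nets N"
    "\<And>K. compact K \<Longrightarrow> K \<subseteq> N \<Longrightarrow> sup_bigo K f 0"
    "(\<lambda>\<epsilon> x. f \<epsilon> x * f \<epsilon> x - s \<epsilon> x) \<in> null_nets N"
proof -
  define Q where "Q \<epsilon> x = s \<epsilon> x * s \<epsilon> x + flat_exp 0 \<epsilon>" for \<epsilon> x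
  have Q: "Q \<in> moderate_nets N"
    unfolding Q_def[abs_def]
    by (intro moderate_nets_add[OF N] moderate_nets_bilinear[OF N bounded_bilinear_mult] s
        null_nets_moderate[OF null_nets_flat_exp[OF N]])
  have pos: "Q \<epsilon> x > 0" if "\<epsilon> \<in> {0<..1}" for \<epsilon> x
    unfolding Q_def using that flat_exp_pos[of \<epsilon>] by (intro add_nonneg_pos) auto
  have Qlb: "locally_bounded_positive N Q"
    unfolding locally_bounded_positive_def
  proof (intro allI impI)
    fix K assume K: "compact K" "K \<subseteq> N"
    obtain c C where c: "c > 0" and ev: "\<forall>\<^sub>F \<epsilon> in at_right 0. \<forall>x\<in>K. c \<le> s \<epsilon> x \<and> s \<epsilon> x \<le> C"
      using locally_bounded_positiveE[OF lb K] .
    have "\<forall>\<^sub>F \<epsilon> in at_right 0. \<forall>x\<in>K. c * c \<le> Q \<epsilon> x \<and> Q \<epsilon> x \<le> C * C + 1"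
    proof (rule eventually_at_right_mono[OF _ ev], intro ballI conjI)
      fix \<epsilon> x assume e: "\<epsilon> \<in> {0<..1::real}" and b: "\<forall>x\<in>K. c \<le> s \<epsilon> x \<and> s \<epsilon> x \<le> C" and x: "x \<in> K"
      have "c \<le> s \<epsilon> x" "s \<epsilon> x \<le> C" using b x by auto
      then have "c * c \<le> s \<epsilon> x * s \<epsilon> x" "s \<epsilon> x * s \<epsilon> x \<le> C * C"
        using c by (intro mult_mono; simp)+
      moreover have "0 \<le> flat_exp 0 \<epsilon>" "flat_exp 0 \<epsilon> \<le> 1" using e by (auto simp: flat_exp_def)
      ultimately show "c * c \<le> Q \<epsilon> x" "Q \<epsilon> x \<le> C * C + 1" by (auto simp: Q_def)
    qed
    moreover have "c * c > 0" using c by simp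
    ultimately show "\<exists>c>0. \<exists>C. \<forall>\<^sub>F \<epsilon> in at_right 0. \<forall>x\<in>K. c \<le> Q \<epsilon> x \<and> Q \<epsilon> x \<le> C" by blast
  qed
  note powr = moderate_nets_powr[OF N Q pos Qlb]
  define f where "f \<epsilon> x = Q \<epsilon> x powr (1 / 4)" for \<epsilon> x
  define d where "d \<epsilon> x = Q \<epsilon> x powr (1 / 2) - s \<epsilon> x" for \<epsilon> x
  have dmod: "d \<in> moderate_nets N"
    unfolding d_def[abs_def] by (intro moderate_nets_diff[OF N] powr s)
  have "d \<in> null_nets N"
  proof (rule null_nets_linear_equation[OF N moderate_nets_smooth[OF dmod]])
    fix v
    let ?m = "\<lambda>\<epsilon> x. - (dirderiv v (s \<epsilon>) x * Q \<epsilon> x powr (- (1 / 2)))"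
    have ds: "(\<lambda>\<epsilon>. dirderiv v (s \<epsilon>)) \<in> moderate_nets N"
    proof (rule moderate_netsI[OF smooth_net_dirderiv[OF moderate_nets_smooth[OF s]]])
      fix K k assume K: "compact K" "K \<subseteq> N"
      obtain r where "net_bound N K r (Suc k) s" using moderate_netsE[OF s K] .
      then show "\<exists>r. net_bound N K r k (\<lambda>\<epsilon>. dirderiv v (s \<epsilon>))" unfolding net_bound_Suc by blast
    qed
    show "?m \<in> moderate_nets N"
      by (intro moderate_nets_uminus[OF N] moderate_nets_bilinear[OF N bounded_bilinear_mult] ds powr)
    fix \<epsilon> x assume e: "\<epsilon> \<in> {0<..1::real}" and x: "x \<in> N"
    have dif: "s \<epsilon> differentiable (at x)" "Q \<epsilon> differentiable (at x)"
      using smooth_net_differentiable[OF moderate_nets_smooth[OF s] e x]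
        smooth_net_differentiable[OF moderate_nets_smooth[OF Q] e x] .
    have "(Q \<epsilon> has_derivative (\<lambda>v. s \<epsilon> x * dirderiv v (s \<epsilon>) x + dirderiv v (s \<epsilon>) x * s \<epsilon> x)) (at x)"
      unfolding Q_def[abs_def]
      using has_derivative_add_const[OF has_derivative_bilinear_dirderiv[OF bounded_bilinear_mult dif(1) dif(1)]] .
    from dirderiv_eq[OF this, of v] have dQ: "dirderiv v (Q \<epsilon>) x = 2 * s \<epsilon> x * dirderiv v (s \<epsilon>) x" by simp
    let ?q = "Q \<epsilon> x powr (- (1 / 2))" and ?S = "Q \<epsilon> x powr (1 / 2)"
    have one: "?q * ?S = 1"
      using pos[OF e, of x] by (simp add: powr_add[symmetric])
    have "dirderiv v (d \<epsilon>) x = (1 / 2) * (Q \<epsilon> x powr (1 / 2 - 1) * dirderiv v (Q \<epsilon>) x) - dirderiv v (s \<epsilon>) x"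
      unfolding d_def[abs_def]
      by (rule dirderiv_eq[OF has_derivative_diff[OF has_derivative_powr_dirderiv[OF dif(2) pos[OF e]]
            has_derivative_dirderiv[OF dif(1)]]])
    also have "\<dots> = dirderiv v (s \<epsilon>) x * (?q * s \<epsilon> x) - dirderiv v (s \<epsilon>) x"
      by (simp add: dQ algebra_simps)
    also have "\<dots> = dirderiv v (s \<epsilon>) x * (?q * s \<epsilon> x) - dirderiv v (s \<epsilon>) x * (?q * ?S)"
      by (simp only: one mult_1_right)
    also have "\<dots> = ?m \<epsilon> x * (?S - s \<epsilon> x)" by algebra
    also have "?S - s \<epsilon> x = d \<epsilon> x" by (simp only: d_def)
    finally show "dirderiv v (d \<epsilon>) x = ?m \<epsilon> x * d \<epsilon> x" .
  next
    fix K r assume K: "compact K" "K \<subseteq> N"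
    obtain c C where c: "c > 0" and ev: "\<forall>\<^sub>F \<epsilon> in at_right 0. \<forall>x\<in>K. c \<le> s \<epsilon> x \<and> s \<epsilon> x \<le> C"
      using locally_bounded_positiveE[OF lb K] .
    obtain D where D: "\<forall>\<^sub>F \<epsilon> in at_right 0. \<forall>x\<in>K. norm (flat_exp 0 \<epsilon>) \<le> D * \<epsilon> powr r"
      using sup_bigo_flat_exp[of K r] unfolding sup_bigo_def by blast
    have "\<forall>\<^sub>F \<epsilon> in at_right 0. \<forall>x\<in>K. norm (d \<epsilon> x) \<le> (D / c) * \<epsilon> powr r"
      using ev D eventually_unit_interval
    proof (eventually_elim, intro ballI)
      fix \<epsilon> x assume b: "\<forall>x\<in>K. c \<le> s \<epsilon> x \<and> s \<epsilon> x \<le> C" and D: "\<forall>x\<in>K. norm (flat_exp 0 \<epsilon>) \<le> D * \<epsilon> powr r"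
        and e: "\<epsilon> \<in> {0<..1::real}" and x: "x \<in> K"
      define S where "S = Q \<epsilon> x powr (1 / 2)"
      have S: "S * S = s \<epsilon> x * s \<epsilon> x + flat_exp 0 \<epsilon>"
        using pos[OF e, of x] by (simp add: S_def powr_add[symmetric] Q_def)
      have S0: "S \<ge> 0" and cs: "c \<le> s \<epsilon> x" using b x by (auto simp: S_def)
      have prod: "(S + s \<epsilon> x) * d \<epsilon> x = flat_exp 0 \<epsilon>"
        using S by (simp add: d_def S_def[symmetric] algebra_simps)
      have "c * \<bar>d \<epsilon> x\<bar> \<le> (S + s \<epsilon> x) * \<bar>d \<epsilon> x\<bar>" using S0 cs by (intro mult_right_mono) auto
      also have "\<dots> = \<bar>(S + s \<epsilon> x) * d \<epsilon> x\<bar>" using S0 cs c by (simp add: abs_mult)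
      also have "\<dots> \<le> D * \<epsilon> powr r" using bspec[OF D x] by (simp add: prod)
      finally show "norm (d \<epsilon> x) \<le> (D / c) * \<epsilon> powr r" using c by (simp add: field_simps)
    qed
    then show "sup_bigo K d r" unfolding sup_bigo_def by blast
  qed
  then have "(\<lambda>\<epsilon> x. f \<epsilon> x * f \<epsilon> x - s \<epsilon> x) \<in> null_nets N"
    by (simp add: f_def d_def[abs_def] powr_add[symmetric])
  moreover have "f \<in> moderate_nets N" unfolding f_def[abs_def] by (rule powr)
  moreover have "sup_bigo K f 0" if K: "compact K" "K \<subseteq> N" for K
  proof -
    obtain c C where "c > 0" "\<forall>\<^sub>F \<epsilon> in at_right 0. \<forall>x\<in>K. c \<le> Q \<epsilon> x \<and> Q \<epsilon> x \<le> C"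
      using locally_bounded_positiveE[OF Qlb K] .
    then show ?thesis unfolding f_def[abs_def] by (rule sup_bigo_powr_0)
  qed
  ultimately show thesis by (intro that[of f])
qed

section \<open>The energy condition in diagonal coordinates\<close>

lemma bilin_add: "bilin A (u + v) w = bilin A u w + bilin A v w" "bilin A u (v + w) = bilin A u v + bilin A u w"
  by (simp_all add: bilin_eq_inner inner_add_left inner_add_right matrix_vector_right_distrib)

lemma bilin_scaleR: "bilin A (c *\<^sub>R v) w = c * bilin A v w" "bilin A v (c *\<^sub>R w) = c * bilin A v w"
  by (simp_all add: bilin_eq_inner matrix_vector_mult_scaleR)

lemma bilin_sum:
  "bilin A (\<Sum>i\<in>I. f i) w = (\<Sum>i\<in>I. bilin A (f i) w)" "bilin A v (\<Sum>i\<in>I. f i) = (\<Sum>i\<in>I. bilin A v (f i))"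
proof -
  have "linear (\<lambda>v. bilin A v w)" "linear (\<lambda>w. bilin A v w)" for v w
    by (auto intro!: linearI simp: bilin_add bilin_scaleR)
  then show "bilin A (\<Sum>i\<in>I. f i) w = (\<Sum>i\<in>I. bilin A (f i) w)"
    "bilin A v (\<Sum>i\<in>I. f i) = (\<Sum>i\<in>I. bilin A v (f i))"
    using linear_sum by blast+
qed

definition chart_component :: "pt set \<Rightarrow> (pt \<Rightarrow> pt) \<Rightarrow> tensor02 net \<Rightarrow> 4 \<Rightarrow> 4 \<Rightarrow> real net" where
  "chart_component W \<phi> s i j \<epsilon> x = bilin (s \<epsilon> x) (coord_field W \<phi> i x) (coord_field W \<phi> j x)"

lemma chart_component_moderate: "chart N W \<phi> \<Longrightarrow> s \<in> moderate_nets W \<Longrightarrow> chart_component W \<phi> s i j \<in> moderate_nets W"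
  unfolding chart_component_def[abs_def] by (rule moderate_component2)

lemma gcomp2_chart_component:
  "chart N W \<phi> \<Longrightarrow> coherent W S \<Longrightarrow> s \<in> S \<Longrightarrow> gcomp2 W \<phi> S i j = net_class W (chart_component W \<phi> s i j)"
  unfolding chart_component_def[abs_def] by (rule gcomp2_eq)

lemma gdiagonal_null:
  assumes "chart N W \<phi>" "coherent W S" "s \<in> S" "s \<in> moderate_nets W" "gdiagonal W \<phi> S" "i \<noteq> j"
  shows "chart_component W \<phi> s i j \<in> null_nets W"
proof -
  note W = chart_open[OF assms(1)]
  have "net_class W (chart_component W \<phi> s i j) = net_class W (\<lambda>\<epsilon> x. 0)"
    using assms gcomp2_chart_component[OF assms(1-3)] by (simp add: gdiagonal_def gzero_eq[OF W])
  then have "net_eq W (chart_component W \<phi> s i j) (\<lambda>\<epsilon> x. 0)"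
    using net_class_eq_iff[OF W chart_component_moderate[OF assms(1,4)] null_nets_moderate[OF null_nets_zero[OF W]]]
    by blast
  from net_eqD(3)[OF this] show ?thesis by simp
qed

lemma class_eq_gzero_iff:
  assumes "open W" "u \<in> moderate_nets W"
  shows "net_class W u = gzero W \<longleftrightarrow> u \<in> null_nets W"
proof -
  have 0: "(\<lambda>\<epsilon> x. 0 :: real) \<in> moderate_nets W"
    by (intro null_nets_moderate null_nets_zero assms)
  show ?thesis
    using net_class_eq_iff[OF assms 0] assms 0 by (simp add: gzero_eq[OF assms(1)] net_eq_def)
qed

lemma null_nets_sum:
  "open N \<Longrightarrow> finite I \<Longrightarrow> (\<And>i. i \<in> I \<Longrightarrow> u i \<in> null_nets N) \<Longrightarrow> (\<lambda>\<epsilon> x. \<Sum>i\<in>I. u i \<epsilon> x) \<in> null_nets N"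
  by (rule null_netsI)
     (simp_all add: net_bound_sum null_netsD smooth_net_def smooth_on_sum null_nets_smooth[unfolded smooth_net_def])

text \<open>Each off-diagonal term is the product of a moderate and a negligible net.\<close>

lemma null_nets_bilin_minus_diagonal:
  assumes ch: "chart N W \<phi>" and s: "s \<in> moderate_nets W"
    and diag: "\<And>i j. i \<noteq> j \<Longrightarrow> chart_component W \<phi> s i j \<in> null_nets W"
    and w: "\<And>i. w i \<in> moderate_nets W"
  shows "(\<lambda>\<epsilon> x. bilin (s \<epsilon> x) (\<Sum>i\<in>UNIV. w i \<epsilon> x *\<^sub>R coord_field W \<phi> i x) (\<Sum>i\<in>UNIV. w i \<epsilon> x *\<^sub>R coord_field W \<phi> i x)
      - (\<Sum>i\<in>UNIV. w i \<epsilon> x * w i \<epsilon> x * chart_component W \<phi> s i i \<epsilon> x)) \<in> null_nets W"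
proof -
  note W = chart_open[OF ch]
  let ?r = "\<lambda>i j \<epsilon> x. if i = j then 0 else w i \<epsilon> x * w j \<epsilon> x * chart_component W \<phi> s i j \<epsilon> x"
  have "?r i j \<in> null_nets W" for i j
  proof (cases "i = j")
    case True
    then show ?thesis using null_nets_zero[OF W] by simp
  next
    case False
    then show ?thesis
      using null_nets_bilinear_right[OF W bounded_bilinear_mult
          moderate_nets_bilinear[OF W bounded_bilinear_mult w[of i] w[of j]] diag[OF False]] by simp
  qed
  then have "(\<lambda>\<epsilon> x. \<Sum>i\<in>UNIV. \<Sum>j\<in>UNIV. ?r i j \<epsilon> x) \<in> null_nets W"
    by (intro null_nets_sum[OF W] finite)
  moreover have "(\<Sum>i\<in>UNIV. \<Sum>j\<in>UNIV. ?r i j \<epsilon> x) =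
      bilin (s \<epsilon> x) (\<Sum>i\<in>UNIV. w i \<epsilon> x *\<^sub>R coord_field W \<phi> i x) (\<Sum>i\<in>UNIV. w i \<epsilon> x *\<^sub>R coord_field W \<phi> i x)
      - (\<Sum>i\<in>UNIV. w i \<epsilon> x * w i \<epsilon> x * chart_component W \<phi> s i i \<epsilon> x)" for \<epsilon> x
  proof -
    have "(\<Sum>j\<in>UNIV. ?r i j \<epsilon> x) = (\<Sum>j\<in>UNIV. w i \<epsilon> x * w j \<epsilon> x * chart_component W \<phi> s i j \<epsilon> x)
        - w i \<epsilon> x * w i \<epsilon> x * chart_component W \<phi> s i i \<epsilon> x" for i
    proof -
      have "(\<Sum>j\<in>UNIV. ?r i j \<epsilon> x) = (\<Sum>j\<in>UNIV - {i}. w i \<epsilon> x * w j \<epsilon> x * chart_component W \<phi> s i j \<epsilon> x)"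
        by (rule sum.mono_neutral_cong_right) auto
      then show ?thesis by (simp add: sum_diff1)
    qed
    moreover have "bilin (s \<epsilon> x) (\<Sum>i\<in>UNIV. w i \<epsilon> x *\<^sub>R coord_field W \<phi> i x) (\<Sum>i\<in>UNIV. w i \<epsilon> x *\<^sub>R coord_field W \<phi> i x)
        = (\<Sum>i\<in>UNIV. \<Sum>j\<in>UNIV. w i \<epsilon> x * w j \<epsilon> x * chart_component W \<phi> s i j \<epsilon> x)"
      unfolding bilin_sum(1) bilin_scaleR(1) bilin_sum(2) bilin_scaleR(2) chart_component_def
      by (simp only: sum_distrib_left mult.assoc) (subst sum.swap, simp only: mult.left_commute)
    ultimately show ?thesis by (simp add: sum_subtractf)
  qed
  ultimately show ?thesis by simp
qed

lemma sum_0123: "(\<Sum>i\<in>(UNIV :: 4 set). f i) = f 0 + f 1 + f 2 + (f 3 :: 'a::comm_monoid_add)"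
proof -
  have "(4 :: 4) = 0" by simp
  then show ?thesis using sum_4[of f] by (simp only: ac_simps)
qed

text \<open>A continuous function has positive bounds on a compact set, and they survive a uniformly small
  perturbation.\<close>

lemma locally_bounded_positive_limit:
  assumes f: "continuous_on N f" and pos: "\<And>x. x \<in> N \<Longrightarrow> f x > 0"
    and lim: "\<And>K \<eta>. compact K \<Longrightarrow> K \<subseteq> N \<Longrightarrow> \<eta> > 0 \<Longrightarrow> \<forall>\<^sub>F \<epsilon> in at_right 0. \<forall>x\<in>K. \<bar>s \<epsilon> x - f x\<bar> \<le> \<eta>"
  shows "locally_bounded_positive N s"
  unfolding locally_bounded_positive_def
proof (intro allI impI)
  fix K assume K: "compact K" "K \<subseteq> N"
  show "\<exists>c>0. \<exists>C. \<forall>\<^sub>F \<epsilon> in at_right 0. \<forall>x\<in>K. c \<le> s \<epsilon> x \<and> s \<epsilon> x \<le> C"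
  proof (cases "K = {}")
    case True
    then show ?thesis by (auto intro: exI[of _ 1])
  next
    case False
    note fK = continuous_on_subset[OF f K(2)]
    obtain a where a: "a \<in> K" "\<And>y. y \<in> K \<Longrightarrow> f a \<le> f y"
      using continuous_attains_inf[OF K(1) False fK] by blast
    obtain b where b: "\<And>y. y \<in> K \<Longrightarrow> f y \<le> f b"
      using continuous_attains_sup[OF K(1) False fK] by blast
    have fa: "f a > 0" using pos a(1) K(2) by blast
    have "\<forall>\<^sub>F \<epsilon> in at_right 0. \<forall>x\<in>K. f a / 2 \<le> s \<epsilon> x \<and> s \<epsilon> x \<le> f b + f a / 2"
    proof (rule eventually_mono[OF lim[OF K, of "f a / 2"]])
      show "f a / 2 > 0" using fa by simp
      show "\<forall>x\<in>K. f a / 2 \<le> s \<epsilon> x \<and> s \<epsilon> x \<le> f b + f a / 2" if *: "\<forall>x\<in>K. \<bar>s \<epsilon> x - f x\<bar> \<le> f a / 2" for \<epsilon>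
      proof
        fix x assume "x \<in> K"
        with * a(2) b have "\<bar>s \<epsilon> x - f x\<bar> \<le> f a / 2" "f a \<le> f x" "f x \<le> f b" by auto
        then show "f a / 2 \<le> s \<epsilon> x \<and> s \<epsilon> x \<le> f b + f a / 2" unfolding abs_le_iff by linarith
      qed
    qed
    then show ?thesis using fa by (intro exI[of _ "f a / 2"] conjI exI[of _ "f b + f a / 2"]) simp_all
  qed
qed

lemma chart_component_tendsto_uniformly:
  assumes ch: "chart M W \<phi>" and K: "compact K" "K \<subseteq> W" and "\<eta> > 0"
    and lim: "\<And>\<eta>. \<eta> > 0 \<Longrightarrow> \<forall>\<^sub>F \<epsilon> in at_right 0. \<forall>x\<in>K. norm (u \<epsilon> x - g x) \<le> \<eta>"
  shows "\<forall>\<^sub>F \<epsilon> in at_right 0. \<forall>x\<in>K.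
     \<bar>chart_component W \<phi> u i j \<epsilon> x - bilin (g x) (coord_field W \<phi> i x) (coord_field W \<phi> j x)\<bar> \<le> \<eta>"
proof -
  have "\<exists>B>0. \<forall>x\<in>K. norm (coord_field W \<phi> i x) \<le> B" for i
  proof -
    have "bounded (coord_field W \<phi> i ` K)"
      using continuous_on_subset[OF smooth_on_continuous[OF smooth_on_coord_field[OF ch]] K(2)] K(1)
      by (intro compact_imp_bounded compact_continuous_image)
    then show ?thesis unfolding bounded_pos by blast
  qed
  then obtain B where B: "\<And>i. B i > 0" "\<And>i x. x \<in> K \<Longrightarrow> norm (coord_field W \<phi> i x) \<le> B i"
    by metis
  obtain D where D: "D > 0" "\<And>A v. norm ((A::tensor02) *v (v::pt)) \<le> norm A * norm v * D"
    using bounded_bilinear.pos_bounded[OF bounded_bilinear_matrix_vector] by blast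
  define \<delta> where "\<delta> = \<eta> / (B i * B j * D)"
  have \<delta>: "\<delta> > 0" using \<open>\<eta> > 0\<close> B(1) D(1) by (simp add: \<delta>_def)
  show ?thesis
  proof (rule eventually_mono[OF lim[OF \<delta>]], rule ballI)
    fix \<epsilon> x assume n: "\<forall>x\<in>K. norm (u \<epsilon> x - g x) \<le> \<delta>" and x: "x \<in> K"
    let ?E = "\<lambda>i. coord_field W \<phi> i x" and ?A = "u \<epsilon> x - g x"
    have "norm ?A * norm (?E j) * D \<le> \<delta> * B j * D"
      using n x B(1)[of j] B(2)[OF x, where i = j] D(1) \<delta> by (intro mult_right_mono mult_mono) auto
    then have 1: "norm (?A *v ?E j) \<le> \<delta> * B j * D" using D(2)[of ?A "?E j"] by linarith
    have "chart_component W \<phi> u i j \<epsilon> x - bilin (g x) (?E i) (?E j) = ?E i \<bullet> (?A *v ?E j)"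
      by (simp add: chart_component_def bilin_eq_inner matrix_vector_mult_diff_rdistrib inner_diff_right)
    also have "\<bar>\<dots>\<bar> \<le> norm (?E i) * norm (?A *v ?E j)" by (rule Cauchy_Schwarz_ineq2)
    also have "\<dots> \<le> B i * (\<delta> * B j * D)"
      using 1 B(1)[of i] B(2)[OF x, where i = i] by (intro mult_mono) auto
    also have "\<dots> = \<eta>" using B(1)[of i] B(1)[of j] D(1) by (simp add: \<delta>_def)
    finally show "\<bar>chart_component W \<phi> u i j \<epsilon> x - bilin (g x) (?E i) (?E j)\<bar> \<le> \<eta>" .
  qed
qed

lemma continuous_on_bilin:
  assumes "continuous_on W g" "continuous_on W v" "continuous_on W w"
  shows "continuous_on W (\<lambda>x. bilin (g x) (v x) (w x))"
  unfolding bilin_eq_inner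
  by (intro continuous_on_inner assms bounded_bilinear.continuous_on[OF bounded_bilinear_matrix_vector])

text \<open>If \<open>\<bar>X\<^sup>i\<bar> \<le> C\<close> on \<open>K\<close>, then the negative part of \<open>(X\<^sup>i)\<^sup>2 L\<close> is at most \<open>C\<^sup>2\<close> times that of \<open>L\<close>. Hence the
  fields with compactly bounded representatives satisfy the second requirement on lightlike fields, in every
  chart, for the components in another chart are bounded as well.\<close>

lemma locally_bounded_field_preserves_nonneg:
  assumes U: "open U" and v: "v \<in> moderate_nets U"
    and bd: "\<And>K. compact K \<Longrightarrow> K \<subseteq> U \<Longrightarrow> sup_bigo K v 0"
    and ch: "chart U W \<phi>" and L: "L \<in> G00 W" and nn: "gnonneg W L"
  shows "gnonneg W (gmult W (gmult W (gcomp1 W \<phi> (net_class U v) i) (gcomp1 W \<phi> (net_class U v) i)) L)"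
proof -
  note W = chart_open[OF ch] and WU = chart_subset[OF ch]
  obtain l where l: "l \<in> moderate_nets W" "L = net_class W l" using L by (auto simp: colombeau_lie[OF W])
  define \<xi> where "\<xi> \<epsilon> x = dirderiv (v \<epsilon> x) \<phi> x $ i" for \<epsilon> x
  have vW: "v \<in> moderate_nets W" using moderate_nets_subset[OF v WU] .
  have \<xi>: "\<xi> \<in> moderate_nets W"
    unfolding \<xi>_def[abs_def] using net_eqD(1)[OF net_eq_component1[OF ch net_eq_refl[OF W vW]]] .
  have "gcomp1 W \<phi> (net_class U v) i = net_class W \<xi>"
    unfolding \<xi>_def[abs_def]
    by (rule gcomp1_eq[OF ch coherent_subset[OF coherent_net_class[OF U] WU]])
       (simp add: net_eq_refl[OF U v])
  moreover have \<xi>\<xi>: "(\<lambda>\<epsilon> x. \<xi> \<epsilon> x * \<xi> \<epsilon> x) \<in> moderate_nets W"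
    and \<xi>l: "(\<lambda>\<epsilon> x. \<xi> \<epsilon> x * \<xi> \<epsilon> x * l \<epsilon> x) \<in> moderate_nets W"
    by (intro moderate_nets_bilinear[OF W bounded_bilinear_mult] \<xi> l(1))+
  ultimately have eq: "gmult W (gmult W (gcomp1 W \<phi> (net_class U v) i) (gcomp1 W \<phi> (net_class U v) i)) L
      = net_class W (\<lambda>\<epsilon> x. \<xi> \<epsilon> x * \<xi> \<epsilon> x * l \<epsilon> x)"
    by (simp only: l(2) gmult_eq[OF W] \<xi> \<xi>\<xi> l(1))
  have nl: "nonneg_net W l" using nn by (simp add: l(2) gnonneg_net_class[OF W l(1)])
  have "nonneg_net W (\<lambda>\<epsilon> x. \<xi> \<epsilon> x * \<xi> \<epsilon> x * l \<epsilon> x)"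
  proof (rule nonneg_net_lower_bound[OF moderate_nets_smooth[OF l(1)] moderate_nets_smooth[OF \<xi>l] nl])
    fix K assume K: "compact K" "K \<subseteq> W"
    have "net_bound W K 0 0 v"
      using bd[of K] K WU moderate_nets_smooth[OF vW] by (auto simp: net_bound_0)
    from net_bound_sup_bigo[OF net_bound_linear[OF W K bounded_linear_vec_nth
        net_bound_net_direction[OF W K chart_smooth[OF ch] this]]]
    have "sup_bigo K \<xi> 0" unfolding \<xi>_def[abs_def] .
    then obtain C where C: "C \<ge> 0" "\<forall>\<^sub>F \<epsilon> in at_right 0. \<forall>x\<in>K. norm (\<xi> \<epsilon> x) \<le> C * \<epsilon> powr 0"
      by (rule sup_bigoE)
    have "\<forall>\<^sub>F \<epsilon> in at_right 0. \<forall>x\<in>K. C * C * min (l \<epsilon> x) 0 - \<eta> \<le> \<xi> \<epsilon> x * \<xi> \<epsilon> x * l \<epsilon> x"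
      if "\<eta> > 0" for \<eta> :: real
    proof (rule eventually_at_right_mono[OF _ C(2)], rule ballI)
      fix \<epsilon> x assume e: "\<epsilon> \<in> {0<..1::real}" and n: "\<forall>x\<in>K. norm (\<xi> \<epsilon> x) \<le> C * \<epsilon> powr 0" and x: "x \<in> K"
      then have "\<bar>\<xi> \<epsilon> x\<bar> \<le> C" by force
      then have "\<bar>\<xi> \<epsilon> x\<bar> * \<bar>\<xi> \<epsilon> x\<bar> \<le> C * C" using C(1) by (intro mult_mono) auto
      then have "C * C * min (l \<epsilon> x) 0 \<le> \<xi> \<epsilon> x * \<xi> \<epsilon> x * min (l \<epsilon> x) 0"
        by (intro mult_right_mono_neg) (auto simp: abs_mult[symmetric])
      also have "\<dots> \<le> \<xi> \<epsilon> x * \<xi> \<epsilon> x * l \<epsilon> x" by (intro mult_left_mono) auto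
      finally show "C * C * min (l \<epsilon> x) 0 - \<eta> \<le> \<xi> \<epsilon> x * \<xi> \<epsilon> x * l \<epsilon> x" using that by simp
    qed
    then show "\<exists>C\<ge>0. \<forall>\<eta>>0. \<forall>\<^sub>F \<epsilon> in at_right 0. \<forall>x\<in>K. C * min (l \<epsilon> x) 0 - \<eta> \<le> \<xi> \<epsilon> x * \<xi> \<epsilon> x * l \<epsilon> x"
      using C(1) by (intro exI[of _ "C * C"]) auto
  qed
  then show ?thesis unfolding eq gnonneg_net_class[OF W \<xi>l] .
qed

text \<open>For the choice \<open>p = g\<^sub>\<nu>\<^sub>\<nu>\<close>, \<open>q = - g\<^sub>0\<^sub>0\<close> the value is \<open>S\<^sub>0\<^sub>0 g\<^sub>\<nu>\<^sub>\<nu> - S\<^sub>\<nu>\<^sub>\<nu> g\<^sub>0\<^sub>0\<close>. For \<open>S = g\<close> this is \<open>0\<close>, so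
  the field is lightlike; for \<open>S = T\<close> it is the expression in the energy condition.\<close>

lemma bilin_two_directions:
  assumes ch: "chart N W \<phi>" and s: "s \<in> moderate_nets W"
    and diag: "\<And>i j. i \<noteq> j \<Longrightarrow> chart_component W \<phi> s i j \<in> null_nets W"
    and a: "a \<in> moderate_nets W" "(\<lambda>\<epsilon> x. a \<epsilon> x * a \<epsilon> x - p \<epsilon> x) \<in> null_nets W"
    and b: "b \<in> moderate_nets W" "(\<lambda>\<epsilon> x. b \<epsilon> x * b \<epsilon> x - q \<epsilon> x) \<in> null_nets W"
    and "\<nu> \<noteq> 0"
  shows "(\<lambda>\<epsilon> x. bilin (s \<epsilon> x)
        (a \<epsilon> x *\<^sub>R coord_field W \<phi> 0 x + b \<epsilon> x *\<^sub>R coord_field W \<phi> \<nu> x)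
        (a \<epsilon> x *\<^sub>R coord_field W \<phi> 0 x + b \<epsilon> x *\<^sub>R coord_field W \<phi> \<nu> x)
      - (chart_component W \<phi> s 0 0 \<epsilon> x * p \<epsilon> x + chart_component W \<phi> s \<nu> \<nu> \<epsilon> x * q \<epsilon> x)) \<in> null_nets W"
proof -
  note W = chart_open[OF ch]
  let ?c = "chart_component W \<phi> s"
  have "(\<lambda>\<epsilon> x. (?c 0 0 \<epsilon> x * (a \<epsilon> x * a \<epsilon> x - p \<epsilon> x) + ?c \<nu> \<nu> \<epsilon> x * (b \<epsilon> x * b \<epsilon> x - q \<epsilon> x))
      + ((a \<epsilon> x * b \<epsilon> x) * ?c 0 \<nu> \<epsilon> x + (a \<epsilon> x * b \<epsilon> x) * ?c \<nu> 0 \<epsilon> x)) \<in> null_nets W"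
    using \<open>\<nu> \<noteq> 0\<close>
    by (intro null_nets_add[OF W] null_nets_bilinear_right[OF W bounded_bilinear_mult]
        moderate_nets_bilinear[OF W bounded_bilinear_mult] chart_component_moderate[OF ch s] diag a b) auto
  then show ?thesis
    by (rule null_nets_cong[OF W, rotated])
       (simp add: bilin_add bilin_scaleR chart_component_def algebra_simps)
qed

theorem theorem4p11:
  fixes M U :: "(real ^ 4) set"
    and \<psi> :: "real ^ 4 \<Rightarrow> real ^ 4"
    and g :: "real ^ 4 \<Rightarrow> real ^ 4 ^ 4"
    and T :: "(real \<Rightarrow> real ^ 4 \<Rightarrow> real ^ 4 ^ 4) set"
    and moll :: "real \<Rightarrow> real ^ 4 \<Rightarrow> real"
  assumes "open M" and "connected M"
    and "continuous_lorentz_metric M g"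
    and "admissible_mollifier moll"
    and "T \<in> G02 M"
    and "chart M U \<psi>"
    and "time_space_coordinates U \<psi> g"
    and "gdiagonal U \<psi> T"
    and "gdiagonal U \<psi> (iota moll M g)"
  shows "(\<forall>X \<in> lightlike_fields (iota moll M g) U. gnonneg U (geval2 U T X X)) \<longleftrightarrow>
         (\<forall>\<nu>\<in>{1, 2, 3}.
            gnonneg U (gdiff U
              (gmult U (gcomp2 U \<psi> T 0 0) (gcomp2 U \<psi> (iota moll M g) \<nu> \<nu>))
              (gmult U (gcomp2 U \<psi> T \<nu> \<nu>) (gcomp2 U \<psi> (iota moll M g) 0 0))))"
proof -
  let ?H = "iota moll M g"
  note ch = \<open>chart M U \<psi>\<close>
  note U = chart_open[OF ch] and UM = chart_subset[OF ch]
  have chU: "chart U U \<psi>" using ch by (simp add: chart_def)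
  have gc: "continuous_on M g" using assms(3) by (simp add: continuous_lorentz_metric_def)
  obtain t where t: "t \<in> moderate_nets M" "T = net_class M t"
    using assms(5) by (auto simp: colombeau_lie[OF assms(1)])
  have tT: "t \<in> T" using t net_eq_refl[OF assms(1)] by simp
  have cohT: "coherent U T"
    using coherent_subset[OF coherent_net_class[OF assms(1)] UM] t(2) by simp
  have cohH: "coherent U ?H" using coherent_subset[OF iota_coherent[OF assms(1)] UM] .
  \<comment> \<open>The diagonality hypothesis provides a representative: a component of an empty set would be empty.\<close>
  have "gcomp2 U \<psi> ?H 0 1 = gzero U" using assms(9) by (simp add: gdiagonal_def)
  moreover have "gzero U \<noteq> {}"
    using net_eq_refl[OF U null_nets_moderate[OF null_nets_zero[OF U]]] by (auto simp: gzero_eq[OF U])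
  ultimately have "?H \<noteq> {}" by (auto simp: gcomp2_def)
  then obtain h where h: "h \<in> ?H" by blast
  have tU: "t \<in> moderate_nets U" using moderate_nets_subset[OF t(1) UM] .
  have hU: "h \<in> moderate_nets U"
    using h moderate_lie(3)[OF assms(1)] moderate_nets_subset[OF _ UM] by (auto simp: iota_def)
  let ?t = "chart_component U \<psi> t" and ?h = "chart_component U \<psi> h" and ?E = "coord_field U \<psi>"
  have tm: "?t i j \<in> moderate_nets U" and hm: "?h i j \<in> moderate_nets U" for i j
    by (intro chart_component_moderate[OF ch] tU hU)+
  have toff: "?t i j \<in> null_nets U" if "i \<noteq> j" for i j
    using gdiagonal_null[OF ch cohT tT tU assms(8) that] .
  have hoff: "?h i j \<in> null_nets U" if "i \<noteq> j" for i j
    using gdiagonal_null[OF ch cohH h hU assms(9) that] .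
  let ?G = "\<lambda>i x. bilin (g x) (?E i x) (?E i x)"
  have Gc: "continuous_on U (?G i)" for i
    by (intro continuous_on_bilin continuous_on_subset[OF gc UM]
        smooth_on_continuous[OF smooth_on_coord_field[OF ch]])
  have Glim: "\<forall>\<^sub>F \<epsilon> in at_right 0. \<forall>x\<in>K. \<bar>?h i i \<epsilon> x - ?G i x\<bar> \<le> \<eta>"
    if "compact K" "K \<subseteq> U" "\<eta> > 0" for K \<eta> i
    using that UM
    by (intro chart_component_tendsto_uniformly[OF ch] iota_tendsto_uniformly[OF assms(1,4) gc h]) auto
  have space: "locally_bounded_positive U (?h \<nu> \<nu>)" if "\<nu> \<in> {1, 2, 3}" for \<nu>
    by (rule locally_bounded_positive_limit[OF Gc _ Glim])
       (use assms(7) that in \<open>unfold time_space_coordinates_def, blast+\<close>)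
  have time: "locally_bounded_positive U (\<lambda>\<epsilon> x. - ?h 0 0 \<epsilon> x)"
  proof (rule locally_bounded_positive_limit)
    show "continuous_on U (\<lambda>x. - ?G 0 x)" by (intro continuous_on_minus Gc)
    show "- ?G 0 x > 0" if "x \<in> U" for x using assms(7) that by (simp add: time_space_coordinates_def)
    show "\<forall>\<^sub>F \<epsilon> in at_right 0. \<forall>x\<in>K. \<bar>- ?h 0 0 \<epsilon> x - - ?G 0 x\<bar> \<le> \<eta>"
      if "compact K" "K \<subseteq> U" "\<eta> > 0" for K \<eta>
      using Glim[OF that, of 0] by (simp add: abs_minus_commute)
  qed
  define L where "L \<nu> \<epsilon> x = ?t 0 0 \<epsilon> x * ?h \<nu> \<nu> \<epsilon> x - ?t \<nu> \<nu> \<epsilon> x * ?h 0 0 \<epsilon> x" for \<nu> \<epsilon> x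
  have prodm: "(\<lambda>\<epsilon> x. ?t i i \<epsilon> x * ?h j j \<epsilon> x) \<in> moderate_nets U" for i j
    by (intro moderate_nets_bilinear[OF U bounded_bilinear_mult] tm hm)
  have Lm: "L \<nu> \<in> moderate_nets U" for \<nu>
    unfolding L_def[abs_def] by (intro moderate_nets_diff[OF U] prodm)
  have Lclass: "gdiff U (gmult U (gcomp2 U \<psi> T 0 0) (gcomp2 U \<psi> ?H \<nu> \<nu>))
              (gmult U (gcomp2 U \<psi> T \<nu> \<nu>) (gcomp2 U \<psi> ?H 0 0)) = net_class U (L \<nu>)" for \<nu>
    unfolding L_def[abs_def]
    by (simp only: gcomp2_chart_component[OF ch cohT tT] gcomp2_chart_component[OF ch cohH h] gmult_eq[OF U tm hm]
        gdiff_eq[OF U prodm prodm])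
  have evalT: "geval2 U T (net_class U v) (net_class U v) = net_class U (\<lambda>\<epsilon> x. bilin (t \<epsilon> x) (v \<epsilon> x) (v \<epsilon> x))"
    and evalH: "geval2 U ?H (net_class U v) (net_class U v) = net_class U (\<lambda>\<epsilon> x. bilin (h \<epsilon> x) (v \<epsilon> x) (v \<epsilon> x))"
    if "v \<in> moderate_nets U" for v
    using net_eq_refl[OF U that]
    by (intro geval2_eq[OF U cohT coherent_net_class[OF U] tT]
        geval2_eq[OF U cohH coherent_net_class[OF U] h]; simp)+
  show ?thesis
  proof
    assume energy: "\<forall>X \<in> lightlike_fields ?H U. gnonneg U (geval2 U T X X)"
    show "\<forall>\<nu>\<in>{1, 2, 3}. gnonneg U (gdiff U
              (gmult U (gcomp2 U \<psi> T 0 0) (gcomp2 U \<psi> ?H \<nu> \<nu>))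
              (gmult U (gcomp2 U \<psi> T \<nu> \<nu>) (gcomp2 U \<psi> ?H 0 0)))"
    proof
      fix \<nu> :: 4 assume \<nu>: "\<nu> \<in> {1, 2, 3}"
      then have \<nu>0: "\<nu> \<noteq> 0" by auto
      \<comment> \<open>The lightlike field is \<open>g\<^sub>\<nu>\<^sub>\<nu>\<^sup>1\<^sup>/\<^sup>2 \<partial>\<^sub>0 + (- g\<^sub>0\<^sub>0)\<^sup>1\<^sup>/\<^sup>2 \<partial>\<^sub>\<nu>\<close>.\<close>
      obtain a where a: "a \<in> moderate_nets U" "\<And>K. compact K \<Longrightarrow> K \<subseteq> U \<Longrightarrow> sup_bigo K a 0"
        "(\<lambda>\<epsilon> x. a \<epsilon> x * a \<epsilon> x - ?h \<nu> \<nu> \<epsilon> x) \<in> null_nets U"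
        using square_root_net[OF U hm space[OF \<nu>]] by blast
      obtain b where b: "b \<in> moderate_nets U" "\<And>K. compact K \<Longrightarrow> K \<subseteq> U \<Longrightarrow> sup_bigo K b 0"
        "(\<lambda>\<epsilon> x. b \<epsilon> x * b \<epsilon> x - - ?h 0 0 \<epsilon> x) \<in> null_nets U"
        using square_root_net[OF U moderate_nets_uminus[OF U hm] time] by blast
      define v where "v \<epsilon> x = a \<epsilon> x *\<^sub>R ?E 0 x + b \<epsilon> x *\<^sub>R ?E \<nu> x" for \<epsilon> x
      have Em: "(\<lambda>\<epsilon>. ?E i) \<in> moderate_nets U" for i
        by (intro moderate_nets_fixed[OF U] smooth_on_coord_field[OF ch])
      have vm: "v \<in> moderate_nets U"
        unfolding v_def[abs_def]
        by (intro moderate_nets_add[OF U] moderate_nets_bilinear[OF U bounded_bilinear_scaleR] a b Em)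
      have vb: "sup_bigo K v 0" if K: "compact K" "K \<subseteq> U" for K
      proof -
        have "net_bound U K 0 0 a" "net_bound U K 0 0 b"
          using a b K by (auto simp: net_bound_0 moderate_nets_smooth)
        then have "net_bound U K 0 0 v"
          unfolding v_def[abs_def]
          by (intro net_bound_add[OF U K] net_bound_fixed_right[OF U K bounded_bilinear_scaleR]
              smooth_on_coord_field[OF ch])
        then show ?thesis by (rule net_bound_sup_bigo)
      qed
      have "(\<lambda>\<epsilon> x. bilin (h \<epsilon> x) (v \<epsilon> x) (v \<epsilon> x)) \<in> null_nets U"
        using bilin_two_directions[OF ch hU hoff a(1,3) b(1,3) \<nu>0] by (simp add: v_def mult.commute)
      then have "geval2 U ?H (net_class U v) (net_class U v) = gzero U"
        unfolding evalH[OF vm] by (simp add: class_eq_gzero_iff[OF U] null_nets_moderate)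
      moreover have "net_class U v \<in> G10 U" using vm by (simp add: colombeau_lie[OF U])
      ultimately have "net_class U v \<in> lightlike_fields ?H U"
        unfolding lightlike_fields_def
        using locally_bounded_field_preserves_nonneg[OF U vm vb] by simp
      then have "gnonneg U (geval2 U T (net_class U v) (net_class U v))" using energy by blast
      then have nn: "nonneg_net U (\<lambda>\<epsilon> x. bilin (t \<epsilon> x) (v \<epsilon> x) (v \<epsilon> x))"
        unfolding evalT[OF vm] by (simp add: gnonneg_net_class[OF U] moderate_bilin[OF U] tU vm)
      have "(\<lambda>\<epsilon> x. bilin (t \<epsilon> x) (v \<epsilon> x) (v \<epsilon> x) - L \<nu> \<epsilon> x) \<in> null_nets U"
        using bilin_two_directions[OF ch tU toff a(1,3) b(1,3) \<nu>0] by (simp add: v_def L_def)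
      then have "net_eq U (\<lambda>\<epsilon> x. bilin (t \<epsilon> x) (v \<epsilon> x) (v \<epsilon> x)) (L \<nu>)"
        by (simp add: net_eq_def Lm moderate_bilin[OF U] tU vm)
      then have "nonneg_net U (L \<nu>)" using nonneg_net_eq[OF U _ nn] by blast
      then show "gnonneg U (gdiff U
              (gmult U (gcomp2 U \<psi> T 0 0) (gcomp2 U \<psi> ?H \<nu> \<nu>))
              (gmult U (gcomp2 U \<psi> T \<nu> \<nu>) (gcomp2 U \<psi> ?H 0 0)))"
        unfolding Lclass gnonneg_net_class[OF U Lm] .
    qed
  next
    assume cond: "\<forall>\<nu>\<in>{1, 2, 3}. gnonneg U (gdiff U
              (gmult U (gcomp2 U \<psi> T 0 0) (gcomp2 U \<psi> ?H \<nu> \<nu>))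
              (gmult U (gcomp2 U \<psi> T \<nu> \<nu>) (gcomp2 U \<psi> ?H 0 0)))"
    show "\<forall>X \<in> lightlike_fields ?H U. gnonneg U (geval2 U T X X)"
    proof
      fix X assume X: "X \<in> lightlike_fields ?H U"
      then obtain v where vm: "v \<in> moderate_nets U" and Xv: "X = net_class U v"
        unfolding lightlike_fields_def by (auto simp: colombeau_lie[OF U])
      define w where "w i \<epsilon> x = dirderiv (v \<epsilon> x) \<psi> x $ i" for i \<epsilon> x
      have wm: "w i \<in> moderate_nets U" for i
        unfolding w_def[abs_def] using net_eqD(1)[OF net_eq_component1[OF ch net_eq_refl[OF U vm]]] .
      have decomp: "(\<Sum>i\<in>UNIV. w i \<epsilon> x *\<^sub>R ?E i x) = v \<epsilon> x" if "x \<in> U" for \<epsilon> x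
        using coord_field_decomposition[OF ch that] by (simp add: w_def)
      have wclass: "gcomp1 U \<psi> X i = net_class U (w i)" for i
        unfolding w_def[abs_def] Xv
        by (rule gcomp1_eq[OF ch coherent_net_class[OF U]]) (simp add: net_eq_refl[OF U vm])
      have wwm: "(\<lambda>\<epsilon> x. w i \<epsilon> x * w i \<epsilon> x) \<in> moderate_nets U"
        and wLm: "(\<lambda>\<epsilon> x. w i \<epsilon> x * w i \<epsilon> x * L i \<epsilon> x) \<in> moderate_nets U" for i
        by (intro moderate_nets_bilinear[OF U bounded_bilinear_mult] wm Lm)+
      have nnL: "nonneg_net U (\<lambda>\<epsilon> x. w \<nu> \<epsilon> x * w \<nu> \<epsilon> x * L \<nu> \<epsilon> x)" if "\<nu> \<in> {1, 2, 3}" for \<nu>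
      proof -
        have "gnonneg U (net_class U (L \<nu>))" using cond that unfolding Lclass by blast
        moreover have "net_class U (L \<nu>) \<in> G00 U" using Lm by (simp add: colombeau_lie[OF U])
        ultimately have "gnonneg U (gmult U (gmult U (gcomp1 U \<psi> X \<nu>) (gcomp1 U \<psi> X \<nu>)) (net_class U (L \<nu>)))"
          using X chU unfolding lightlike_fields_def by blast
        then show ?thesis
          by (simp only: wclass gmult_eq[OF U wm wm] gmult_eq[OF U wwm Lm] gnonneg_net_class[OF U wLm])
      qed
      \<comment> \<open>\<open>- g\<^sub>0\<^sub>0 T(X,X)\<close> agrees with \<open>u\<close> up to the negligible net \<open>n\<close> below; dividing by \<open>- g\<^sub>0\<^sub>0\<close>, which is bounded away
          from \<open>0\<close> on compact sets, transfers non-negativity from \<open>u\<close> to \<open>T(X,X)\<close>.\<close>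
      define u where "u \<epsilon> x = w 1 \<epsilon> x * w 1 \<epsilon> x * L 1 \<epsilon> x + w 2 \<epsilon> x * w 2 \<epsilon> x * L 2 \<epsilon> x
        + w 3 \<epsilon> x * w 3 \<epsilon> x * L 3 \<epsilon> x" for \<epsilon> x
      have um: "u \<in> moderate_nets U"
        unfolding u_def[abs_def] by (intro moderate_nets_add[OF U] wLm)
      have nnu: "nonneg_net U u"
        unfolding u_def[abs_def]
        by (intro nonneg_net_add[OF _ _ U] nnL smooth_net_add[OF U] moderate_nets_smooth[OF wLm]) simp_all
      let ?\<tau> = "\<lambda>\<epsilon> x. bilin (t \<epsilon> x) (v \<epsilon> x) (v \<epsilon> x)" and ?\<gamma> = "\<lambda>\<epsilon> x. bilin (h \<epsilon> x) (v \<epsilon> x) (v \<epsilon> x)"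
      have \<tau>m: "?\<tau> \<in> moderate_nets U" and \<gamma>m: "?\<gamma> \<in> moderate_nets U"
        by (intro moderate_bilin[OF U] tU hU vm)+
      have "geval2 U ?H X X = gzero U" using X by (simp add: lightlike_fields_def)
      then have \<gamma>0: "?\<gamma> \<in> null_nets U"
        unfolding Xv evalH[OF vm] class_eq_gzero_iff[OF U \<gamma>m] .
      define n where "n \<epsilon> x = - ?h 0 0 \<epsilon> x * ?\<tau> \<epsilon> x - u \<epsilon> x" for \<epsilon> x
      have diag: "(\<lambda>\<epsilon> x. bilin (s \<epsilon> x) (v \<epsilon> x) (v \<epsilon> x)
          - (\<Sum>i\<in>UNIV. w i \<epsilon> x * w i \<epsilon> x * chart_component U \<psi> s i i \<epsilon> x)) \<in> null_nets U"
        if "s \<in> moderate_nets U" "\<And>i j. i \<noteq> j \<Longrightarrow> chart_component U \<psi> s i j \<in> null_nets U" for s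
        by (rule null_nets_cong[OF U _ null_nets_bilin_minus_diagonal[where w = w, OF ch that wm]]) (simp_all add: decomp)
      \<comment> \<open>In diagonal form \<open>- g\<^sub>0\<^sub>0 T(X,X) - u = - T\<^sub>0\<^sub>0 g(X,X)\<close>, and \<open>g(X,X)\<close> is negligible.\<close>
      have "n \<in> null_nets U"
      proof (rule null_nets_cong[OF U])
        let ?dt = "\<lambda>\<epsilon> x. ?\<tau> \<epsilon> x - (\<Sum>i\<in>UNIV. w i \<epsilon> x * w i \<epsilon> x * ?t i i \<epsilon> x)"
          and ?dh = "\<lambda>\<epsilon> x. ?\<gamma> \<epsilon> x - (\<Sum>i\<in>UNIV. w i \<epsilon> x * w i \<epsilon> x * ?h i i \<epsilon> x)"
        show "(\<lambda>\<epsilon> x. (- ?h 0 0 \<epsilon> x * ?dt \<epsilon> x + ?t 0 0 \<epsilon> x * ?dh \<epsilon> x) + - ?t 0 0 \<epsilon> x * ?\<gamma> \<epsilon> x) \<in> null_nets U"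
          by (intro null_nets_add[OF U] null_nets_bilinear_right[OF U bounded_bilinear_mult]
              moderate_nets_uminus[OF U] tm hm diag[OF tU toff] diag[OF hU hoff] \<gamma>0)
        show "(- ?h 0 0 \<epsilon> x * ?dt \<epsilon> x + ?t 0 0 \<epsilon> x * ?dh \<epsilon> x) + - ?t 0 0 \<epsilon> x * ?\<gamma> \<epsilon> x = n \<epsilon> x" for \<epsilon> x
          unfolding n_def u_def L_def sum_0123 by (simp add: algebra_simps)
      qed
      have "nonneg_net U ?\<tau>"
      proof (rule nonneg_net_lower_bound[OF moderate_nets_smooth[OF um] moderate_nets_smooth[OF \<tau>m] nnu])
        fix K assume K: "compact K" "K \<subseteq> U"
        obtain c C where c: "c > 0" and ev: "\<forall>\<^sub>F \<epsilon> in at_right 0. \<forall>x\<in>K. c \<le> - ?h 0 0 \<epsilon> x \<and> - ?h 0 0 \<epsilon> x \<le> C"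
          using locally_bounded_positiveE[OF time K] .
        have "\<forall>\<^sub>F \<epsilon> in at_right 0. \<forall>x\<in>K. (1 / c) * min (u \<epsilon> x) 0 - \<eta> \<le> ?\<tau> \<epsilon> x" if "\<eta> > 0" for \<eta> :: real
        proof -
          have "\<forall>\<^sub>F \<epsilon> in at_right 0. \<forall>x\<in>K. norm (n \<epsilon> x) \<le> c * \<eta>"
            using c that by (intro null_nets_small[OF \<open>n \<in> null_nets U\<close> K]) simp
          with ev show ?thesis
          proof (eventually_elim, intro ballI)
            fix \<epsilon> x assume "\<forall>x\<in>K. c \<le> - ?h 0 0 \<epsilon> x \<and> - ?h 0 0 \<epsilon> x \<le> C" "\<forall>x\<in>K. norm (n \<epsilon> x) \<le> c * \<eta>" "x \<in> K"
            then have k: "c \<le> - ?h 0 0 \<epsilon> x" and n: "\<bar>n \<epsilon> x\<bar> \<le> c * \<eta>" by auto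
            define y where "y = min (u \<epsilon> x) 0 - c * \<eta>"
            have y0: "y \<le> 0"
              unfolding y_def using mult_pos_pos[OF c that] min.cobounded2[of "u \<epsilon> x" 0] by linarith
            have "y \<le> - ?h 0 0 \<epsilon> x * ?\<tau> \<epsilon> x" using n by (auto simp: n_def y_def)
            then have "y / - ?h 0 0 \<epsilon> x \<le> ?\<tau> \<epsilon> x" using k c by (simp add: field_simps)
            moreover have "y / c \<le> y / - ?h 0 0 \<epsilon> x"
              using k c by (intro divide_left_mono_neg[OF k y0] mult_pos_pos) simp_all
            moreover have "y / c = (1 / c) * min (u \<epsilon> x) 0 - \<eta>" using c by (simp add: y_def field_simps)
            ultimately show "(1 / c) * min (u \<epsilon> x) 0 - \<eta> \<le> ?\<tau> \<epsilon> x" by linarith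
          qed
        qed
        then show "\<exists>C\<ge>0. \<forall>\<eta>>0. \<forall>\<^sub>F \<epsilon> in at_right 0. \<forall>x\<in>K. C * min (u \<epsilon> x) 0 - \<eta> \<le> ?\<tau> \<epsilon> x"
          using c by (intro exI[of _ "1 / c"]) auto
      qed
      then show "gnonneg U (geval2 U T X X)"
        unfolding Xv evalT[OF vm] gnonneg_net_class[OF U \<tau>m] .
    qed
  qed
qed

end
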